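(* If $G$ is a connected claw-free graph of order $n > 14$, then $\gamma_t^d(G) \le 4n/7$, with equality if and only if $G \in \mathcal{H}$.
   Context: All graphs are finite and simple; claw-free means no induced $K_{1,3}$. For a graph $G$ with no isolated vertex, a set $S \subseteq V(G)$ is a disjunctive total dominating set if every vertex of $G$ either is adjacent to a vertex of $S$ or has at least two vertices of $S$ at distance exactly $2$ from it; $\gamma_t^d(G)$ is the minimum cardinality of such a set. For $t \ge 1$, $H_t$ is the graph obtained from a complete graph $K_t$ by, for each vertex $v$ of $K_t$, adding a new path $P_6$ (on six vertices) and joining $v$ to the two central vertices of that path; $\mathcal{H} = \{H_t : t \ge 1\}$. *)

theory Defs
  imports "Graph_Theory.Graph_Theory"
begin

text \<open>
  A finite simple graph is a \<^locale>\<open>graph\<close> of the digraph library: a finite symmetric digraph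
  without loops and parallel arcs. Adjacency of \<open>u\<close> and \<open>v\<close> is \<open>u \<rightarrow>\<^bsub>G\<^esub> v\<close>.
\<close>

definition claw_free :: "('a, 'b) pre_digraph \<Rightarrow> bool" where
  "claw_free G \<longleftrightarrow> \<not> (\<exists>H. induced_subgraph H G \<and> K\<^bsub>1,3\<^esub> H)"

definition graph_dist :: "('a, 'b) pre_digraph \<Rightarrow> 'a \<Rightarrow> 'a \<Rightarrow> ereal" where
  "graph_dist G u v = wf_digraph.\<mu> G (\<lambda>_. 1) u v"

definition disj_total_dominating :: "('a, 'b) pre_digraph \<Rightarrow> 'a set \<Rightarrow> bool" where
  "disj_total_dominating G S \<longleftrightarrow> S \<subseteq> verts G \<and>
     (\<forall>v \<in> verts G. (\<exists>u \<in> S. v \<rightarrow>\<^bsub>G\<^esub> u) \<or> card {u \<in> S. graph_dist G v u = 2} \<ge> 2)"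

text \<open>
  Meaningful for finite graphs without isolated vertices: there the whole vertex set is
  disjunctive total dominating, so the minimum is taken over a nonempty finite set.
\<close>

definition disj_total_dom_number :: "('a, 'b) pre_digraph \<Rightarrow> nat" where
  "disj_total_dom_number G = Min (card ` {S. disj_total_dominating G S})"

text \<open>
  \<open>Clique_Vert i\<close> is the \<open>i\<close>-th vertex of the complete graph, and
  \<open>Path_Vert i 0, \<dots>, Path_Vert i 5\<close> are the consecutive vertices of the path attached to it,
  with central vertices \<open>Path_Vert i 2\<close> and \<open>Path_Vert i 3\<close>.
  The postfix operator in \<open>R\<^sup>s\<close> is the symmetric closure.
\<close>

datatype h_vert = Clique_Vert nat | Path_Vert nat nat

definition H_graph :: "nat \<Rightarrow> h_vert pair_pre_digraph" where
  "H_graph t =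
    \<lparr> pverts = {Clique_Vert i | i. i < t} \<union> {Path_Vert i j | i j. i < t \<and> j < 6},
      parcs =
        ({(Clique_Vert i, Clique_Vert k) | i k. i < t \<and> k < t \<and> i \<noteq> k} \<union>
         {(Path_Vert i j, Path_Vert i (Suc j)) | i j. i < t \<and> Suc j < 6} \<union>
         {(Clique_Vert i, Path_Vert i j) | i j. i < t \<and> j \<in> {2, 3}})\<^sup>s \<rparr>"

text \<open>The family is closed under isomorphism, so that its members may have arbitrary vertex types.\<close>

definition H_family :: "('a, 'b) pre_digraph set" where
  "H_family = {G. \<exists>t \<ge> 1. digraph_iso (with_proj (H_graph t)) G}"

end

theory Submission
  imports Defs
begin

text \<open>
  Replacing exact distance two by a walk of length two makes domination monotone under adding
  vertices and edges, so the domination numbers of the parts of a vertex partition add up to an upper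
  bound. Call a connected set \<^emph>\<open>good\<close> if it can be dominated with fewer than four sevenths of its size.
  By induction, every connected set of order at least 7 is good, or splits into connected 7-sets each
  dominated by four vertices, or is one exceptional graph of order 10 (a triangle with pendant paths
  of orders 2, 2 and 3). For the induction step take a minimal connected part of order at
  least 7 with connected complement: either both parts are handled by induction, or some vertex
  \<open>v\<close> has at most three branches, each of order at most 6. A depth-first search tree in a
  claw-free graph has at most two children per vertex, so small branches have few possible shapes
  and the finitely many cases are checked by evaluation.

  If equality holds, the graph splits into 7-sets, and no union of \<open>j\<close> of them is dominated by
  fewer than \<open>4 j\<close> vertices. Inspecting how a 7-set can be attached to an outside vertex leaves
  only \<open>H\<^sub>1\<close> attached at its clique vertex and a 7-vertex path attached at two consecutive
  vertices. Three or more parts exclude the latter, and claw-freeness turns the clique vertices into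
  a complete graph.
\<close>

section \<open>Shapes of small rooted pieces\<close>

text \<open>The argument is shaped by rounding. A part of order m may use fewer than 4m/7 vertices,
  and below 7 the only order at which a connected part with a neighbour outside always achieves this
  is 4, with two vertices. A partition is therefore useful only if both parts have order 4 or at
  least 7, and what admits no such partition is a star of small branches. Equality can only come
  from sets of order 7, where 4m/7 is an integer.

  The exceptional graph is one vertex too expensive and cannot serve as a part. It is repaired
  together with its neighbour: some of its vertices move across so that no new part has order 10,
  and where this fails, the claw condition or an explicit cover helps.

  For equality, the lever is that a vertex outside a 7-set can be taken at the expense of the 7-set
  that contains it. Excluding the path attachment takes two such outside vertices, hence three
  7-sets; this is the origin of the bound 14.\<close>

definition shift_label :: "nat \<Rightarrow> nat \<Rightarrow> nat" where
  "shift_label k i = (if i = 0 then 1 else i + k)"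

text \<open>Label 0 of a sublist is the vertex from which its root was reached; in the larger list
  that vertex has label 1, while all other labels move up by \<open>k\<close>.\<close>

definition shift_edges :: "nat \<Rightarrow> (nat \<times> nat) list \<Rightarrow> (nat \<times> nat) list" where
  "shift_edges k E = map (\<lambda>(i, j). (shift_label k i, shift_label k j)) E"

text \<open>
  Spanning edge lists of a connected set of order \<open>m\<close>: label 0 is a vertex outside the set, label 1
  its neighbour in the set, from which a depth-first search starts. If a vertex has two children,
  these are not adjacent, and since there is no claw its parent is adjacent to one of them.
\<close>

fun shapes :: "nat \<Rightarrow> (nat \<times> nat) list list" where
  "shapes m = (if m = 0 then [] else if m = 1 then [[(0, 1)]] else
     map (\<lambda>E. (0, 1) # shift_edges 1 E) (shapes (m - 1)) @
     concat (map (\<lambda>b. concat (map (\<lambda>E. concat (map (\<lambda>F.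
         [(0, 1) # (0, 2) # shift_edges 1 E @ shift_edges (m - b) F,
          (0, 1) # (0, m - b + 1) # shift_edges 1 E @ shift_edges (m - b) F])
       (shapes b))) (shapes (m - 1 - b))))
       [1..<(m - 1) div 2 + 1]))"

declare shapes.simps [simp del]

definition eadj :: "(nat \<times> nat) list \<Rightarrow> nat \<Rightarrow> nat \<Rightarrow> bool" where
  "eadj E i j \<longleftrightarrow> list_ex (\<lambda>(a, b). a = i \<and> b = j \<or> a = j \<and> b = i) E"

definition enbrs :: "(nat \<times> nat) list \<Rightarrow> nat \<Rightarrow> nat list" where
  "enbrs E i = concat (map (\<lambda>(a, b). if a = i then [b] else if b = i then [a] else []) E)"

definition enear :: "(nat \<times> nat) list \<Rightarrow> nat \<Rightarrow> nat \<Rightarrow> bool" where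
  "enear E i k \<longleftrightarrow> i \<noteq> k \<and> list_ex (\<lambda>y. eadj E y k) (enbrs E i)"

text \<open>An executable test that is sound only: the graph may have more edges than
  \<open>E\<close>, and these never destroy domination. The pattern \<open>a # b # _\<close> yields
  two different dominators as long as \<open>S\<close> is distinct.\<close>

definition edom :: "(nat \<times> nat) list \<Rightarrow> nat list \<Rightarrow> nat \<Rightarrow> bool" where
  "edom E S i \<longleftrightarrow>
    list_ex (eadj E i) S \<or> (case filter (enear E i) S of a # b # _ \<Rightarrow> True | _ \<Rightarrow> False)"

section \<open>Connected sets and covers\<close>

locale claw_free_relation =
  fixes V :: "'a set" and adj :: "'a \<Rightarrow> 'a \<Rightarrow> bool" (infix "\<sim>" 50)
  assumes finite_V: "finite V"
    and adj_in: "x \<sim> y \<Longrightarrow> x \<in> V"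
    and adj_sym: "x \<sim> y \<Longrightarrow> y \<sim> x"
    and adj_irrefl: "\<not> x \<sim> x"
    and claw: "\<lbrakk>x \<sim> a; x \<sim> b; x \<sim> c; a \<noteq> b; a \<noteq> c; b \<noteq> c\<rbrakk> \<Longrightarrow> a \<sim> b \<or> a \<sim> c \<or> b \<sim> c"
begin

text \<open>
  Adjacency of \<open>x\<close> and \<open>u\<close> is allowed: a neighbour dominates on its own, so this does not change
  domination, but makes it monotone.
\<close>

definition near :: "'a \<Rightarrow> 'a \<Rightarrow> bool" where
  "near x u \<longleftrightarrow> u \<noteq> x \<and> (\<exists>y. x \<sim> y \<and> y \<sim> u)"

definition dominated :: "'a \<Rightarrow> 'a set \<Rightarrow> bool" where
  "dominated x S \<longleftrightarrow> (\<exists>u\<in>S. x \<sim> u) \<or> (\<exists>u\<in>S. \<exists>w\<in>S. u \<noteq> w \<and> near x u \<and> near x w)"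

definition covers :: "'a set \<Rightarrow> 'a set \<Rightarrow> bool" where
  "covers X S \<longleftrightarrow> (\<forall>x\<in>X. dominated x S)"

text \<open>The set \<open>S\<close> may leave \<open>X\<close>, which makes costs subadditive over
  unions and lets one part use dominators that lie in another.\<close>

definition cost :: "'a set \<Rightarrow> nat \<Rightarrow> bool" where
  "cost X k \<longleftrightarrow> (\<exists>S\<subseteq>V. card S \<le> k \<and> covers X S)"

lemma dominated_mono: "dominated x S \<Longrightarrow> S \<subseteq> T \<Longrightarrow> dominated x T"
  unfolding dominated_def by blast

lemma covers_mono: "covers X S \<Longrightarrow> Y \<subseteq> X \<Longrightarrow> S \<subseteq> T \<Longrightarrow> covers Y T"
  unfolding covers_def using dominated_mono by blast

lemma covers_Un: "covers X S \<Longrightarrow> covers Y T \<Longrightarrow> covers (X \<union> Y) (S \<union> T)"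
  unfolding covers_def using dominated_mono by (metis Un_iff Un_upper1 Un_upper2)

lemma cost_Un: assumes "cost X k" "cost Y l" shows "cost (X \<union> Y) (k + l)"
proof -
  from assms obtain S T where "S \<subseteq> V" "card S \<le> k" "covers X S" "T \<subseteq> V" "card T \<le> l" "covers Y T"
    unfolding cost_def by blast
  then show ?thesis unfolding cost_def
    by (intro exI[of _ "S \<union> T"]) (use card_Un_le[of S T] covers_Un in auto)
qed

lemma cost_mono: "cost X k \<Longrightarrow> k \<le> l \<Longrightarrow> cost X l"
  unfolding cost_def by (meson order_trans)

section \<open>Connectedness by cuts, and components after deleting a vertex\<close>

definition con :: "'a set \<Rightarrow> bool" where
  "con X \<longleftrightarrow> X \<subseteq> V \<and> X \<noteq> {} \<and> (\<forall>Y. Y \<subseteq> X \<longrightarrow> Y \<noteq> {} \<longrightarrow> Y \<noteq> X \<longrightarrow> (\<exists>y\<in>Y. \<exists>z\<in>X - Y. y \<sim> z))"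

lemma conD: "con X \<Longrightarrow> Y \<subseteq> X \<Longrightarrow> Y \<noteq> {} \<Longrightarrow> Y \<noteq> X \<Longrightarrow> \<exists>y\<in>Y. \<exists>z\<in>X - Y. y \<sim> z"
  unfolding con_def by blast

lemma con_sub: "con X \<Longrightarrow> X \<subseteq> V" and con_ne: "con X \<Longrightarrow> X \<noteq> {}"
  unfolding con_def by auto

lemma con_finite: "con X \<Longrightarrow> finite X"
  using con_sub finite_V finite_subset by blast

lemma con_singleton: "x \<in> V \<Longrightarrow> con {x}"
  unfolding con_def by auto

text \<open>An edge leaving \<open>Y\<close> also leaves its complement, so of the two sets the one
  that avoids \<open>r\<close> can be tested.\<close>

lemma conI_base:
  assumes "X \<subseteq> V" "r \<in> X"
    and "\<And>Y. Y \<subseteq> X \<Longrightarrow> Y \<noteq> {} \<Longrightarrow> r \<notin> Y \<Longrightarrow> \<exists>y\<in>Y. \<exists>z\<in>X - Y. y \<sim> z"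
  shows "con X"
  unfolding con_def
proof (intro conjI allI impI)
  fix Y assume Y: "Y \<subseteq> X" "Y \<noteq> {}" "Y \<noteq> X"
  show "\<exists>y\<in>Y. \<exists>z\<in>X - Y. y \<sim> z"
  proof (cases "r \<in> Y")
    case True
    then obtain y z where "y \<in> X - Y" "z \<in> X - (X - Y)" "y \<sim> z"
      using assms(3)[of "X - Y"] Y by blast
    then show ?thesis using adj_sym by blast
  qed (use assms(3) Y in blast)
qed (use assms in auto)

lemma con_Un:
  assumes "con X" "con Y" "x \<in> X" "y \<in> Y" "x \<sim> y"
  shows "con (X \<union> Y)"
proof (rule conI_base[where r = x])
  fix Z assume Z: "Z \<subseteq> X \<union> Y" "Z \<noteq> {}" "x \<notin> Z"
  show "\<exists>a\<in>Z. \<exists>b\<in>X \<union> Y - Z. a \<sim> b"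
  proof (cases "Z \<inter> X = {}")
    case False
    then obtain a b where "a \<in> Z \<inter> X" "b \<in> X - Z \<inter> X" "a \<sim> b"
      using conD[OF assms(1), of "Z \<inter> X"] Z assms(3) by blast
    then show ?thesis by blast
  next
    case True
    then have ZY: "Z \<subseteq> Y" using Z by blast
    show ?thesis
    proof (cases "y \<in> Z")
      case True then show ?thesis using Z assms adj_sym by blast
    next
      case False
      then obtain a b where "a \<in> Z" "b \<in> Y - Z" "a \<sim> b"
        using conD[OF assms(2), of Z] Z ZY assms(4) by blast
      then show ?thesis by blast
    qed
  qed
qed (use assms con_sub in auto)

lemma con_insert: "con X \<Longrightarrow> x \<in> X \<Longrightarrow> x \<sim> y \<Longrightarrow> con (insert y X)"
  using con_Un[of X "{y}" x y] con_singleton[of y] adj_in adj_sym by auto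

text \<open>\<open>D\<close> is a largest connected set that contains \<open>d\<close> and avoids
  \<open>v\<close>. An edge to another vertex of \<open>X - {v}\<close> would enlarge it, so the
  edge leaving \<open>D\<close> in the connected set \<open>X\<close> ends in
  \<open>v\<close>.\<close>

lemma component_exists:
  assumes "con X" "v \<in> X" "d \<in> X - {v}"
  obtains D where "d \<in> D" "D \<subseteq> X - {v}" "con D"
    "\<And>x y. x \<in> D \<Longrightarrow> y \<in> X - {v} - D \<Longrightarrow> \<not> x \<sim> y" "\<exists>e\<in>D. v \<sim> e"
proof -
  let ?P = "\<lambda>D. d \<in> D \<and> D \<subseteq> X - {v} \<and> con D"
  have "?P {d}" using assms con_singleton con_sub by auto
  moreover have "\<forall>D. ?P D \<longrightarrow> card D < Suc (card X)"
    using con_finite[OF assms(1)] by (meson Diff_subset card_mono le_imp_less_Suc order_trans)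
  ultimately obtain D where D: "?P D" and max: "\<And>D'. ?P D' \<Longrightarrow> card D' \<le> card D"
    using ex_has_greatest_nat[of ?P "{d}" card "Suc (card X)"] by blast
  have sep: "\<not> x \<sim> y" if "x \<in> D" "y \<in> X - {v} - D" for x y
  proof
    assume "x \<sim> y"
    then have "?P (insert y D)" using D con_insert that by blast
    then have "card (insert y D) \<le> card D" by (rule max)
    then show False using that D con_finite by (simp add: card_insert_if)
  qed
  have "\<exists>y\<in>D. \<exists>z\<in>X - D. y \<sim> z" using conD[OF assms(1), of D] D assms by blast
  then have "\<exists>e\<in>D. v \<sim> e" using sep adj_sym by blast
  then show thesis using that D sep by blast
qed

lemma con_Diff_component:
  assumes "con X" "v \<in> X" "D \<subseteq> X - {v}" "\<And>x y. x \<in> D \<Longrightarrow> y \<in> X - {v} - D \<Longrightarrow> \<not> x \<sim> y"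
  shows "con (X - D)"
proof (rule conI_base[where r = v])
  fix Y assume Y: "Y \<subseteq> X - D" "Y \<noteq> {}" "v \<notin> Y"
  then obtain y z where yz: "y \<in> Y" "z \<in> X - Y" "y \<sim> z" using conD[OF assms(1), of Y] assms by blast
  then have "z \<notin> D" using assms(4)[of z y] adj_sym Y by blast
  then show "\<exists>y\<in>Y. \<exists>z\<in>X - D - Y. y \<sim> z" using yz by blast
qed (use assms con_sub[OF assms(1)] in auto)

text \<open>Three components of \<open>X - {v}\<close> would supply three pairwise non-adjacent
  neighbours of \<open>v\<close>, a claw. Ordering the two components by size halves the enumeration
  in \<open>shapes\<close>.\<close>

lemma split_at:
  assumes "con X" "v \<in> X" "X \<noteq> {v}"
  obtains (one) d where "con (X - {v})" "d \<in> X - {v}" "v \<sim> d"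
  | (two) D E d e where "X - {v} = D \<union> E" "D \<inter> E = {}" "con D" "con E" "d \<in> D" "e \<in> E"
      "v \<sim> d" "v \<sim> e" "card E \<le> card D" "\<And>x y. x \<in> D \<Longrightarrow> y \<in> E \<Longrightarrow> \<not> x \<sim> y"
proof -
  obtain d0 where "d0 \<in> X - {v}" using assms by blast
  from component_exists[OF assms(1,2) this] obtain D where D: "D \<subseteq> X - {v}" "con D"
    "\<And>x y. x \<in> D \<Longrightarrow> y \<in> X - {v} - D \<Longrightarrow> \<not> x \<sim> y" "\<exists>e\<in>D. v \<sim> e" by metis
  then obtain d where d: "d \<in> D" "v \<sim> d" by blast
  show thesis
  proof (cases "D = X - {v}")
    case True then show ?thesis using one D d by blast
  next
    case False
    then obtain e0 where e0: "e0 \<in> X - {v}" "e0 \<notin> D" using D by blast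
    from component_exists[OF assms(1,2) e0(1)] obtain E where E: "e0 \<in> E" "E \<subseteq> X - {v}" "con E"
    "\<And>x y. x \<in> E \<Longrightarrow> y \<in> X - {v} - E \<Longrightarrow> \<not> x \<sim> y" "\<exists>e\<in>E. v \<sim> e" by metis
    then obtain e where e: "e \<in> E" "v \<sim> e" by blast
    have disj: "D \<inter> E = {}"
    proof (rule ccontr)
      assume ne: "D \<inter> E \<noteq> {}"
      moreover have "D \<inter> E \<noteq> E" using e0 E by blast
      ultimately obtain y z where "y \<in> D \<inter> E" "z \<in> E - D \<inter> E" "y \<sim> z"
        using conD[OF E(3), of "D \<inter> E"] by blast
      then show False using D(3)[of y z] E(2) by blast
    qed
    have sep: "\<not> x \<sim> y" if "x \<in> D" "y \<in> E" for x y using D(3)[of x y] that disj E(2) by blast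
    have all: "X - {v} = D \<union> E"
    proof (rule ccontr)
      assume "X - {v} \<noteq> D \<union> E"
      then obtain f0 where f0: "f0 \<in> X - {v}" "f0 \<notin> D" "f0 \<notin> E" using D E by blast
      from component_exists[OF assms(1,2) f0(1)] obtain F where F: "f0 \<in> F" "F \<subseteq> X - {v}" "con F"
        "\<And>x y. x \<in> F \<Longrightarrow> y \<in> X - {v} - F \<Longrightarrow> \<not> x \<sim> y" "\<exists>e\<in>F. v \<sim> e" by metis
      then obtain f where f: "f \<in> F" "v \<sim> f" by blast
      have "D \<inter> F = {}"
      proof (rule ccontr)
        assume ne: "D \<inter> F \<noteq> {}"
        then obtain y z where "y \<in> D \<inter> F" "z \<in> F - D \<inter> F" "y \<sim> z"
          using conD[OF F(3), of "D \<inter> F"] f0 F by blast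
        then show False using D(3)[of y z] F(2) by blast
      qed
      moreover have "E \<inter> F = {}"
      proof (rule ccontr)
        assume ne: "E \<inter> F \<noteq> {}"
        then obtain y z where "y \<in> E \<inter> F" "z \<in> F - E \<inter> F" "y \<sim> z"
          using conD[OF F(3), of "E \<inter> F"] f0 F by blast
        then show False using E(4)[of y z] F(2) by blast
      qed
      ultimately have "\<not> d \<sim> f" "\<not> e \<sim> f" "d \<noteq> f" "e \<noteq> f" "d \<noteq> e"
        using D(3)[of d f] E(4)[of e f] d e f F(2) disj by auto
      then show False using claw[of v d e f] d e f sep by blast
    qed
    show ?thesis
    proof (cases "card E \<le> card D")
      case True
      then show ?thesis using two[of D E d e] all disj D E d e sep by blast
    next
      case False
      then show ?thesis using two[of E D e d] all disj D E d e sep adj_sym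
        by (metis Un_commute Int_commute nat_le_linear)
    qed
  qed
qed

section \<open>Embedding spanning shapes\<close>

text \<open>Nothing is said about pairs outside \<open>E\<close>, so one list stands for every graph
  that contains its edges.\<close>

definition embeds :: "(nat \<Rightarrow> 'a) \<Rightarrow> 'a \<Rightarrow> 'a \<Rightarrow> 'a set \<Rightarrow> nat \<Rightarrow> (nat \<times> nat) list \<Rightarrow> bool" where
  "embeds \<phi> v c M m E \<longleftrightarrow> \<phi> 0 = v \<and> \<phi> 1 = c \<and> \<phi> ` {1..m} = M \<and> inj_on \<phi> {..m} \<and>
     (\<forall>(i, j) \<in> set E. i \<le> m \<and> j \<le> m \<and> \<phi> i \<sim> \<phi> j)"

lemma inj_on_atMost_card:
  assumes "\<phi> ` {1..m} = M" "card M = m" "\<phi> 0 \<notin> M"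
  shows "inj_on \<phi> {..m}"
proof -
  have "inj_on \<phi> {1..m}" using assms by (intro eq_card_imp_inj_on) auto
  moreover have "{..m} = insert 0 {1..m}" by auto
  ultimately show ?thesis using assms by auto
qed

lemma shift_edges_adj:
  assumes "\<forall>(i, j)\<in>set E. i \<le> a \<and> j \<le> a \<and> \<phi> i \<sim> \<phi> j"
    and "\<And>i. i \<le> a \<Longrightarrow> \<psi> (shift_label k i) = \<phi> i \<and> shift_label k i \<le> m"
  shows "\<forall>(i, j)\<in>set (shift_edges k E). i \<le> m \<and> j \<le> m \<and> \<psi> i \<sim> \<psi> j"
  using assms unfolding shift_edges_def by fastforce

lemma shape_exists:
  assumes "con M" "card M = m" "v \<notin> M" "v \<sim> c" "c \<in> M"
  shows "\<exists>E\<in>set (shapes m). \<exists>\<phi>. embeds \<phi> v c M m E"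
  using assms
proof (induction m arbitrary: M v c rule: less_induct)
  case (less m)
  have fin: "finite M" using less con_finite by blast
  then have m: "m \<noteq> 0" using less.prems by (metis card_0_eq empty_iff)
  show ?case
  proof (cases "M = {c}")
    case True
    then have "m = 1" using less by auto
    moreover have "embeds (\<lambda>i. if i = 0 then v else c) v c M 1 [(0, 1)]"
      unfolding embeds_def using True less.prems by (auto simp: inj_on_def)
    ultimately show ?thesis by (auto simp: shapes.simps)
  next
    case False
    have m1: "m \<noteq> 1" using False less.prems by (auto simp: card_1_singleton_iff)
    have cM: "card (M - {c}) = m - 1" using less.prems fin by auto
    from less.prems(1,5) False show ?thesis
    proof (cases rule: split_at)
      case (one d)
      have "m - 1 < m" using m by auto
      from less.IH[OF this one(1) cM _ one(3) one(2)] obtain E \<phi> where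
        E: "E \<in> set (shapes (m - 1))" "embeds \<phi> c d (M - {c}) (m - 1) E" by auto
      define \<psi> where "\<psi> i = (if i = 0 then v else \<phi> (i - 1))" for i
      have img: "\<psi> ` {1..m} = M"
      proof -
        have e: "{1..m} = Suc ` {0..m-1}" using m by (simp add: image_Suc_atLeastAtMost)
        have "\<psi> ` {1..m} = \<phi> ` {0..m-1}" unfolding e image_image by (simp add: \<psi>_def)
        also have "{0..m-1} = insert 0 {1..m-1}" by auto
        finally show ?thesis using E(2) less.prems unfolding embeds_def by auto
      qed
      have "embeds \<psi> v c M m ((0, 1) # shift_edges 1 E)"
        unfolding embeds_def
      proof (intro conjI)
        show "inj_on \<psi> {..m}" using inj_on_atMost_card[OF img] less.prems by (auto simp: \<psi>_def)
        have "\<psi> (shift_label 1 i) = \<phi> i \<and> shift_label 1 i \<le> m" if "i \<le> m - 1" for i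
          using that m by (auto simp: \<psi>_def shift_label_def)
        then have "\<forall>(i, j)\<in>set (shift_edges 1 E). i \<le> m \<and> j \<le> m \<and> \<psi> i \<sim> \<psi> j"
          using E(2) unfolding embeds_def by (intro shift_edges_adj) auto
        moreover have "\<psi> 0 \<sim> \<psi> 1" using E(2) less.prems unfolding embeds_def \<psi>_def by auto
        ultimately show "\<forall>(i, j)\<in>set ((0, 1) # shift_edges 1 E). i \<le> m \<and> j \<le> m \<and> \<psi> i \<sim> \<psi> j"
          using m by auto
      qed (use E img in \<open>auto simp: \<psi>_def embeds_def\<close>)
      moreover have "(0, 1) # shift_edges 1 E \<in> set (shapes m)"
        using E(1) m m1 by (subst shapes.simps) auto
      ultimately show ?thesis by blast
    next
      case (two D D' d d')
      define b where "b = card D'"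
      have fD: "finite D" "finite D'" using two con_finite by auto
      have cards: "card D + b = m - 1" using cM two fD unfolding b_def by (metis card_Un_disjoint)
      have b1: "1 \<le> b" using two fD unfolding b_def by (simp add: card_gt_0_iff Suc_le_eq) blast
      have bm: "b < (m - 1) div 2 + 1" "b < m" "m - 1 - b < m" using cards two b1 unfolding b_def by auto
      have cD: "card D = m - 1 - b" using cards by auto
      have nin: "c \<notin> D" "c \<notin> D'" using two by auto
      from less.IH[OF bm(3) two(3) cD nin(1) two(7,5)] obtain E \<phi> where
        E: "E \<in> set (shapes (m - 1 - b))" "embeds \<phi> c d D (m - 1 - b) E" by auto
      from less.IH[OF bm(2) two(4) b_def[symmetric] nin(2) two(8,6)] obtain F \<phi>' where
        F: "F \<in> set (shapes b)" "embeds \<phi>' c d' D' b F" by auto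
      \<comment> \<open>The larger component takes the labels 2 to \<open>m - b\<close>, the smaller
        one the last \<open>b\<close> labels; \<open>c\<close> is label 0 of both sublists and
        becomes label 1.\<close>
      define \<psi> where "\<psi> i = (if i = 0 then v else if i \<le> m - b then \<phi> (i - 1) else \<phi>' (i - (m - b)))" for i
      have mb: "2 \<le> m - b" using cards two b1 unfolding b_def by auto
      have i1: "\<psi> ` {1..m-b} = insert c D"
      proof -
        have e: "{1..m-b} = Suc ` {0..m-1-b}" using mb by (simp add: image_Suc_atLeastAtMost)
        have "\<psi> ` {1..m-b} = \<phi> ` {0..m-1-b}" unfolding e image_image using mb
          by (intro image_cong) (auto simp: \<psi>_def)
        also have "{0..m-1-b} = insert 0 {1..m-1-b}" by auto
        finally show ?thesis using E(2) unfolding embeds_def by auto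
      qed
      have i2: "\<psi> ` {m-b+1..m} = D'"
      proof -
        have e: "{m-b+1..m} = (\<lambda>i. i + (m - b)) ` {1..b}" using bm image_add_atLeastAtMost'[of "m - b" 1 b]
          by simp
        have "\<psi> ` {m-b+1..m} = \<phi>' ` {1..b}" unfolding e image_image by (intro image_cong) (auto simp: \<psi>_def)
        then show ?thesis using F(2) unfolding embeds_def by auto
      qed
      have img: "\<psi> ` {1..m} = M"
      proof -
        have "{1..m} = {1..m-b} \<union> {m-b+1..m}" using bm mb by auto
        then show ?thesis using i1 i2 two(1) less.prems by (auto simp: image_Un)
      qed
      have vd: "v \<sim> d \<or> v \<sim> d'"
      proof -
        have "d \<noteq> d'" "d \<noteq> v" "d' \<noteq> v" "\<not> d \<sim> d'" using two less.prems by blast+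
        then show ?thesis using claw[of c d d' v] two(7,8) adj_sym less.prems(4) by blast
      qed
      have e1: "\<psi> (shift_label 1 i) = \<phi> i \<and> shift_label 1 i \<le> m" if "i \<le> m - 1 - b" for i
        using that mb unfolding \<psi>_def shift_label_def by auto
      have e2: "\<psi> (shift_label (m - b) i) = \<phi>' i \<and> shift_label (m - b) i \<le> m" if "i \<le> b" for i
        using that mb E(2) F(2) bm unfolding \<psi>_def embeds_def shift_label_def by auto
      have edges: "\<forall>(i, j)\<in>set (shift_edges 1 E @ shift_edges (m - b) F). i \<le> m \<and> j \<le> m \<and> \<psi> i \<sim> \<psi> j"
        using shift_edges_adj[of E "m - 1 - b" \<phi> \<psi> 1 m] shift_edges_adj[of F b \<phi>' \<psi> "m - b" m]
          E(2) F(2) e1 e2 unfolding embeds_def by auto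
      have p: "\<psi> 0 = v" "\<psi> 1 = c" "\<psi> 2 = d" "\<psi> (m - b + 1) = d'"
        using E(2) F(2) mb unfolding \<psi>_def embeds_def by (auto simp: numeral_2_eq_2)
      have inj: "inj_on \<psi> {..m}" using inj_on_atMost_card[OF img] less.prems p by auto
      \<comment> \<open>The claw condition at \<open>c\<close> yields only one of the two chords;
        hence the two variants in \<open>shapes\<close> for each pair of sublists.\<close>
      define x where "x = (if v \<sim> d then 2 else m - b + 1)"
      have x: "v \<sim> \<psi> x" "x \<le> m" using vd p mb b1 bm unfolding x_def by auto
      have "embeds \<psi> v c M m ((0, 1) # (0, x) # shift_edges 1 E @ shift_edges (m - b) F)"
        unfolding embeds_def using p img inj edges x less.prems m by auto
      moreover have "(0, 1) # (0, x) # shift_edges 1 E @ shift_edges (m - b) F \<in> set (shapes m)"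
      proof -
        have "b \<in> set [1..<(m - 1) div 2 + 1]" using b1 bm by auto
        then show ?thesis unfolding x_def using E(1) F(1) m m1 by (subst shapes.simps) (auto simp del: set_upt)
      qed
      ultimately show ?thesis by blast
    qed
  qed
qed

section \<open>Soundness of the evaluated domination test\<close>

lemma eadj_sound:
  assumes "\<forall>(i, j)\<in>set E. \<phi> i \<sim> \<phi> j" "eadj E i j" shows "\<phi> i \<sim> \<phi> j"
  using assms adj_sym unfolding eadj_def list_ex_iff by fastforce

lemma enbrs_sound:
  assumes "\<forall>(i, j)\<in>set E. \<phi> i \<sim> \<phi> j" "j \<in> set (enbrs E i)" shows "\<phi> i \<sim> \<phi> j"
  using assms adj_sym unfolding enbrs_def by (fastforce split: if_splits)

lemma enear_sound:
  assumes "\<forall>(i, j)\<in>set E. \<phi> i \<sim> \<phi> j" "inj_on \<phi> I" "i \<in> I" "k \<in> I" "enear E i k"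
  shows "near (\<phi> i) (\<phi> k)"
proof -
  from assms(5) obtain y where "i \<noteq> k" "y \<in> set (enbrs E i)" "eadj E y k"
    unfolding enear_def list_ex_iff by blast
  then show ?thesis
    unfolding near_def using enbrs_sound[OF assms(1)] eadj_sound[OF assms(1)] assms(2-4)
    by (metis inj_onD)
qed

lemma edom_sound:
  assumes "\<forall>(i, j)\<in>set E. \<phi> i \<sim> \<phi> j" "inj_on \<phi> I" "i \<in> I" "set S \<subseteq> I" "distinct S" "edom E S i"
  shows "dominated (\<phi> i) (\<phi> ` set S)"
proof (cases "list_ex (eadj E i) S")
  case True
  then show ?thesis using eadj_sound[OF assms(1)] unfolding dominated_def list_ex_iff by blast
next
  case False
  then obtain a b xs where f: "filter (enear E i) S = a # b # xs"
    using assms(6) unfolding edom_def by (auto split: list.splits)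
  then have "distinct (a # b # xs)" "set (a # b # xs) \<subseteq> set S" "\<forall>z\<in>set (a # b # xs). enear E i z"
    using assms(5) distinct_filter[of S "enear E i"] filter_set[of "enear E i" S] by (metis, auto simp flip: f)
  then have ab: "a \<noteq> b" "a \<in> set S" "b \<in> set S" "enear E i a" "enear E i b" by auto
  then have "\<phi> a \<noteq> \<phi> b" using assms by (metis inj_on_eq_iff subsetD)
  then show ?thesis unfolding dominated_def
    using ab enear_sound[OF assms(1,2,3)] assms(4) by blast
qed

lemma list_all_edom_sound:
  assumes "list_all (edom E S) T" "\<forall>(i, j)\<in>set E. \<phi> i \<sim> \<phi> j" "inj_on \<phi> I" "set T \<subseteq> I" "set S \<subseteq> I" "distinct S"
  shows "covers (\<phi> ` set T) (\<phi> ` set S)"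
  using assms edom_sound[OF assms(2,3) _ assms(5,6)] unfolding covers_def list_all_iff by blast

end

section \<open>Branches at a vertex\<close>

lemma shapes_3: "shapes 3 = [[(0,1),(1,2),(2,3)], [(0,1),(0,2),(1,2),(1,3)], [(0,1),(0,3),(1,2),(1,3)]]"
  by code_simp

text \<open>The test on label 1 puts an element of \<open>S\<close> within distance two of the
  outside vertex 0, so the branch contributes half of the domination of 0.\<close>

lemma shapes_4_cover:
  "list_all (\<lambda>E. list_ex (\<lambda>S. list_all (edom E S) [1,2,3,4] \<and> list_ex (eadj E 1) S)
     [[1,2],[2,3]]) (shapes 4)"
  by code_simp

lemma shapes_5_cover:
  "list_all (\<lambda>E. list_ex (\<lambda>S. list_all (edom E (0 # S)) [1,2,3,4,5])
     [[2,3],[2,4],[4,5]]) (shapes 5)"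
  by code_simp

text \<open>A third vertex is spent instead of vertex 0; \<open>star_four_five\<close> relies on
  this trade.\<close>

lemma shapes_5_self_cover:
  "list_all (\<lambda>E. list_ex (\<lambda>S. list_all (edom E S) [1,2,3,4,5] \<and> list_ex (eadj E 1) S)
     [[1,2,3],[1,2,4],[2,3,4]]) (shapes 5)"
  by code_simp

lemma shapes_6_cover:
  "list_all (\<lambda>E. list_ex (\<lambda>S. list_all (edom E (0 # S)) [0,1,2,3,4,5,6])
     [[1,3,4],[2,3,5],[1,5,6]]) (shapes 6)"
  by code_simp

text \<open>Labels 7, 8, 9 are a path of order 3 hanging from 0. Order 10 tolerates five vertices.
  The exception is the exceptional graph: triangle 0, 1, 2, short arms 5, 6 at 1 and 3, 4 at 2, and
  the hanging path as long arm at 0.\<close>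

lemma shapes_6_tail_cover:
  "list_all (\<lambda>E. list_ex (\<lambda>S. list_all (edom (E @ [(0,7),(7,8),(8,9)]) S) [0,1,2,3,4,5,6,7,8,9])
       [[1,3,4,7,8],[2,3,5,7,8],[0,4,5,7,8]]
     \<or> E = [(0,1),(0,2),(1,2),(2,3),(3,4),(1,5),(5,6)]) (shapes 6)"
  by code_simp

text \<open>Two paths 5, 6, 7 and 8, 9 hang from 0, and the roots 1 and 5 are adjacent. If the
  branch list is a bare path, this is the exceptional graph on the triangle 0, 1, 5 with long arm 2,
  3, 4.\<close>

lemma shapes_4_tails_cover:
  "list_all (\<lambda>E. list_all (edom (E @ [(0,5),(5,6),(6,7),(0,8),(8,9),(1,5)]) [0,1,2,6,8]) [0,1,2,3,4,5,6,7,8,9]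
     \<or> E = [(0,1),(1,2),(2,3),(3,4)]) (shapes 4)"
  by code_simp

text \<open>The same two hanging paths next to a branch of order 6: order 12 tolerates six
  vertices.\<close>

lemma shapes_6_tails_cover:
  "list_all (\<lambda>E. list_ex (\<lambda>S. list_all (edom (E @ [(0,7),(7,8),(8,9),(0,10),(10,11),(1,7)]) S)
       [0,1,2,3,4,5,6,7,8,9,10,11])
     [[0,1,3,4,8,10],[0,1,3,5,8,10],[0,1,5,6,8,10]]) (shapes 6)"
  by code_simp

text \<open>
  \<open>star_s m\<close> vertices suffice for a branch of order \<open>m\<close> at a vertex \<open>v\<close> that is itself taken, and
  \<open>star_d m\<close> measures how they dominate \<open>v\<close>: 2 if they do, 1 if one of them is within distance two.
  The only exception is a path of order 3 attached at its end.
\<close>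

definition star_s :: "nat \<Rightarrow> nat" where
  "star_s m = (if m \<le> 1 then 0 else if m \<le> 3 then 1 else if m \<le> 5 then 2 else 3)"

definition star_d :: "nat \<Rightarrow> nat" where
  "star_d m = (if m \<le> 1 \<or> m = 5 then 0 else if m = 4 then 1 else 2)"

text \<open>\<open>k\<close> counts \<open>v\<close>, the branches, and a neighbour of
  \<open>v\<close> in case the attachments do not add up to 2. The listed triples consist of an
  empty branch and branches of orders 4 and 5; there \<open>k\<close> is 6 at order 10, one too
  many.\<close>

lemma star_arith:
  assumes "a \<le> 6" "b \<le> 6" "c \<le> 6" "6 \<le> a + b + c"
  defines "n \<equiv> 1 + a + b + c"
    and "k \<equiv> 1 + star_s a + star_s b + star_s c + (if 2 \<le> star_d a + star_d b + star_d c then 0 else 1)"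
  shows "7 * k < 4 * n \<or> n = 7 \<and> k \<le> 4 \<or>
     (a, b, c) \<in> set [(0,4,5),(0,5,4),(4,0,5),(4,5,0),(5,0,4),(5,4,0)]"
proof -
  have "\<forall>a\<in>set [0..<7]. \<forall>b\<in>set [0..<7]. \<forall>c\<in>set [0..<7]. 6 \<le> a + b + c \<longrightarrow>
     7 * (1 + star_s a + star_s b + star_s c + (if 2 \<le> star_d a + star_d b + star_d c then 0 else 1)) < 4 * (1 +
       a + b + c)
     \<or> 1 + a + b + c = 7 \<and> 1 + star_s a + star_s b + star_s c + (if 2 \<le> star_d a + star_d b + star_d c then 0
       else 1) \<le> 4
     \<or> (a, b, c) \<in> set [(0,4,5),(0,5,4),(4,0,5),(4,5,0),(5,0,4),(5,4,0)]"
    by code_simp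
  moreover have "a \<in> set [0..<7]" "b \<in> set [0..<7]" "c \<in> set [0..<7]" using assms by auto
  ultimately show ?thesis using assms(4) unfolding n_def k_def by blast
qed

context claw_free_relation begin

lemma list_covers:
  assumes "list_all (edom E S) T" "\<forall>(i, j)\<in>set E. xs ! i \<sim> xs ! j" "distinct xs" "distinct S"
    "\<forall>i\<in>set S \<union> set T. i < length xs"
  shows "covers ((!) xs ` set T) ((!) xs ` set S)"
proof (rule list_all_edom_sound[OF assms(1,2)])
  show "inj_on ((!) xs) {..<length xs}" using assms(3) inj_on_nth by blast
qed (use assms in auto)

lemma embeds_covers:
  assumes "embeds \<phi> v r M m E" "list_all (edom E S) T" "distinct S" "set S \<subseteq> {..m}" "set T \<subseteq> {..m}"
  shows "covers (\<phi> ` set T) (\<phi> ` set S)"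
  using list_all_edom_sound[OF assms(2) _ _ assms(5,4,3)] assms(1) unfolding embeds_def by auto

section \<open>Combining the branches at a vertex\<close>

text \<open>The degrees are meant to be added: two branches of degree 1 dominate \<open>v\<close>
  together.\<close>

definition attached :: "'a \<Rightarrow> 'a set \<Rightarrow> nat \<Rightarrow> bool" where
  "attached v S d \<longleftrightarrow> (1 \<le> d \<longrightarrow> (\<exists>u\<in>S. v \<sim> u \<or> near v u)) \<and> (2 \<le> d \<longrightarrow> dominated v S)"

text \<open>The flag \<open>b\<close> tells whether \<open>v\<close> itself is taken. Keeping
  \<open>S\<close> inside \<open>M\<close> makes the contributions of disjoint branches
  disjoint.\<close>

definition offer :: "bool \<Rightarrow> 'a \<Rightarrow> 'a set \<Rightarrow> nat \<Rightarrow> nat \<Rightarrow> bool" where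
  "offer b v M s d \<longleftrightarrow> (\<exists>S\<subseteq>M. card S \<le> s \<and> covers M (if b then insert v S else S) \<and> attached v S d)"

lemma offer_empty: "offer b v {} s 0"
  unfolding offer_def attached_def covers_def by auto

lemma dominated_attached: "dominated v S \<Longrightarrow> attached v S d"
  unfolding attached_def dominated_def by blast

text \<open>A total attachment of 2 comes from one branch that dominates \<open>v\<close>, or from
  two branches with one vertex each within distance two; these vertices differ because the branches
  are disjoint. Otherwise the neighbour \<open>r\<close> is added.\<close>

lemma star_cover:
  assumes "offer b v M1 s1 d1" "offer b v M2 s2 d2" "offer b v M3 s3 d3"
    and "M1 \<inter> M2 = {}" "M1 \<inter> M3 = {}" "M2 \<inter> M3 = {}" "M1 \<union> M2 \<union> M3 \<subseteq> V" "v \<sim> r"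
  obtains S where "S \<subseteq> V" "b \<Longrightarrow> v \<in> S" "covers (insert v (M1 \<union> M2 \<union> M3)) S"
    "card S \<le> (if b then 1 else 0) + s1 + s2 + s3 + (if 2 \<le> d1 + d2 + d3 then 0 else 1)"
proof -
  obtain S1 where S1: "S1 \<subseteq> M1" "card S1 \<le> s1" "covers M1 (if b then insert v S1 else S1)" "attached v S1 d1"
    using assms(1) unfolding offer_def by blast
  obtain S2 where S2: "S2 \<subseteq> M2" "card S2 \<le> s2" "covers M2 (if b then insert v S2 else S2)" "attached v S2 d2"
    using assms(2) unfolding offer_def by blast
  obtain S3 where S3: "S3 \<subseteq> M3" "card S3 \<le> s3" "covers M3 (if b then insert v S3 else S3)" "attached v S3 d3"
    using assms(3) unfolding offer_def by blast
  define S0 where "S0 = (if b then {v} else {}) \<union> S1 \<union> S2 \<union> S3"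
  have cov: "covers (M1 \<union> M2 \<union> M3) S0"
    using S1 S2 S3 unfolding S0_def covers_def
    by (auto intro: dominated_mono split: if_splits)
  have "S0 = (if b then {v} else {}) \<union> (S1 \<union> S2 \<union> S3)" unfolding S0_def by blast
  then have "card S0 \<le> card (if b then {v} else {}) + card (S1 \<union> S2 \<union> S3)" using card_Un_le by metis
  moreover have "card (S1 \<union> S2 \<union> S3) \<le> card S1 + card S2 + card S3"
    using card_Un_le[of S1 S2] card_Un_le[of "S1 \<union> S2" S3] by linarith
  ultimately have crd: "card S0 \<le> (if b then 1 else 0) + s1 + s2 + s3" using S1 S2 S3 by (auto split: if_splits)
  have vr: "v \<in> V" "r \<in> V" using assms(8) adj_in adj_sym by blast+
  have sub: "S0 \<subseteq> V" using S1 S2 S3 assms(7) vr unfolding S0_def by auto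
  show thesis
  proof (cases "2 \<le> d1 + d2 + d3")
    case True
    have "dominated v S0"
    proof (cases "2 \<le> d1 \<or> 2 \<le> d2 \<or> 2 \<le> d3")
      case True
      then have "dominated v S1 \<or> dominated v S2 \<or> dominated v S3"
        using S1 S2 S3 unfolding attached_def by blast
      then show ?thesis unfolding S0_def by (auto intro: dominated_mono)
    next
      case False
      then have "(1 \<le> d1 \<and> 1 \<le> d2) \<or> (1 \<le> d1 \<and> 1 \<le> d3) \<or> (1 \<le> d2 \<and> 1 \<le> d3)" using True by linarith
      then obtain u w where "u \<in> S0" "w \<in> S0" "u \<noteq> w" "v \<sim> u \<or> near v u" "v \<sim> w \<or> near v w"
        using S1 S2 S3 assms(4-6) unfolding attached_def S0_def by blast
      then show ?thesis unfolding dominated_def by blast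
    qed
    then have "covers (insert v (M1 \<union> M2 \<union> M3)) S0" using cov unfolding covers_def by auto
    then show thesis using that[of S0] crd sub True unfolding S0_def by auto
  next
    case False
    have "dominated v (insert r S0)" using assms(8) unfolding dominated_def by blast
    then have "covers (insert v (M1 \<union> M2 \<union> M3)) (insert r S0)"
      using cov covers_mono[OF cov order_refl, of "insert r S0"] unfolding covers_def by auto
    moreover have "card (insert r S0) \<le> Suc (card S0)" using card_Un_le[of "{r}" S0] by simp
    ultimately show thesis using that[of "insert r S0"] crd sub vr False unfolding S0_def by auto
  qed
qed

section \<open>Covers of single branches\<close>

definition path3 :: "'a \<Rightarrow> 'a set \<Rightarrow> 'a \<Rightarrow> 'a \<Rightarrow> 'a \<Rightarrow> bool" where
  "path3 v M a b c \<longleftrightarrow> M = {a, b, c} \<and> distinct [v, a, b, c] \<and> v \<sim> a \<and> a \<sim> b \<and> b \<sim> c"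

definition branch :: "'a \<Rightarrow> 'a \<Rightarrow> 'a set \<Rightarrow> bool" where
  "branch v r M \<longleftrightarrow> con M \<and> v \<notin> M \<and> r \<in> M \<and> v \<sim> r \<and> card M \<le> 6"

text \<open>Admitting the empty set lets every star be treated as one with exactly three
  branches.\<close>

definition leg :: "'a \<Rightarrow> 'a set \<Rightarrow> bool" where
  "leg v M \<longleftrightarrow> M = {} \<or> (\<exists>r. branch v r M)"

lemma branch_finite: "branch v r M \<Longrightarrow> finite M"
  unfolding branch_def using con_finite by blast

lemma branch_shape:
  assumes "branch v r M" "card M = m"
  obtains E \<phi> where "E \<in> set (shapes m)" "embeds \<phi> v r M m E"
  using shape_exists[of M m v r] assms unfolding branch_def by blast

lemma branch_2_cover:
  assumes "branch v r M" "card M = 2" shows "covers M {v, r}"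
proof -
  obtain e where e: "M = {r, e}" "r \<noteq> e" using assms unfolding branch_def card_2_iff by force
  have "con M" using assms branch_def by blast
  then have "r \<sim> e" using conD[of M "{r}"] e by blast
  then show ?thesis using assms e adj_sym unfolding covers_def dominated_def branch_def by auto
qed

text \<open>In both shapes other than the path, label 1 is adjacent to 0, 2 and 3: the root
  dominates the rest of the branch, and \<open>v\<close> dominates the root.\<close>

lemma branch_3_cases:
  assumes "branch v r M" "card M = 3"
  shows "covers M {v, r} \<or> (\<exists>b c. path3 v M r b c)"
proof -
  obtain E \<phi> where E: "E \<in> set (shapes 3)" "embeds \<phi> v r M 3 E" using branch_shape[OF assms] .
  have "{1..3} = {1, 2, 3::nat}" by auto
  then have M: "M = {\<phi> 1, \<phi> 2, \<phi> 3}" and r: "r = \<phi> 1" "v = \<phi> 0" using E(2) unfolding embeds_def by auto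
  have "distinct (map \<phi> [0,1,2,3])"
    using E(2) inj_on_subset[of \<phi> "{..3}" "set [0,1,2,3]"] unfolding distinct_map embeds_def by auto
  then have d: "distinct [\<phi> 0, \<phi> 1, \<phi> 2, \<phi> 3]" by simp
  consider "E = [(0,1),(1,2),(2,3)]" | "E = [(0,1),(0,2),(1,2),(1,3)] \<or> E = [(0,1),(0,3),(1,2),(1,3)]"
    using E(1) unfolding shapes_3 by auto
  then show ?thesis
  proof cases
    case 1
    then have "path3 v M r (\<phi> 2) (\<phi> 3)" using E(2) M r d unfolding path3_def embeds_def by auto
    then show ?thesis by blast
  next
    case 2
    then have "\<phi> 0 \<sim> \<phi> 1" "\<phi> 1 \<sim> \<phi> 2" "\<phi> 1 \<sim> \<phi> 3" using E(2) unfolding embeds_def by auto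
    then show ?thesis unfolding covers_def dominated_def M r using adj_sym by auto
  qed
qed

lemma branch_4_self:
  assumes "branch v r M" "card M = 4"
  obtains S where "S \<subseteq> M" "card S \<le> 2" "covers M S" "\<exists>s\<in>S. r \<sim> s"
proof -
  obtain E \<phi> where E: "E \<in> set (shapes 4)" "embeds \<phi> v r M 4 E" using branch_shape[OF assms] .
  obtain S where S: "S \<in> set [[1,2],[2,3]]" "list_all (edom E S) [1,2,3,4]" "list_ex (eadj E 1) S"
    using shapes_4_cover E(1) unfolding list_all_iff[of _ "shapes 4"] list_ex_iff[of _ "[[1,2],[2,3]]"] by blast
  have "covers (\<phi> ` set [1,2,3,4]) (\<phi> ` set S)"
    by (rule embeds_covers[OF E(2) S(2)]) (use S(1) in auto)
  moreover have M: "M = \<phi> ` set [1,2,3,4]"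
  proof -
    have "{1..4} = set [1,2,3,4::nat]" by auto
    then show ?thesis using E(2) unfolding embeds_def by metis
  qed
  moreover have "\<phi> ` set S \<subseteq> M" "card (\<phi> ` set S) \<le> 2"
    using S(1) unfolding M by (auto simp: card_insert_if)
  moreover have "\<exists>s\<in>\<phi> ` set S. r \<sim> s"
    using S(3) eadj_sound[of E \<phi> 1] E(2) unfolding embeds_def list_ex_iff by fastforce
  ultimately show thesis using that by blast
qed

lemma offer_4: assumes "branch v r M" "card M = 4" shows "offer False v M 2 1"
proof -
  obtain S where S: "S \<subseteq> M" "card S \<le> 2" "covers M S" "\<exists>s\<in>S. r \<sim> s" using branch_4_self[OF assms] .
  have "attached v S 1" unfolding attached_def using S assms unfolding branch_def near_def by auto
  then show ?thesis unfolding offer_def using S by auto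
qed

lemma offer_mono_mode: "offer False v M s d \<Longrightarrow> offer True v M s d"
  unfolding offer_def using covers_mono by (metis subset_insertI order_refl)

lemma offer_5_self: assumes "branch v r M" "card M = 5" shows "offer False v M 3 1"
proof -
  obtain E \<phi> where E: "E \<in> set (shapes 5)" "embeds \<phi> v r M 5 E" using branch_shape[OF assms] .
  obtain S where S: "S \<in> set [[1,2,3],[1,2,4],[2,3,4]]" "list_all (edom E S) [1,2,3,4,5]" "list_ex (eadj E 1) S"
    using shapes_5_self_cover E(1)
    unfolding list_all_iff[of _ "shapes 5"] list_ex_iff[of _ "[[1,2,3],[1,2,4],[2,3,4]]"] by blast
  have "covers (\<phi> ` set [1,2,3,4,5]) (\<phi> ` set S)"
    by (rule embeds_covers[OF E(2) S(2)]) (use S(1) in auto)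
  moreover have M: "M = \<phi> ` set [1,2,3,4,5]"
  proof -
    have "{1..5} = set [1,2,3,4,5::nat]" by auto
    then show ?thesis using E(2) unfolding embeds_def by metis
  qed
  moreover have sub: "\<phi> ` set S \<subseteq> M" "card (\<phi> ` set S) \<le> 3"
    using S(1) unfolding M by (auto simp: card_insert_if)
  moreover have "\<exists>s\<in>\<phi> ` set S. r \<sim> s"
    using S(3) eadj_sound[of E \<phi> 1] E(2) unfolding embeds_def list_ex_iff by fastforce
  then obtain s where s: "s \<in> \<phi> ` set S" "r \<sim> s" by (elim bexE)
  then have "s \<in> M" using sub by (elim subsetD)
  then have "near v s" using s assms(1) unfolding branch_def near_def by metis
  then have "attached v (\<phi> ` set S) 1" unfolding attached_def using s(1) by auto
  ultimately show ?thesis unfolding offer_def by auto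
qed

lemma offer_5: assumes "branch v r M" "card M = 5" shows "offer True v M 2 0"
proof -
  obtain E \<phi> where E: "E \<in> set (shapes 5)" "embeds \<phi> v r M 5 E" using branch_shape[OF assms] .
  obtain S where S: "S \<in> set [[2,3],[2,4],[4,5]]" "list_all (edom E (0 # S)) [1,2,3,4,5]"
    using shapes_5_cover E(1)
    unfolding list_all_iff[of _ "shapes 5"] list_ex_iff[of _ "[[2,3],[2,4],[4,5]]"] by blast
  have "covers (\<phi> ` set [1,2,3,4,5]) (\<phi> ` set (0 # S))"
    by (rule embeds_covers[OF E(2) S(2)]) (use S(1) in auto)
  moreover have M: "M = \<phi> ` set [1,2,3,4,5]"
  proof -
    have "{1..5} = set [1,2,3,4,5::nat]" by auto
    then show ?thesis using E(2) unfolding embeds_def by metis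
  qed
  moreover have sub: "\<phi> ` set S \<subseteq> M" "card (\<phi> ` set S) \<le> 2"
    using S(1) unfolding M by (auto simp: card_insert_if)
  moreover have "\<phi> ` set (0 # S) = insert v (\<phi> ` set S)" using E(2) unfolding embeds_def by auto
  ultimately show ?thesis unfolding offer_def attached_def by (intro exI[of _ "\<phi> ` set S"]) auto
qed

lemma dominated_insert_self: "dominated v (insert v S) \<Longrightarrow> dominated v S"
  unfolding dominated_def near_def using adj_irrefl by auto

lemma offer_6: assumes "branch v r M" "card M = 6" shows "offer True v M 3 2"
proof -
  obtain E \<phi> where E: "E \<in> set (shapes 6)" "embeds \<phi> v r M 6 E" using branch_shape[OF assms] .
  obtain S where S: "S \<in> set [[1,3,4],[2,3,5],[1,5,6]]" "list_all (edom E (0 # S)) [0,1,2,3,4,5,6]"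
    using shapes_6_cover E(1)
    unfolding list_all_iff[of _ "shapes 6"] list_ex_iff[of _ "[[1,3,4],[2,3,5],[1,5,6]]"] by blast
  have c: "covers (\<phi> ` set [0,1,2,3,4,5,6]) (\<phi> ` set (0 # S))"
    by (rule embeds_covers[OF E(2) S(2)]) (use S(1) in auto)
  moreover have M: "M = \<phi> ` set [1,2,3,4,5,6]"
  proof -
    have "{1..6} = set [1,2,3,4,5,6::nat]" by auto
    then show ?thesis using E(2) unfolding embeds_def by metis
  qed
  moreover have sub: "\<phi> ` set S \<subseteq> M" "card (\<phi> ` set S) \<le> 3"
    using S(1) unfolding M by (auto simp: card_insert_if)
  moreover have e: "\<phi> ` set (0 # S) = insert v (\<phi> ` set S)" "\<phi> 0 = v" using E(2) unfolding embeds_def by auto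
  moreover have "dominated v (\<phi> ` set S)"
    using c e dominated_insert_self unfolding covers_def by auto
  ultimately show ?thesis unfolding offer_def
    by (intro exI[of _ "\<phi> ` set S"]) (auto intro: dominated_attached covers_mono)
qed

text \<open>A path branch costs one more than \<open>star_s 3\<close>, because \<open>v\<close> and
  \<open>a\<close> need not dominate its end \<open>c\<close>. In exchange the cover works without
  \<open>v\<close> and dominates \<open>v\<close>.\<close>

lemma offer_path3:
  assumes "path3 v M a b c" shows "offer False v M 2 2"
proof -
  have "covers M {a, b}" "dominated v {a, b}" "card {a, b} \<le> 2"
    using assms adj_sym unfolding path3_def covers_def dominated_def by (auto simp: card_insert_if)
  then show ?thesis unfolding offer_def using assms
    by (intro exI[of _ "{a, b}"]) (auto simp: path3_def intro: dominated_attached)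
qed

lemma offer_root:
  assumes "branch v r M" "covers M {v, r}" shows "offer True v M 1 2"
proof -
  have "dominated v {r}" using assms unfolding branch_def dominated_def by auto
  then show ?thesis unfolding offer_def using assms
    by (intro exI[of _ "{r}"]) (auto simp: branch_def intro: dominated_attached)
qed

lemma leg_offer:
  assumes "leg v M" "\<nexists>a b c. path3 v M a b c"
  shows "offer True v M (star_s (card M)) (star_d (card M))"
proof (cases "M = {}")
  case True then show ?thesis using offer_empty by (simp add: star_d_def)
next
  case False
  then obtain r where r: "branch v r M" using assms unfolding leg_def by blast
  then have "card M \<noteq> 0" "card M \<le> 6" using False branch_finite[OF r] r by (auto simp: branch_def)
  then consider "card M = 1" | "card M = 2" | "card M = 3" | "card M = 4" | "card M = 5" | "card M = 6"
    by linarith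
  then show ?thesis
  proof cases
    case 1
    then have "M = {r}" using r by (auto simp: card_1_singleton_iff branch_def)
    then have "covers M {v}" using r adj_sym unfolding covers_def dominated_def branch_def by auto
    then show ?thesis using 1 unfolding offer_def attached_def
      by (intro exI[of _ "{}"]) (auto simp: star_s_def star_d_def)
  next
    case 2 then show ?thesis using offer_root[OF r branch_2_cover[OF r]] by (simp add: star_s_def star_d_def)
  next
    case 3 then show ?thesis using offer_root[OF r] branch_3_cases[OF r] assms(2)
      by (auto simp: star_s_def star_d_def)
  next
    case 4 then show ?thesis using offer_mono_mode[OF offer_4[OF r]] by (simp add: star_s_def star_d_def)
  next
    case 5 then show ?thesis using offer_5[OF r] by (simp add: star_s_def star_d_def)
  next
    case 6 then show ?thesis using offer_6[OF r] by (simp add: star_s_def star_d_def)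
  qed
qed


section \<open>The bound\<close>

definition good :: "'a set \<Rightarrow> bool" where
  "good X \<longleftrightarrow> (\<exists>k. 7 * k < 4 * card X \<and> cost X k)"

definition unit :: "'a set \<Rightarrow> bool" where
  "unit U \<longleftrightarrow> con U \<and> card U = 7 \<and> cost U 4"

definition unit_partition :: "'a set set \<Rightarrow> 'a set \<Rightarrow> bool" where
  "unit_partition P X \<longleftrightarrow> finite P \<and> \<Union>P = X \<and> disjoint P \<and> (\<forall>U\<in>P. unit U)"

definition decomposable :: "'a set \<Rightarrow> bool" where
  "decomposable X \<longleftrightarrow> (\<exists>P. unit_partition P X)"

definition fine :: "'a set \<Rightarrow> bool" where
  "fine X \<longleftrightarrow> good X \<or> decomposable X"

text \<open>
  The exceptional graph of order 10: it needs 6 vertices, and \<open>7 * 6 > 4 * 10\<close>.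
\<close>

definition net :: "'a set \<Rightarrow> 'a \<Rightarrow> 'a \<Rightarrow> 'a \<Rightarrow> 'a \<Rightarrow> 'a \<Rightarrow> 'a \<Rightarrow> 'a \<Rightarrow> 'a \<Rightarrow> 'a \<Rightarrow> 'a \<Rightarrow> bool" where
  "net X t x x' s y y' u z z' z'' \<longleftrightarrow>
     X = {t, x, x', s, y, y', u, z, z', z''} \<and> distinct [t, x, x', s, y, y', u, z, z', z''] \<and>
     t \<sim> s \<and> t \<sim> u \<and> s \<sim> u \<and> t \<sim> x \<and> x \<sim> x' \<and> s \<sim> y \<and> y \<sim> y' \<and> u \<sim> z \<and> z \<sim> z' \<and> z' \<sim> z''"

definition netlike :: "'a set \<Rightarrow> bool" where
  "netlike X \<longleftrightarrow> (\<exists>t x x' s y y' u z z' z''. net X t x x' s y y' u z z' z'')"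

lemma unit_partition_cost:
  assumes "unit_partition P X" shows "card X = 7 * card P" "cost X (4 * card P)"
proof -
  have "finite P" using assms unfolding unit_partition_def by blast
  then have "card X = 7 * card P \<and> cost X (4 * card P)"
    using assms
  proof (induction P arbitrary: X rule: finite_induct)
    case empty
    then show ?case unfolding unit_partition_def cost_def covers_def by auto
  next
    case (insert U P)
    have U: "unit U" using insert unfolding unit_partition_def by blast
    have P: "unit_partition P (\<Union>P)" using insert unfolding unit_partition_def
      by (auto simp: pairwise_insert)
    have dis: "U \<inter> \<Union>P = {}" using insert unfolding unit_partition_def
      by (auto simp: pairwise_insert disjnt_def)
    have fin: "finite U" "finite (\<Union>P)" using U P con_finite unfolding unit_partition_def unit_def by auto
    have X: "X = U \<union> \<Union>P" using insert unfolding unit_partition_def by auto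
    then have "card X = card U + card (\<Union>P)" using card_Un_disjoint[OF fin dis] by simp
    moreover have "cost X (4 + 4 * card P)" unfolding X using cost_Un U insert.IH[OF P] unfolding unit_def
      by blast
    ultimately show ?case using insert.IH[OF P] insert.hyps U unfolding unit_def by (simp add: algebra_simps)
  qed
  then show "card X = 7 * card P" "cost X (4 * card P)" by auto
qed

lemma decomposable_cost: "decomposable X \<Longrightarrow> \<exists>k. card X = 7 * k \<and> cost X (4 * k)"
  unfolding decomposable_def using unit_partition_cost by blast

lemma fine_cost: assumes "fine X" shows "\<exists>k. 7 * k \<le> 4 * card X \<and> cost X k"
proof (cases "good X")
  case True then show ?thesis unfolding good_def using less_imp_le by blast
next
  case False
  then obtain k where "card X = 7 * k" "cost X (4 * k)" using assms decomposable_cost unfolding fine_def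
    by blast
  then show ?thesis by (intro exI[of _ "4 * k"]) auto
qed

lemma good_Un_fine:
  assumes "good X" "fine Y" "X \<inter> Y = {}" "finite X" "finite Y" shows "good (X \<union> Y)"
proof -
  obtain k l where "7 * k < 4 * card X" "cost X k" "7 * l \<le> 4 * card Y" "cost Y l"
    using assms fine_cost unfolding good_def by blast
  then show ?thesis using cost_Un card_Un_disjoint[OF assms(4,5,3)] unfolding good_def
    by (intro exI[of _ "k + l"]) auto
qed

lemma fine_Un:
  assumes "fine X" "fine Y" "X \<inter> Y = {}" "finite X" "finite Y" shows "fine (X \<union> Y)"
proof -
  consider "good X" | "good Y" | "decomposable X" "decomposable Y" using assms unfolding fine_def by blast
  then show ?thesis
  proof cases
    case 1 then show ?thesis using good_Un_fine assms unfolding fine_def by blast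
  next
    case 2 then show ?thesis using good_Un_fine[of Y X] assms unfolding fine_def
      by (metis Int_commute Un_commute)
  next
    case 3
    then obtain P Q where PQ: "unit_partition P X" "unit_partition Q Y" unfolding decomposable_def by blast
    then have "disjnt U W" if "U \<in> P" "W \<in> Q" for U W
      using assms(3) that unfolding unit_partition_def disjnt_def by blast
    then have "disjoint (P \<union> Q)" using PQ unfolding unit_partition_def pairwise_def
      by (metis Un_iff disjnt_sym)
    then have "unit_partition (P \<union> Q) (X \<union> Y)" using PQ unfolding unit_partition_def by auto
    then show ?thesis unfolding fine_def decomposable_def by blast
  qed
qed

lemma unit_fine: "con X \<Longrightarrow> card X = 7 \<Longrightarrow> cost X 4 \<Longrightarrow> fine X"
  unfolding fine_def decomposable_def by (intro disjI2 exI[of _ "{X}"]) (auto simp: unit_partition_def unit_def)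

lemma good_fine: "cost X k \<Longrightarrow> 7 * k < 4 * card X \<Longrightarrow> fine X"
  unfolding fine_def good_def by blast

lemma list_cost:
  assumes "list_all (edom E S) [0..<length xs]" "\<forall>(i, j)\<in>set E. xs ! i \<sim> xs ! j" "distinct xs" "distinct S"
    "\<forall>i\<in>set S. i < length xs" "set xs \<subseteq> V" "length S \<le> k"
  shows "cost (set xs) k"
proof -
  have "covers ((!) xs ` set [0..<length xs]) ((!) xs ` set S)"
    by (rule list_covers[OF assms(1-4)]) (use assms(5) in auto)
  moreover have "(!) xs ` set [0..<length xs] = set xs" using map_nth[of xs] by (metis set_map)
  moreover have "card ((!) xs ` set S) \<le> k" using card_image_le[of "set S" "(!) xs"] card_length[of S] assms(7)
    by simp
  moreover have "(!) xs ` set S \<subseteq> V" using assms(5,6) by auto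
  ultimately show ?thesis unfolding cost_def by metis
qed

lemma net_V: "net X t x x' s y y' u z z' z'' \<Longrightarrow> X \<subseteq> V"
  using adj_in adj_sym unfolding net_def by auto

lemma netlike_cost: assumes "netlike X" shows "cost X 6" "card X = 10" "finite X"
proof -
  obtain t x x' s y y' u z z' z'' where n: "net X t x x' s y y' u z z' z''" using assms unfolding netlike_def
    by blast
  let ?xs = "[t, x, x', s, y, y', u, z, z', z'']"
  have X: "X = set ?xs" "distinct ?xs" using n unfolding net_def by auto
  show "card X = 10" using distinct_card[OF X(2)] X(1) by simp
  show "finite X" using X(1) by simp
  have "cost (set ?xs) 6"
  proof (rule list_cost[where E = "[(0,3),(0,6),(3,6),(0,1),(1,2),(3,4),(4,5),(6,7),(7,8),(8,9)]"
    and S = "[0,1,3,4,7,8]"])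
    have "length ?xs = 10" by simp
    moreover have "list_all (edom [(0,3),(0,6),(3,6),(0,1),(1,2),(3,4),(4,5),(6,7),(7,8),(8,9)] [0,1,3,4,7,8])
      [0..<10]"
      by code_simp
    ultimately show "list_all (edom [(0,3),(0,6),(3,6),(0,1),(1,2),(3,4),(4,5),(6,7),(7,8),(8,9)] [0,1,3,4,7,8])
      [0..<length ?xs]"
      by metis
    show "distinct ?xs" by (rule X(2))
    show "set ?xs \<subseteq> V" using net_V[OF n] X by simp
  qed (use n in \<open>auto simp: net_def\<close>)
  then show "cost X 6" using X by simp
qed

lemma branch_con_insert: "branch v r M \<Longrightarrow> con (insert v M)"
  unfolding branch_def using con_insert adj_sym by blast

lemma path3_branch: assumes "path3 v M a b c" shows "branch v a M" "card M = 3"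
proof -
  show c: "card M = 3" using assms unfolding path3_def by auto
  have "b \<in> V" using assms adj_in unfolding path3_def by blast
  then have "con {a, b}" using con_insert[of "{b}" b a] con_singleton assms adj_sym unfolding path3_def by auto
  then have "con {c, a, b}" using con_insert[of "{a, b}" b c] assms unfolding path3_def by auto
  moreover have "M = {c, a, b}" using assms unfolding path3_def by auto
  ultimately show "branch v a M" using assms c unfolding branch_def path3_def by auto
qed

text \<open>The edge between the roots saves a vertex: \<open>b\<close> is dominated by
  \<open>v\<close> and \<open>r\<close>, both two steps away through \<open>a\<close>, so the path
  costs \<open>b\<close> alone.\<close>

lemma path3_pair_offer:
  assumes "path3 v M a b c" "branch v r N" "covers N {v, r}" "M \<inter> N = {}" "a \<sim> r"
  shows "offer True v (M \<union> N) 2 2"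
proof -
  have ne: "v \<noteq> r" "b \<noteq> v" "b \<noteq> r" using assms unfolding path3_def branch_def by auto
  have "near b v" "near b r" using assms ne adj_sym unfolding near_def path3_def by blast+
  then have "dominated b {v, b, r}" unfolding dominated_def using ne by blast
  moreover have "dominated a {v, b, r}" "dominated c {v, b, r}" "dominated v {b, r}"
    using assms adj_sym unfolding dominated_def path3_def branch_def by blast+
  ultimately have "covers (M \<union> N) {v, b, r}" "dominated v {b, r}"
    using assms covers_mono[OF assms(3) order_refl, of "{v, b, r}"] unfolding covers_def path3_def by auto
  then show ?thesis using assms unfolding offer_def
    by (intro exI[of _ "{b, r}"]) (auto simp: path3_def branch_def card_insert_if intro: dominated_attached)
qed

text \<open>The same saving for two paths: \<open>b\<close> reaches \<open>v\<close> and
  \<open>a'\<close> through \<open>a\<close>, so the first path costs \<open>b\<close> alone and the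
  second one costs two vertices.\<close>

lemma path3_path3_offer:
  assumes "path3 v M a b c" "path3 v N a' b' c'" "M \<inter> N = {}" "a \<sim> a'"
  shows "offer True v (M \<union> N) 3 2"
proof -
  have ne: "v \<noteq> a'" "b \<noteq> v" "b \<noteq> a'" using assms unfolding path3_def by auto
  have "near b v" "near b a'" using assms ne adj_sym unfolding near_def path3_def by blast+
  then have "dominated b {v, b, a', b'}" unfolding dominated_def using ne by blast
  moreover have "dominated a {v, b, a', b'}" "dominated c {v, b, a', b'}" "dominated v {b, a', b'}"
     "dominated a' {v, b, a', b'}" "dominated b' {v, b, a', b'}" "dominated c' {v, b, a', b'}"
    using assms adj_sym unfolding dominated_def path3_def by blast+
  ultimately have "covers (M \<union> N) {v, b, a', b'}" "dominated v {b, a', b'}"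
    using assms unfolding covers_def path3_def by auto
  then show ?thesis using assms unfolding offer_def
    by (intro exI[of _ "{b, a', b'}"]) (auto simp: path3_def card_insert_if intro: dominated_attached)
qed

text \<open>The adjacent roots and \<open>v\<close> form the triangle, the remainders of their paths
  are the short arms, and the third path is the long arm at \<open>v\<close>.\<close>

lemma two_path3_net:
  assumes "path3 v M a b c" "path3 v N a' b' c'" "path3 v L d e f" "M \<inter> N = {}" "M \<inter> L = {}" "N \<inter> L = {}"
    "a \<sim> a'"
  shows "netlike (insert v (M \<union> N \<union> L))"
proof -
  have "net (insert v (M \<union> N \<union> L)) a b c a' b' c' v d e f"
    using assms adj_sym unfolding net_def path3_def by auto
  then show ?thesis unfolding netlike_def by blast
qed


lemma leg_card: "leg v M \<Longrightarrow> card M \<le> 6"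
  and leg_finite: "leg v M \<Longrightarrow> finite M"
  and leg_notin: "leg v M \<Longrightarrow> v \<notin> M"
  and leg_V: "leg v M \<Longrightarrow> M \<subseteq> V"
  unfolding leg_def branch_def using con_finite con_sub by auto

lemma branch_V: "branch v r M \<Longrightarrow> insert v M \<subseteq> V"
  unfolding branch_def using con_sub adj_in by auto

lemma con_star:
  assumes "leg v M1" "leg v M2" "v \<in> V"
  shows "con (insert v (M1 \<union> M2))"
proof -
  have 1: "con (insert v M)" if "leg v M" for M
    using that branch_con_insert con_singleton assms(3) unfolding leg_def by auto
  show ?thesis
  proof (cases "M2 = {}")
    case True then show ?thesis using 1[OF assms(1)] by simp
  next
    case False
    then obtain r where r: "branch v r M2" using assms unfolding leg_def by blast
    have "con (insert v M1 \<union> M2)" using con_Un[OF 1[OF assms(1)], of M2 v r] r unfolding branch_def by auto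
    then show ?thesis by simp
  qed
qed

lemma star_card:
  assumes "leg v M1" "leg v M2" "leg v M3" "M1 \<inter> M2 = {}" "M1 \<inter> M3 = {}" "M2 \<inter> M3 = {}"
  shows "card (insert v (M1 \<union> M2 \<union> M3)) = 1 + card M1 + card M2 + card M3"
proof -
  have "card (M1 \<union> M2 \<union> M3) = card M1 + card M2 + card M3"
    using assms leg_finite by (subst card_Un_disjoint) (auto simp: card_Un_disjoint)
  then show ?thesis using assms leg_finite leg_notin by auto
qed

lemma star_cost:
  assumes "offer b v M1 s1 d1" "offer b v M2 s2 d2" "offer b v M3 s3 d3"
    and "M1 \<inter> M2 = {}" "M1 \<inter> M3 = {}" "M2 \<inter> M3 = {}" "M1 \<union> M2 \<union> M3 \<subseteq> V" "v \<sim> r"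
  shows "cost (insert v (M1 \<union> M2 \<union> M3)) ((if b then 1 else 0) + s1 + s2 + s3 + (if 2 \<le> d1 + d2 + d3 then 0 else
    1))"
  by (rule star_cover[OF assms]) (auto simp: cost_def)

text \<open>Here \<open>v\<close> is left out. The branches spend 2 and 3 vertices of their own,
  each with one of them within distance two of \<open>v\<close>, so five suffice at order
  10.\<close>

lemma star_four_five:
  assumes "branch v r M" "card M = 4" "branch v q N" "card N = 5" "M \<inter> N = {}"
  shows "fine (insert v (M \<union> N))"
proof -
  have l: "leg v M" "leg v N" "leg v {}" using assms unfolding leg_def by auto
  have "cost (insert v (M \<union> N \<union> {})) 5"
    using star_cost[OF offer_4[OF assms(1,2)] offer_5_self[OF assms(3,4)]
      offer_empty[where s = 0], of r] assms l leg_V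
    by (auto simp: branch_def)
  then show ?thesis using star_card[OF l] assms by (intro good_fine[of _ 5]) auto
qed

lemma star_without_path3:
  assumes "leg v M1" "leg v M2" "leg v M3" "M1 \<inter> M2 = {}" "M1 \<inter> M3 = {}" "M2 \<inter> M3 = {}"
    and "7 \<le> card (insert v (M1 \<union> M2 \<union> M3))"
    and "\<And>M a b c. M \<in> {M1, M2, M3} \<Longrightarrow> \<not> path3 v M a b c"
    and "con (insert v (M1 \<union> M2 \<union> M3))"
  shows "fine (insert v (M1 \<union> M2 \<union> M3))"
proof -
  let ?X = "insert v (M1 \<union> M2 \<union> M3)"
  let ?k = "1 + star_s (card M1) + star_s (card M2) + star_s (card M3)
      + (if 2 \<le> star_d (card M1) + star_d (card M2) + star_d (card M3) then 0 else 1)"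
  note n = star_card[OF assms(1-6)]
  obtain r where r: "v \<sim> r"
    using assms(1-3,7) n unfolding leg_def branch_def by (cases "M1 = {} \<and> M2 = {} \<and> M3 = {}") auto
  have k: "cost ?X ?k"
    using star_cost[OF leg_offer[OF assms(1)] leg_offer[OF assms(2)] leg_offer[OF assms(3)] assms(4-6) _ r]
      assms(1-3,8) leg_V by auto
  have c: "card M1 \<le> 6" "card M2 \<le> 6" "card M3 \<le> 6" "6 \<le> card M1 + card M2 + card M3"
    using assms(1-3,7) leg_card n by auto
  have e: "\<exists>r. branch v r M" if "leg v M" "card M \<noteq> 0" for M using that unfolding leg_def by auto
  from star_arith[OF c] consider "7 * ?k < 4 * card ?X" | "card ?X = 7" "?k \<le> 4"
    | "(card M1, card M2, card M3) \<in> {(0,4,5),(0,5,4),(4,0,5),(4,5,0),(5,0,4),(5,4,0)}"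
    unfolding n by auto
  then show ?thesis
  proof cases
    case 1 then show ?thesis using good_fine[OF k] by blast
  next
    case 2 then show ?thesis using unit_fine[OF assms(9)] cost_mono[OF k] by blast
  next
    case 3
    have z: "M = {}" if "leg v M" "card M = 0" for M using that leg_finite by auto
    have f: "fine (insert v (M \<union> N))" if "leg v M" "leg v N" "card M = 4" "card N = 5" "M \<inter> N = {}" for M N
      using star_four_five that e by (metis zero_neq_numeral)
    from 3 show ?thesis
      using f[of M1 M2] f[of M2 M1] f[of M1 M3] f[of M3 M1] f[of M2 M3] f[of M3 M2] z[of M1] z[of M2]
        z[of M3] assms(1-6)
      by (auto simp: Un_commute Int_commute)
  qed
qed

section \<open>Explicit vertex lists for stars with a hanging path\<close>

lemma shape_list:
  assumes "con M" "card M = m" "v \<notin> M" "v \<sim> r" "r \<in> M"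
  obtains E xs where "E \<in> set (shapes m)" "length xs = Suc m" "xs ! 0 = v" "xs ! 1 = r" "set xs = insert v M"
    "distinct xs" "\<forall>(i, j)\<in>set E. i < Suc m \<and> j < Suc m \<and> xs ! i \<sim> xs ! j"
proof -
  obtain E \<phi> where E: "E \<in> set (shapes m)" "embeds \<phi> v r M m E" using shape_exists[OF assms] by blast
  define xs where "xs = map \<phi> [0..<Suc m]"
  have m: "1 \<le> m" using assms con_finite[OF assms(1)] by (auto simp: Suc_le_eq card_gt_0_iff)
  have nth: "xs ! i = \<phi> i" if "i < Suc m" for i using that unfolding xs_def by (simp del: upt_Suc)
  have "set [0..<Suc m] = insert 0 {1..m}" by auto
  then have "set xs = insert v M" using E(2) unfolding xs_def embeds_def set_map by auto
  moreover have "distinct xs" using E(2) unfolding xs_def embeds_def distinct_map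
    by (simp add: atLeast0LessThan lessThan_Suc_atMost del: upt_Suc)
  moreover have "\<forall>(i, j)\<in>set E. i < Suc m \<and> j < Suc m \<and> xs ! i \<sim> xs ! j"
    using E(2) nth unfolding embeds_def by fastforce
  moreover have "xs ! 0 = v" "xs ! 1 = r" using E(2) nth m unfolding embeds_def by auto
  ultimately show thesis using that[OF E(1), of xs] unfolding xs_def by simp
qed

lemma branch_list:
  assumes "branch v r M" "card M = m"
  obtains E xs where "E \<in> set (shapes m)" "length xs = Suc m" "xs ! 0 = v" "xs ! 1 = r" "set xs = insert v M"
    "distinct xs" "\<forall>(i, j)\<in>set E. i < Suc m \<and> j < Suc m \<and> xs ! i \<sim> xs ! j"
proof -
  have b: "con M" "v \<notin> M" "v \<sim> r" "r \<in> M" using assms(1) unfolding branch_def by auto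
  show thesis by (rule shape_list[OF b(1) assms(2) b(2-4)]) (rule that)
qed

lemma nth_append_edges:
  assumes "\<forall>(i, j)\<in>set E. i < length xs \<and> j < length xs \<and> xs ! i \<sim> xs ! j"
  shows "\<forall>(i, j)\<in>set E. (xs @ ys) ! i \<sim> (xs @ ys) ! j"
  using assms by (auto simp: nth_append)

lemma six_branch_tail:
  assumes "path3 v M a b c" "branch v r N" "card N = 6" "M \<inter> N = {}"
  shows "fine (insert v (M \<union> N)) \<or> netlike (insert v (M \<union> N))"
proof -
  obtain E ys where E: "E \<in> set (shapes 6)" "length ys = Suc 6" "ys ! 0 = v" "ys ! 1 = r" "set ys = insert v N"
    "distinct ys" "\<forall>(i, j)\<in>set E. i < Suc 6 \<and> j < Suc 6 \<and> ys ! i \<sim> ys ! j"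
    using branch_list[OF assms(2,3)] by blast
  define xs where "xs = ys @ [a, b, c]"
  have X: "insert v (M \<union> N) = set xs" using E(5) assms(1) unfolding xs_def path3_def by auto
  have dist: "distinct xs" using assms E(5,6) unfolding xs_def path3_def branch_def distinct_append by auto
  have adjs: "\<forall>(i, j)\<in>set (E @ [(0,7),(7,8),(8,9)]). xs ! i \<sim> xs ! j"
  proof -
    have "\<forall>(i, j)\<in>set E. xs ! i \<sim> xs ! j" unfolding xs_def using E(2,7) by (intro nth_append_edges) auto
    moreover have "xs ! 0 = v" "xs ! 1 = r" "xs ! 7 = a" "xs ! 8 = b" "xs ! 9 = c"
      using E(2-4) unfolding xs_def by (auto simp: nth_append)
    ultimately show ?thesis using assms adj_sym unfolding path3_def branch_def by auto
  qed
  have sub: "set xs \<subseteq> V"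
    using branch_V[OF assms(2)] branch_V[OF path3_branch(1)[OF assms(1)]] unfolding X[symmetric] by auto
  have len: "length xs = 10" unfolding xs_def using E(2) by simp
  have card10: "card (set xs) = 10" using distinct_card[OF dist] len by simp
  from shapes_6_tail_cover E(1) consider S where "S \<in> set [[1,3,4,7,8],[2,3,5,7,8],[0,4,5,7,8]]"
      "list_all (edom (E @ [(0,7),(7,8),(8,9)]) S) [0,1,2,3,4,5,6,7,8,9]"
    | "E = [(0,1),(0,2),(1,2),(2,3),(3,4),(1,5),(5,6)]"
    unfolding list_all_iff[of _ "shapes 6"] list_ex_iff[of _ "[[1,3,4,7,8],[2,3,5,7,8],[0,4,5,7,8]]"] by blast
  then show ?thesis
  proof cases
    case (1 S)
    have "[0..<length xs] = [0,1,2,3,4,5,6,7,8,9]" unfolding len by (simp add: upt_rec)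
    then have "cost (set xs) 5"
      using 1 by (intro list_cost[OF _ adjs dist _ _ sub]) (auto simp: len)
    then show ?thesis using card10 unfolding X by (intro disjI1 good_fine[of _ 5]) auto
  next
    case 2
    have nth: "xs = [xs!0,xs!1,xs!2,xs!3,xs!4,xs!5,xs!6,xs!7,xs!8,xs!9]" using len
      by (intro nth_equalityI) (auto simp: less_Suc_eq numeral_eq_Suc)
    have "net (set xs) (xs!1) (xs!5) (xs!6) (xs!2) (xs!3) (xs!4) (xs!0) (xs!7) (xs!8) (xs!9)"
      unfolding net_def
    proof (intro conjI)
      show "set xs = {xs ! 1, xs ! 5, xs ! 6, xs ! 2, xs ! 3, xs ! 4, xs ! 0, xs ! 7, xs ! 8, xs ! 9}"
        by (subst nth) auto
      have "distinct [xs!0,xs!1,xs!2,xs!3,xs!4,xs!5,xs!6,xs!7,xs!8,xs!9]" using dist nth by metis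
      then show "distinct [xs ! 1, xs ! 5, xs ! 6, xs ! 2, xs ! 3, xs ! 4, xs ! 0, xs ! 7, xs ! 8, xs ! 9]"
        by auto
    qed (use adjs 2 adj_sym in auto)
    then show ?thesis unfolding X netlike_def by blast
  qed
qed

lemma four_branch_tails:
  assumes "path3 v M a b c" "branch v r N" "card N = 4" "branch v e L" "card L = 2"
    "M \<inter> N = {}" "M \<inter> L = {}" "N \<inter> L = {}" "a \<sim> r"
  shows "fine (insert v (M \<union> N \<union> L)) \<or> netlike (insert v (M \<union> N \<union> L))"
proof -
  obtain f where f: "L = {e, f}" "e \<noteq> f" using assms(4,5) unfolding branch_def card_2_iff by force
  have ef: "e \<sim> f" using conD[of L "{e}"] f assms(4) unfolding branch_def by blast
  obtain E ys where E: "E \<in> set (shapes 4)" "length ys = Suc 4" "ys ! 0 = v" "ys ! 1 = r" "set ys = insert v N"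
    "distinct ys" "\<forall>(i, j)\<in>set E. i < Suc 4 \<and> j < Suc 4 \<and> ys ! i \<sim> ys ! j"
    using branch_list[OF assms(2,3)] by blast
  define xs where "xs = ys @ [a, b, c, e, f]"
  have X: "insert v (M \<union> N \<union> L) = set xs" using E(5) assms(1) f unfolding xs_def path3_def by auto
  have dist: "distinct xs" using assms E(5,6) f unfolding xs_def path3_def branch_def distinct_append by auto
  have adjs: "\<forall>(i, j)\<in>set (E @ [(0,5),(5,6),(6,7),(0,8),(8,9),(1,5)]). xs ! i \<sim> xs ! j"
  proof -
    have "\<forall>(i, j)\<in>set E. xs ! i \<sim> xs ! j" unfolding xs_def using E(2,7) by (intro nth_append_edges) auto
    moreover have "xs ! 0 = v" "xs ! 1 = r" "xs ! 5 = a" "xs ! 6 = b" "xs ! 7 = c" "xs ! 8 = e" "xs ! 9 = f"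
      using E(2-4) unfolding xs_def by (auto simp: nth_append)
    ultimately show ?thesis using assms adj_sym ef unfolding path3_def branch_def by auto
  qed
  have sub: "set xs \<subseteq> V"
    using branch_V[OF assms(2)] branch_V[OF assms(4)] branch_V[OF path3_branch(1)[OF assms(1)]]
    unfolding X[symmetric] by auto
  have len: "length xs = 10" unfolding xs_def using E(2) by simp
  have card10: "card (set xs) = 10" using distinct_card[OF dist] len by simp
  from shapes_4_tails_cover E(1) consider
      "list_all (edom (E @ [(0,5),(5,6),(6,7),(0,8),(8,9),(1,5)]) [0,1,2,6,8]) [0,1,2,3,4,5,6,7,8,9]"
    | "E = [(0,1),(1,2),(2,3),(3,4)]"
    unfolding list_all_iff[of _ "shapes 4"] by blast
  then show ?thesis
  proof cases
    case 1
    have "[0..<length xs] = [0,1,2,3,4,5,6,7,8,9]" unfolding len by (simp add: upt_rec)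
    then have "cost (set xs) 5"
      using 1 by (intro list_cost[OF _ adjs dist _ _ sub]) (auto simp: len)
    then show ?thesis using card10 unfolding X by (intro disjI1 good_fine[of _ 5]) auto
  next
    case 2
    have nth: "xs = [xs!0,xs!1,xs!2,xs!3,xs!4,xs!5,xs!6,xs!7,xs!8,xs!9]" using len
      by (intro nth_equalityI) (auto simp: less_Suc_eq numeral_eq_Suc)
    have "net (set xs) (xs!0) (xs!8) (xs!9) (xs!5) (xs!6) (xs!7) (xs!1) (xs!2) (xs!3) (xs!4)"
      unfolding net_def
    proof (intro conjI)
      show "set xs = {xs ! 0, xs ! 8, xs ! 9, xs ! 5, xs ! 6, xs ! 7, xs ! 1, xs ! 2, xs ! 3, xs ! 4}"
        by (subst nth) auto
      have "distinct [xs!0,xs!1,xs!2,xs!3,xs!4,xs!5,xs!6,xs!7,xs!8,xs!9]" using dist nth by metis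
      then show "distinct [xs ! 0, xs ! 8, xs ! 9, xs ! 5, xs ! 6, xs ! 7, xs ! 1, xs ! 2, xs ! 3, xs ! 4]"
        by auto
    qed (use adjs 2 adj_sym in auto)
    then show ?thesis unfolding X netlike_def by blast
  qed
qed

lemma six_branch_tails:
  assumes "path3 v M a b c" "branch v r N" "card N = 6" "branch v e L" "card L = 2"
    "M \<inter> N = {}" "M \<inter> L = {}" "N \<inter> L = {}" "a \<sim> r"
  shows "fine (insert v (M \<union> N \<union> L))"
proof -
  obtain f where f: "L = {e, f}" "e \<noteq> f" using assms(4,5) unfolding branch_def card_2_iff by force
  have ef: "e \<sim> f" using conD[of L "{e}"] f assms(4) unfolding branch_def by blast
  obtain E ys where E: "E \<in> set (shapes 6)" "length ys = Suc 6" "ys ! 0 = v" "ys ! 1 = r" "set ys = insert v N"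
    "distinct ys" "\<forall>(i, j)\<in>set E. i < Suc 6 \<and> j < Suc 6 \<and> ys ! i \<sim> ys ! j"
    using branch_list[OF assms(2,3)] by blast
  define xs where "xs = ys @ [a, b, c, e, f]"
  have X: "insert v (M \<union> N \<union> L) = set xs" using E(5) assms(1) f unfolding xs_def path3_def by auto
  have dist: "distinct xs" using assms E(5,6) f unfolding xs_def path3_def branch_def distinct_append by auto
  have adjs: "\<forall>(i, j)\<in>set (E @ [(0,7),(7,8),(8,9),(0,10),(10,11),(1,7)]). xs ! i \<sim> xs ! j"
  proof -
    have "\<forall>(i, j)\<in>set E. xs ! i \<sim> xs ! j" unfolding xs_def using E(2,7) by (intro nth_append_edges) auto
    moreover have "xs ! 0 = v" "xs ! 1 = r" "xs ! 7 = a" "xs ! 8 = b" "xs ! 9 = c" "xs ! 10 = e" "xs ! 11 = f"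
      using E(2-4) unfolding xs_def by (auto simp: nth_append)
    ultimately show ?thesis using assms adj_sym ef unfolding path3_def branch_def by auto
  qed
  have sub: "set xs \<subseteq> V"
    using branch_V[OF assms(2)] branch_V[OF assms(4)] branch_V[OF path3_branch(1)[OF assms(1)]]
    unfolding X[symmetric] by auto
  have len: "length xs = 12" unfolding xs_def using E(2) by simp
  have card12: "card (set xs) = 12" using distinct_card[OF dist] len by simp
  from shapes_6_tails_cover E(1) obtain S where S: "S \<in> set [[0,1,3,4,8,10],[0,1,3,5,8,10],[0,1,5,6,8,10]]"
      "list_all (edom (E @ [(0,7),(7,8),(8,9),(0,10),(10,11),(1,7)]) S) [0,1,2,3,4,5,6,7,8,9,10,11]"
    unfolding list_all_iff[of _ "shapes 6"] list_ex_iff[of _ "[[0,1,3,4,8,10],[0,1,3,5,8,10],[0,1,5,6,8,10]]"]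
      by blast
  have "[0..<length xs] = [0,1,2,3,4,5,6,7,8,9,10,11]" unfolding len by (simp add: upt_rec)
  then have "cost (set xs) 6"
    using S by (intro list_cost[OF _ adjs dist _ _ sub]) (auto simp: len)
  then show ?thesis using card12 unfolding X by (intro good_fine[of _ 6]) auto
qed


section \<open>Stars with a path of order 3 as a branch\<close>

text \<open>What the analysis of stars uses of the induction hypothesis. Parts that are the
  exceptional graph are dealt with when this is established, so they do not appear in it.\<close>

definition splits_fine :: "'a set \<Rightarrow> bool" where
  "splits_fine X \<longleftrightarrow> (\<forall>Y Z. X = Y \<union> Z \<longrightarrow> Y \<inter> Z = {} \<longrightarrow> con Y \<longrightarrow> con Z \<longrightarrow>
     card Y = 4 \<or> 7 \<le> card Y \<longrightarrow> card Z = 4 \<or> 7 \<le> card Z \<longrightarrow> fine X)"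

lemma splits_fineD:
  "splits_fine X \<Longrightarrow> X = Y \<union> Z \<Longrightarrow> Y \<inter> Z = {} \<Longrightarrow> con Y \<Longrightarrow> con Z \<Longrightarrow>
     card Y = 4 \<or> 7 \<le> card Y \<Longrightarrow> card Z = 4 \<or> 7 \<le> card Z \<Longrightarrow> fine X"
  unfolding splits_fine_def by blast

lemma star_cost_two:
  assumes "offer b v M1 s1 d1" "offer b v M2 s2 d2" "M1 \<inter> M2 = {}" "M1 \<union> M2 \<subseteq> V" "v \<sim> r"
    and "X = insert v (M1 \<union> M2)" "(if b then 1 else 0) + s1 + s2 + (if 2 \<le> d1 + d2 then 0 else 1) \<le> k"
  shows "cost X k"
  using star_cost[OF assms(1,2) offer_empty[where s = 0] assms(3) _ _ _ assms(5)] assms(4,6,7)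
  by (auto intro: cost_mono)

text \<open>By the order of \<open>L\<close>. For 1, the vertices \<open>a\<close>,
  \<open>b\<close>, \<open>a'\<close>, \<open>b'\<close> suffice at order 8. For 2 and 3, the edge
  between \<open>a\<close> and \<open>r\<close> saves a vertex, unless \<open>L\<close> is a third
  path and the exceptional graph arises. For 4, \<open>L\<close> is split off. From 5 on,
  \<open>v\<close> with \<open>N\<close> is a part of order 4, and \<open>M\<close> with
  \<open>L\<close> has order at least 8.\<close>

lemma two_path3_root:
  assumes M: "path3 v M a b c" and N: "path3 v N a' b' c'" and L: "branch v r L"
    and dis: "M \<inter> N = {}" "M \<inter> L = {}" "N \<inter> L = {}"
    and sp: "splits_fine (insert v (M \<union> N \<union> L))" and ar: "a \<sim> r"
  shows "fine (insert v (M \<union> N \<union> L)) \<or> netlike (insert v (M \<union> N \<union> L))"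
proof -
  let ?X = "insert v (M \<union> N \<union> L)"
  note bM = path3_branch[OF M] and bN = path3_branch[OF N]
  have legs: "leg v M" "leg v N" "leg v L" using bM bN L unfolding leg_def by auto
  have n: "card ?X = 7 + card L" using star_card[OF legs dis] bM bN by simp
  have vr: "v \<sim> r" "v \<in> V" using L adj_in unfolding branch_def by auto
  have cov: "fine ?X" if "covers L {v, r}" "2 \<le> card L"
  proof -
    have "cost ?X 5"
      by (rule star_cost_two[OF path3_pair_offer[OF M L that(1) dis(2) ar] offer_mono_mode[OF
        offer_path3[OF N]] _ _ vr(1)])
        (use dis leg_V legs in auto)
    then show ?thesis using that n by (intro good_fine[of _ 5]) auto
  qed
  have "card L \<noteq> 0" "card L \<le> 6" using L branch_finite[OF L] unfolding branch_def by auto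
  then consider "card L = 1" | "card L = 2" | "card L = 3" | "card L = 4" | "5 \<le> card L" by linarith
  then show ?thesis
  proof cases
    case 1
    then have Lr: "L = {r}" using L by (auto simp: card_1_singleton_iff branch_def)
    have "covers ?X {a, b, a', b'}"
      using M N ar vr adj_sym unfolding Lr covers_def dominated_def path3_def by auto
    moreover have "card {a, b, a', b'} \<le> 4" by (auto simp: card_insert_if)
    moreover have "{a, b, a', b'} \<subseteq> V" using M N leg_V legs unfolding path3_def by blast
    ultimately have "cost ?X 4" unfolding cost_def by blast
    then show ?thesis using n 1 by (intro disjI1 good_fine[of _ 4]) auto
  next
    case 2 then show ?thesis using cov branch_2_cover[OF L] by auto
  next
    case 3
    then consider "covers L {v, r}" | e f where "path3 v L r e f" using branch_3_cases[OF L] by blast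
    then show ?thesis
    proof cases
      case 1 then show ?thesis using cov 3 by auto
    next
      case 2
      have "netlike (insert v (M \<union> L \<union> N))" using two_path3_net[OF M 2 N] dis ar by blast
      then show ?thesis by (simp add: Un_ac)
    qed
  next
    case 4
    have "fine ?X"
    proof (rule splits_fineD[OF sp, of L "insert v (M \<union> N)"])
      show "con (insert v (M \<union> N))" by (rule con_star) (use legs vr in auto)
      show "card (insert v (M \<union> N)) = 4 \<or> 7 \<le> card (insert v (M \<union> N))"
        using star_card[of v M N "{}"] legs dis bM bN by (auto simp: leg_def)
    qed (use 4 dis L leg_notin[OF legs(3)] in \<open>auto simp: branch_def\<close>)
    then show ?thesis by blast
  next
    case 5
    have "fine ?X"
    proof (rule splits_fineD[OF sp, of "insert v N" "M \<union> L"])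
      show "con (insert v N)" using branch_con_insert bN by blast
      show "con (M \<union> L)" using con_Un[of M L a r] bM L ar unfolding branch_def by blast
      show "card (insert v N) = 4 \<or> 7 \<le> card (insert v N)"
        using star_card[of v N "{}" "{}"] legs bN by (auto simp: leg_def)
      show "card (M \<union> L) = 4 \<or> 7 \<le> card (M \<union> L)"
        using card_Un_disjoint[OF leg_finite[OF legs(1)] leg_finite[OF legs(3)] dis(2)] bM 5 by auto
    qed (use dis leg_notin legs in auto)
    then show ?thesis by blast
  qed
qed

text \<open>With a third branch, the claw condition at \<open>v\<close> makes two of the three roots
  adjacent. Without one, the set is spanned by a path of order 7 with middle \<open>v\<close> and is
  a unit.\<close>

lemma star_two_path3:
  assumes M: "path3 v M a b c" and N: "path3 v N a' b' c'" and L: "leg v L"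
    and dis: "M \<inter> N = {}" "M \<inter> L = {}" "N \<inter> L = {}"
    and sp: "splits_fine (insert v (M \<union> N \<union> L))"
  shows "fine (insert v (M \<union> N \<union> L)) \<or> netlike (insert v (M \<union> N \<union> L))"
proof -
  let ?X = "insert v (M \<union> N \<union> L)"
  note bM = path3_branch[OF M] and bN = path3_branch[OF N]
  have legs: "leg v M" "leg v N" using bM bN unfolding leg_def by auto
  have n: "card ?X = 7 + card L" using star_card[OF legs L dis] bM bN by simp
  have va: "v \<sim> a" "v \<in> V" using M adj_in unfolding path3_def by auto
  show ?thesis
  proof (cases "L = {}")
    case True
    have "cost (insert v (M \<union> N)) 4"
      by (rule star_cost_two[OF offer_path3[OF M] offer_path3[OF N] dis(1) _ va(1)]) (use leg_V legs in auto)
    moreover have "con (insert v (M \<union> N))" by (rule con_star) (use legs va in auto)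
    ultimately show ?thesis using unit_fine n True by auto
  next
    case False
    then obtain r where r: "branch v r L" using L unfolding leg_def by blast
    have "a \<noteq> a'" "a \<noteq> r" "a' \<noteq> r" using dis M N r unfolding path3_def branch_def by auto
    then consider "a \<sim> a'" | "a \<sim> r" | "a' \<sim> r" using claw[of v a a' r] M N r unfolding path3_def branch_def
      by blast
    then show ?thesis
    proof cases
      case 1
      show ?thesis
      proof (cases "\<exists>d e f. path3 v L d e f")
        case True
        then show ?thesis using two_path3_net[OF M N] dis 1 by blast
      next
        case False
        have "cost ?X (4 + star_s (card L))"
          by (rule star_cost_two[OF path3_path3_offer[OF M N dis(1) 1] leg_offer[OF L False] _ _ va(1)])
            (use dis leg_V legs L in auto)
        moreover have "card L \<noteq> 0" "card L \<le> 6" using r branch_finite[OF r] unfolding branch_def by auto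
        then have "7 * (4 + star_s (card L)) < 4 * card ?X" unfolding n star_s_def by auto
        ultimately show ?thesis using good_fine by blast
      qed
    next
      case 2 then show ?thesis using two_path3_root[OF M N r dis sp] by blast
    next
      case 3
      have e: "insert v (N \<union> M \<union> L) = ?X" by auto
      show ?thesis using two_path3_root[OF N M r, unfolded e] dis sp 3 by (simp add: Int_commute)
    qed
  qed
qed

text \<open>These are the sizes left over by \<open>path3_arith\<close>. Where possible the star is
  split, either into \<open>v\<close> with \<open>M\<close> (order 4) and the rest, or at a branch
  of order 4. If \<open>N\<close> has order 2, the claw condition at \<open>v\<close> is applied to
  the three roots.\<close>

lemma path3_special:
  assumes M: "path3 v M a b c" and N: "leg v N" and L: "leg v L"
    and dis: "M \<inter> N = {}" "M \<inter> L = {}" "N \<inter> L = {}"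
    and sp: "splits_fine (insert v (M \<union> N \<union> L))"
    and sizes: "(card N, card L) \<in> {(0,4),(0,6),(2,2),(2,4),(2,6),(4,4),(4,6)}"
  shows "fine (insert v (M \<union> N \<union> L)) \<or> netlike (insert v (M \<union> N \<union> L))"
proof -
  let ?X = "insert v (M \<union> N \<union> L)"
  note bM = path3_branch[OF M]
  have legs: "leg v M" using bM unfolding leg_def by auto
  have n: "card ?X = 4 + card N + card L" using star_card[OF legs N L dis] bM by simp
  have va: "v \<sim> a" "v \<in> V" using M adj_in unfolding path3_def by auto
  have "L \<noteq> {}" using sizes by auto
  then obtain r where r: "branch v r L" using L unfolding leg_def by blast
  have Mv: "con (insert v M)" "card (insert v M) = 4"
    using branch_con_insert bM leg_notin[OF legs] leg_finite[OF legs] by auto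
  have part: "fine ?X" if "con (N \<union> L)" "card (N \<union> L) = 4 \<or> 7 \<le> card (N \<union> L)"
    by (rule splits_fineD[OF sp, of "insert v M" "N \<union> L"])
      (use that Mv dis leg_notin[OF N] leg_notin[OF L] in auto)
  consider "card N = 0" | "card N = 4" | "card N = 2" using sizes by auto
  then show ?thesis
  proof cases
    case 1
    then have "N = {}" using leg_finite[OF N] by auto
    then show ?thesis using six_branch_tail[OF M r] part r dis sizes unfolding branch_def by auto
  next
    case 2
    have "fine ?X"
    proof (rule splits_fineD[OF sp, of N "insert v (M \<union> L)"])
      show "con N" using N 2 unfolding leg_def branch_def by auto
      show "con (insert v (M \<union> L))" by (rule con_star) (use legs va L in auto)
      show "card (insert v (M \<union> L)) = 4 \<or> 7 \<le> card (insert v (M \<union> L))"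
        using star_card[of v M L "{}"] legs dis L bM sizes 2 by (auto simp: leg_def)
    qed (use 2 dis leg_notin[OF N] in auto)
    then show ?thesis by blast
  next
    case 3
    then obtain p where p: "branch v p N" using N unfolding leg_def by auto
    note pcov = branch_2_cover[OF p 3]
    \<comment> \<open>With \<open>a\<close> adjacent to \<open>p\<close>, the vertices
      \<open>v\<close>, \<open>b\<close> and \<open>p\<close> serve both \<open>M\<close> and
      \<open>N\<close>.\<close>
    have mid: "fine ?X" if "a \<sim> p" "offer True v L s d" "s = card L div 2" for s d
    proof -
      have "cost ?X (3 + s)"
        by (rule star_cost_two[OF path3_pair_offer[OF M p pcov dis(1) that(1)] that(2) _ _ va(1)])
          (use dis leg_V legs L N in auto)
      moreover have "7 * (3 + s) < 4 * card ?X" unfolding n using that(3) 3 sizes by auto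
      ultimately show ?thesis by (intro good_fine[of _ "3 + s"]) auto
    qed
    have pr: "con (N \<union> L)" if "p \<sim> r" using con_Un[of N L p r] p r that unfolding branch_def by blast
    have cNL: "card (N \<union> L) = 2 + card L"
      using card_Un_disjoint[OF leg_finite[OF N] leg_finite[OF L] dis(3)] 3 by auto
    have "a \<noteq> p" "a \<noteq> r" "p \<noteq> r" using dis M p r unfolding path3_def branch_def by auto
    then have adj_cases: "a \<sim> p \<or> a \<sim> r \<or> p \<sim> r"
      using claw[of v a p r] M p r unfolding path3_def branch_def by blast
    have eX: "insert v (M \<union> L \<union> N) = ?X" by auto
    consider "card L = 2" | "card L = 4" | "card L = 6" using 3 sizes by auto
    then show ?thesis
    proof cases
      case 1
      have "fine ?X" if "a \<sim> r"
      proof -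
        have "cost ?X 4"
          by (rule star_cost_two[OF path3_pair_offer[OF M r branch_2_cover[OF r 1] dis(2) that]
            offer_root[OF p pcov] _ _ va(1)])
            (use dis leg_V legs L N in auto)
        then show ?thesis using n 1 3 eX by (intro good_fine[of _ 4]) auto
      qed
      then show ?thesis using adj_cases mid[OF _ offer_root[OF r branch_2_cover[OF r 1]]] part pr cNL 1 by auto
    next
      case 2
      from adj_cases show ?thesis
      proof (elim disjE)
        assume "a \<sim> p" then show ?thesis using mid[OF _ offer_mono_mode[OF offer_4[OF r 2]]] 2 by auto
      next
        assume "a \<sim> r" then show ?thesis using four_branch_tails[OF M r 2 p 3] dis eX by (simp add: Int_commute)
      next
        assume pr: "p \<sim> r"
        obtain p' where p': "N = {p, p'}" "p \<noteq> p'" using p 3 unfolding branch_def card_2_iff by force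
        have pp: "p \<sim> p'" using conD[of N "{p}"] p' p unfolding branch_def by blast
        obtain S where S: "S \<subseteq> L" "card S \<le> 2" "covers L S" "\<exists>s\<in>S. r \<sim> s" using branch_4_self[OF r 2] .
        then obtain s where s: "s \<in> S" "r \<sim> s" by blast
        let ?S = "{a, b, p} \<union> S"
        have "s \<noteq> p" "a \<noteq> s" "a \<noteq> p" using s S dis M p unfolding path3_def branch_def by auto
        then have "dominated p ?S" unfolding dominated_def near_def
          using s pr va p adj_sym unfolding branch_def by blast
        moreover have "dominated v ?S" "dominated a ?S" "dominated b ?S" "dominated c ?S" "dominated p' ?S"
          using M pp adj_sym unfolding dominated_def path3_def by auto
        moreover have "covers L ?S" using covers_mono[OF S(3)] by blast
        ultimately have "covers ?X ?S" using M p' unfolding covers_def path3_def by auto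
        moreover have "card ?S \<le> 5"
        proof -
          have "card {a, b, p} \<le> 3" by (auto simp: card_insert_if)
          then show ?thesis using card_Un_le[of "{a, b, p}" S] S(2) by linarith
        qed
        moreover have "?S \<subseteq> V" using leg_V[OF legs] leg_V[OF N] leg_V[OF L] S(1) M p
          unfolding path3_def branch_def by auto
        ultimately have "cost ?X 5" unfolding cost_def by blast
        then show ?thesis using n 2 3 by (intro disjI1 good_fine[of _ 5]) auto
      qed
    next
      case six: 3
      from adj_cases show ?thesis
      proof (elim disjE)
        assume "a \<sim> p" then show ?thesis using mid[OF _ offer_6[OF r six]] six by auto
      next
        assume "a \<sim> r" then show ?thesis using six_branch_tails[OF M r six p 3] dis eX
          by (simp add: Int_commute)
      next
        assume "p \<sim> r" then show ?thesis using part pr cNL six by auto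
      qed
    qed
  qed
qed

text \<open>The 3 pays for \<open>v\<close> and two vertices of the path; the latter dominate
  \<open>v\<close>, so no extra neighbour is counted.\<close>

lemma path3_arith:
  assumes "a \<le> 6" "b \<le> 6" "3 \<le> a + b"
  shows "7 * (3 + star_s a + star_s b) < 4 * (4 + a + b) \<or> a + b = 3 \<and> star_s a + star_s b \<le> 1 \<or>
     (a, b) \<in> set [(0,4),(0,6),(2,2),(2,4),(2,6),(4,4),(4,6)] \<or> (b, a) \<in>
       set [(0,4),(0,6),(2,2),(2,4),(2,6),(4,4),(4,6)]"
proof -
  have "\<forall>a\<in>set [0..<7]. \<forall>b\<in>set [0..<7]. 3 \<le> a + b \<longrightarrow>
     7 * (3 + star_s a + star_s b) < 4 * (4 + a + b) \<or> a + b = 3 \<and> star_s a + star_s b \<le> 1 \<or>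
     (a, b) \<in> set [(0,4),(0,6),(2,2),(2,4),(2,6),(4,4),(4,6)] \<or> (b, a) \<in>
       set [(0,4),(0,6),(2,2),(2,4),(2,6),(4,4),(4,6)]"
    by code_simp
  moreover have "a \<in> set [0..<7]" "b \<in> set [0..<7]" using assms by auto
  ultimately show ?thesis using assms by blast
qed

lemma star_path3:
  assumes M: "path3 v M a b c" and N: "leg v N" and L: "leg v L"
    and dis: "M \<inter> N = {}" "M \<inter> L = {}" "N \<inter> L = {}"
    and sp: "splits_fine (insert v (M \<union> N \<union> L))"
    and big: "7 \<le> card (insert v (M \<union> N \<union> L))" and con: "con (insert v (M \<union> N \<union> L))"
  shows "fine (insert v (M \<union> N \<union> L)) \<or> netlike (insert v (M \<union> N \<union> L))"
proof -
  let ?X = "insert v (M \<union> N \<union> L)"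
  note bM = path3_branch[OF M]
  have legs: "leg v M" using bM unfolding leg_def by auto
  have n: "card ?X = 4 + card N + card L" using star_card[OF legs N L dis] bM by simp
  have va: "v \<sim> a" "v \<in> V" using M adj_in unfolding path3_def by auto
  have eX: "insert v (M \<union> L \<union> N) = ?X" by auto
  consider a' b' c' where "path3 v N a' b' c'" | a' b' c' where "path3 v L a' b' c'"
    | "\<nexists>a b c. path3 v N a b c" "\<nexists>a b c. path3 v L a b c" by blast
  then show ?thesis
  proof cases
    case 1 then show ?thesis using star_two_path3[OF M 1 L dis sp] by blast
  next
    case 2 show ?thesis using star_two_path3[OF M 2 N, unfolded eX] dis sp by (simp add: Int_commute)
  next
    case 3
    let ?k = "3 + star_s (card N) + star_s (card L)"
    have k: "cost ?X ?k"
      by (rule cost_mono[OF star_cost[OF offer_mono_mode[OF offer_path3[OF M]] leg_offer[OF N 3(1)]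
        leg_offer[OF L 3(2)] dis _ va(1)]])
        (use leg_V legs L N in auto)
    consider "7 * ?k < 4 * card ?X" | "card ?X = 7" "?k \<le> 4"
      | "(card N, card L) \<in> {(0,4),(0,6),(2,2),(2,4),(2,6),(4,4),(4,6)}"
      | "(card L, card N) \<in> {(0,4),(0,6),(2,2),(2,4),(2,6),(4,4),(4,6)}"
      using path3_arith[OF leg_card[OF N] leg_card[OF L]] big unfolding n by auto
    then show ?thesis
    proof cases
      case 1 then show ?thesis using good_fine[OF k] by blast
    next
      case 2 then show ?thesis using unit_fine[OF con] cost_mono[OF k] by blast
    next
      case 3 then show ?thesis using path3_special[OF M N L dis sp] by blast
    next
      case 4 show ?thesis using path3_special[OF M L N, unfolded eX] dis sp 4 by (simp add: Int_commute)
    qed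
  qed
qed

lemma star_fine_or_netlike:
  assumes "leg v M1" "leg v M2" "leg v M3" "M1 \<inter> M2 = {}" "M1 \<inter> M3 = {}" "M2 \<inter> M3 = {}"
    and X: "X = insert v (M1 \<union> M2 \<union> M3)" "7 \<le> card X" "con X" "splits_fine X"
  shows "fine X \<or> netlike X"
proof -
  have e: "X = insert v (M2 \<union> M1 \<union> M3)" "X = insert v (M3 \<union> M1 \<union> M2)" using X(1) by auto
  consider a b c where "path3 v M1 a b c" | a b c where "path3 v M2 a b c" | a b c where "path3 v M3 a b c"
    | "\<And>M a b c. M \<in> {M1, M2, M3} \<Longrightarrow> \<not> path3 v M a b c" by blast
  then show ?thesis
  proof cases
    case 1
    from star_path3[OF 1 assms(2-6)] show ?thesis using X by simp
  next
    case 2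
    from star_path3[OF 2 assms(1,3)] show ?thesis using X assms(4-6) unfolding e(1)[symmetric]
      by (simp add: Int_commute)
  next
    case 3
    from star_path3[OF 3 assms(1,2)] show ?thesis using X assms(4-6) unfolding e(2)[symmetric]
      by (simp add: Int_commute)
  next
    case 4
    from star_without_path3[OF assms(1-6) _ 4] show ?thesis using X by simp
  qed
qed


text \<open>
  The vertex \<open>w\<close> itself may fail: no cover of a path of order 7 by four vertices contains its middle
  vertex. Then the claw condition at \<open>w\<close> provides another neighbour of \<open>z\<close>.
\<close>

lemma seven_cover_through:
  assumes "con W" "card W = 7" "z \<notin> W" "w \<in> W" "z \<sim> w"
  obtains w' S where "w' \<in> W" "z \<sim> w'" "w' \<in> S" "S \<subseteq> V" "card S \<le> 4" "covers W S"
proof -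
  note found = that
  have fin: "finite W" using assms con_finite by blast
  have W1: "W \<noteq> {w}" using assms by auto
  have c6: "card (W - {w}) = 6" using assms fin by auto
  from assms(1,4) W1 show thesis
  proof (cases rule: split_at)
    case (one d)
    then have b: "branch w d (W - {w})" unfolding branch_def using c6 by auto
    have "W - {w} \<subseteq> V" using con_sub[OF assms(1)] by auto
    then obtain S where S: "S \<subseteq> V" "True \<Longrightarrow> w \<in> S" "covers (insert w (W - {w} \<union> {} \<union> {})) S"
      "card S \<le> (if True then 1 else 0) + 3 + 0 + 0 + (if (2::nat) \<le> 2 + 0 + 0 then 0 else 1)"
      using star_cover[OF offer_6[OF b c6] offer_empty[where s = 0] offer_empty[where s = 0] _ _ _ _ one(3)]
        by auto
    moreover have "insert w (W - {w} \<union> {} \<union> {}) = W" using assms by auto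
    ultimately show thesis using that[of w S] assms by auto
  next
    case (two D E d e)
    have finDE: "finite D" "finite E" using two con_finite by auto
    have cs: "card D + card E = 6" using card_Un_disjoint[OF finDE two(2)] two(1) c6 by simp
    have "card E \<noteq> 0" using two finDE by auto
    have nin: "w \<notin> D" "w \<notin> E" using two(1) by auto
    have bD: "branch w d D" and bE: "branch w e E" unfolding branch_def using two nin cs \<open>card E \<noteq> 0\<close> by auto
    have legs: "leg w D" "leg w E" using bD bE unfolding leg_def by auto
    have Weq: "insert w (D \<union> E \<union> {}) = W" using two(1) assms by auto
    have sub: "D \<union> E \<union> {} \<subseteq> V" using leg_V legs by auto
    have fin: thesis if "offer True w D s1 d1" "offer True w E s2 d2"
      "1 + s1 + s2 + (if 2 \<le> d1 + d2 then 0 else 1) \<le> 4" for s1 s2 d1 d2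
    proof -
      note le = that
      obtain S where S: "S \<subseteq> V" "True \<Longrightarrow> w \<in> S" "covers (insert w (D \<union> E \<union> {})) S"
        "card S \<le> (if True then 1 else 0) + s1 + s2 + 0 + (if 2 \<le> d1 + d2 + 0 then 0 else 1)"
        by (rule star_cover[OF le(1,2) offer_empty[where s = 0] two(2) _ _ sub two(7)]) auto
      have "card S \<le> 4" using S(4) le(3) by simp
      moreover have "covers W S" using S(3) Weq by simp
      ultimately show thesis using found[of w S] assms(4,5) S(1,2) by blast
    qed
    consider "card E = 1" "card D = 5" | "card E = 2" "card D = 4" | "card E = 3" "card D = 3"
      using cs two(9) \<open>card E \<noteq> 0\<close> by linarith
    then show thesis
    proof cases
      case 1
      then have "\<nexists>a b c. path3 w E a b c" "\<nexists>a b c. path3 w D a b c" using path3_branch(2) by fastforce+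
      then show thesis using fin leg_offer[OF legs(1)] leg_offer[OF legs(2)] 1
        by (fastforce simp: star_s_def star_d_def)
    next
      case 2
      then have "\<nexists>a b c. path3 w E a b c" "\<nexists>a b c. path3 w D a b c" using path3_branch(2) by fastforce+
      then show thesis using fin leg_offer[OF legs(1)] leg_offer[OF legs(2)] 2
        by (fastforce simp: star_s_def star_d_def)
    next
      case 3
      have o: "offer True w M 1 2 \<or> (\<exists>a b c. path3 w M a b c)" if "leg w M" "card M = 3" for M
        using leg_offer[OF that(1)] that(2) by (auto simp: star_s_def star_d_def)
      consider "offer True w D 1 2" | "offer True w E 1 2"
        | a b c a' b' c' where "path3 w D a b c" "path3 w E a' b' c'" using o legs 3 by blast
      then show thesis
      proof cases
        case 1
        have "offer True w E 2 2" using o[OF legs(2) 3(1)] offer_mono_mode[OF offer_path3] unfolding offer_def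
          by (meson le_trans one_le_numeral)
        then show thesis using fin[OF 1] by auto
      next
        case 2
        have "offer True w D 2 2" using o[OF legs(1) 3(2)] offer_mono_mode[OF offer_path3] unfolding offer_def
          by (meson le_trans one_le_numeral)
        then show thesis using fin[OF _ 2] by auto
      next
        case (3 a b c a' b' c')
        then have aa: "w \<sim> a" "w \<sim> a'" "a \<in> D" "a' \<in> E" "a \<in> W" "a' \<in> W" using Weq unfolding path3_def by auto
        then have "a \<noteq> a'" "\<not> a \<sim> a'" "z \<noteq> a" "z \<noteq> a'" using two assms(3) by blast+
        then have "z \<sim> a \<or> z \<sim> a'" using claw[of w z a a'] aa assms(5) adj_sym by blast
        moreover have "covers W {a, b, a', b'}" unfolding Weq[symmetric]
          using 3 adj_sym unfolding covers_def dominated_def path3_def by auto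
        moreover have "{a, b, a', b'} \<subseteq> V" using 3 leg_V legs unfolding path3_def by blast
        moreover have "card {a, b, a', b'} \<le> 4" by (auto simp: card_insert_if)
        ultimately show thesis using that[of a "{a, b, a', b'}"] that[of a' "{a, b, a', b'}"] aa by blast
      qed
    qed
  qed
qed

section \<open>Joining the exceptional graph to another part\<close>

definition subsets_fine :: "'a set \<Rightarrow> bool" where
  "subsets_fine X \<longleftrightarrow> (\<forall>Y. Y \<subset> X \<longrightarrow> con Y \<longrightarrow> card Y = 4 \<or> 7 \<le> card Y \<longrightarrow> fine Y \<or> netlike Y)"

lemma split_not_ten:
  assumes "subsets_fine X" "X = Y \<union> Z" "Y \<inter> Z = {}" "con Y" "con Z"
    "card Y = 4 \<or> 7 \<le> card Y" "card Z = 4 \<or> 7 \<le> card Z" "card Y \<noteq> 10" "card Z \<noteq> 10"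
  shows "fine X"
proof -
  have "Y \<subset> X" "Z \<subset> X" using assms con_ne by blast+
  then have "fine Y" "fine Z" using assms netlike_cost(2) unfolding subsets_fine_def by blast+
  then show ?thesis using fine_Un assms con_finite by blast
qed

text \<open>Three vertices \<open>R\<close> move to \<open>W\<close>; the order 10 would arise
  exactly for the excluded order 7 of \<open>W\<close>.\<close>

lemma split_three_join:
  assumes "subsets_fine X" "X = U \<union> R \<union> W" "U \<inter> R = {}" "U \<inter> W = {}" "R \<inter> W = {}" "con U" "con (R \<union> W)"
    "card U = 7" "card R = 3" "finite R" "finite W" "card W = 4 \<or> 7 \<le> card W" "card W \<noteq> 7"
  shows "fine X"
proof (rule split_not_ten[OF assms(1), of U "R \<union> W"])
  have "card (R \<union> W) = card W + 3" using card_Un_disjoint[OF assms(10,11,5)] assms(9) by simp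
  then show "card (R \<union> W) = 4 \<or> 7 \<le> card (R \<union> W)" "card (R \<union> W) \<noteq> 10" using assms(12,13) by auto
qed (use assms in auto)

text \<open>The counterpart for \<open>W\<close> of order 7: moving six vertices gives order 13 and
  leaves a part of order 4.\<close>

lemma split_four:
  assumes "subsets_fine X" "X = Q \<union> R \<union> W" "Q \<inter> R = {}" "Q \<inter> W = {}" "R \<inter> W = {}" "con Q" "con (R \<union> W)"
    "card Q = 4" "card R = 6" "finite R" "finite W" "card W = 7"
  shows "fine X"
proof (rule split_not_ten[OF assms(1), of Q "R \<union> W"])
  have "card (R \<union> W) = 13" using card_Un_disjoint[OF assms(10,11,5)] assms(9,12) by simp
  then show "card (R \<union> W) = 4 \<or> 7 \<le> card (R \<union> W)" "card (R \<union> W) \<noteq> 10" by auto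
qed (use assms in auto)

lemma con_three: "a \<sim> b \<Longrightarrow> b \<sim> c \<Longrightarrow> con {a, b, c}"
  using con_insert[of "{b}" b a] con_insert[of "{a, b}" b c] con_singleton[of b] adj_in adj_sym
  by (auto simp: insert_commute)

lemma net_sym: "net N t x x' s y y' u z z' z'' \<Longrightarrow> net N s y y' t x x' u z z' z''"
  unfolding net_def using adj_sym by auto

text \<open>The arm of \<open>t\<close> follows \<open>W\<close>, and the other two arms keep order
  7. If \<open>W\<close> has order 7, the arms of \<open>t\<close> and \<open>s\<close> both follow
  it, joined by the edge between \<open>s\<close> and \<open>t\<close>, and the arm of order 4
  stays.\<close>

lemma net_join_side:
  assumes "net N t x x' s y y' u z z' z''" "subsets_fine X" "X = N \<union> W" "N \<inter> W = {}" "con W"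
    "card W = 4 \<or> 7 \<le> card W" "n \<in> {t, x, x'}" "w \<in> W" "n \<sim> w"
  shows "fine X"
proof -
  let ?T = "{t, x, x'}" and ?S = "{s, y, y'}" and ?Q = "{u, z, z', z''}"
  note net = assms(1)[unfolded net_def]
  have ad: "t \<sim> s" "t \<sim> u" "s \<sim> u" "t \<sim> x" "x \<sim> x'" "s \<sim> y" "y \<sim> y'" "u \<sim> z" "z \<sim> z'" "z' \<sim> z''" using net
    by auto
  have cT: "con ?T" using con_three[of x' x t] ad adj_sym by (auto simp: insert_commute)
  have cS: "con ?S" using con_three[of y' y s] ad adj_sym by (auto simp: insert_commute)
  have cQ: "con ?Q" using con_insert[OF con_three[of z z' z'']] ad adj_sym by blast
  have dis: "?T \<inter> ?S = {}" "?T \<inter> ?Q = {}" "?S \<inter> ?Q = {}" "?T \<inter> W = {}" "?S \<inter> W = {}" "?Q \<inter> W = {}"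
    using net assms(4) by auto
  have X: "X = ?T \<union> ?S \<union> ?Q \<union> W" using assms(3) net by auto
  have fin: "finite W" using assms con_finite by blast
  have TW: "con (?T \<union> W)" using con_Un[OF cT assms(5,7,8,9)] .
  have cards: "card ?T = 3" "card ?S = 3" "card ?Q = 4" using net by auto
  show ?thesis
  proof (cases "card W = 7")
    case False
    have c: "con (?S \<union> ?Q)" by (rule con_Un[OF cS cQ, of s u]) (use ad in simp_all)
    have k: "card (?S \<union> ?Q) = 7" using card_Un_disjoint[OF _ _ dis(3)] cards by simp
    have e: "X = (?S \<union> ?Q) \<union> ?T \<union> W" using X by blast
    have d: "(?S \<union> ?Q) \<inter> ?T = {}" "(?S \<union> ?Q) \<inter> W = {}" using dis(1,2,5,6) by blast+
    show ?thesis
      by (rule split_three_join[OF assms(2) e d dis(4) c TW k cards(1) _ fin assms(6) False]) simp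
  next
    case True
    have st: "s \<sim> t" using ad adj_sym by blast
    have "con (?S \<union> (?T \<union> W))" by (rule con_Un[OF cS TW _ _ st]) simp_all
    moreover have "?S \<union> (?T \<union> W) = (?T \<union> ?S) \<union> W" by blast
    ultimately have c: "con ((?T \<union> ?S) \<union> W)" by argo
    have k: "card (?T \<union> ?S) = 6" using card_Un_disjoint[OF _ _ dis(1)] cards by simp
    have e: "X = ?Q \<union> (?T \<union> ?S) \<union> W" using X by blast
    have d: "?Q \<inter> (?T \<union> ?S) = {}" "(?T \<union> ?S) \<inter> W = {}" using dis(2,3,4,5) by blast+
    show ?thesis
      by (rule split_four[OF assms(2) e d(1) dis(6) d(2) cQ c cards(3) k _ fin True]) simp
  qed
qed

text \<open>If \<open>W\<close> has order 7, moving the whole tail would give order 10. When the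
  edge starts at \<open>z'\<close> or \<open>z''\<close>, only these two move, and the parts have
  orders 9 and 8.\<close>

lemma net_join_tail:
  assumes "net N t x x' s y y' u z z' z''" "subsets_fine X" "X = N \<union> W" "N \<inter> W = {}" "con W"
    "card W = 4 \<or> 7 \<le> card W" "n \<in> {z, z', z''}" "w \<in> W" "n \<sim> w"
  shows "fine X"
proof -
  let ?T = "{t, x, x'}" and ?S = "{s, y, y'}" and ?Z = "{z, z', z''}"
  note net = assms(1)[unfolded net_def]
  have ad: "t \<sim> s" "t \<sim> u" "s \<sim> u" "t \<sim> x" "x \<sim> x'" "s \<sim> y" "y \<sim> y'" "u \<sim> z" "z \<sim> z'" "z' \<sim> z''" using net
    by auto
  have cT: "con ?T" using con_three[of x' x t] ad adj_sym by (auto simp: insert_commute)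
  have cS: "con ?S" using con_three[of y' y s] ad adj_sym by (auto simp: insert_commute)
  have cZ: "con ?Z" using con_three[of z z' z''] ad adj_sym by blast
  have dis: "?T \<inter> ?S = {}" "?T \<inter> ?Z = {}" "?S \<inter> ?Z = {}" "?T \<inter> W = {}" "?S \<inter> W = {}" "?Z \<inter> W = {}"
     "u \<notin> ?T" "u \<notin> ?S" "u \<notin> ?Z" "u \<notin> W"
    using net assms(4) by auto
  have X: "X = insert u (?T \<union> ?S) \<union> ?Z \<union> W" using assms(3) net by auto
  have fin: "finite W" using assms con_finite by blast
  have cards: "card ?T = 3" "card ?S = 3" "card ?Z = 3" using net by auto
  have cTS: "con (?T \<union> ?S)" using con_Un[OF cT cS, of t s] ad by auto
  have cU: "con (insert u (?T \<union> ?S))" using con_insert[OF cTS, of t u] ad by auto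
  have kU: "card (insert u (?T \<union> ?S)) = 7" using card_Un_disjoint[of ?T ?S] dis cards by simp
  show ?thesis
  proof (cases "card W = 7")
    case False
    have c: "con (?Z \<union> W)" using con_Un[OF cZ assms(5,7,8,9)] .
    have d: "insert u (?T \<union> ?S) \<inter> ?Z = {}" "insert u (?T \<union> ?S) \<inter> W = {}"
      using dis by simp_all
    show ?thesis
      by (rule split_three_join[OF assms(2) X d dis(6) cU c kU cards(3) _ fin assms(6) False]) simp
  next
    case True
    show ?thesis
    proof (cases "n = z")
      case False
      then have n: "n \<in> {z', z''}" using assms by auto
      have "z'' \<sim> z'" using ad adj_sym by blast
      then have "con {z', z''}" using con_insert[OF con_singleton[of z''], of z'' z'] adj_in by blast
      then have c: "con ({z', z''} \<union> W)" using con_Un[OF _ assms(5) n assms(8,9)] by blast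
      have k: "card ({z', z''} \<union> W) = 9" using card_Un_disjoint[of "{z', z''}" W] dis cards fin True net by auto
      have c': "con (insert z (insert u (?T \<union> ?S)))" using con_insert[OF cU, of u z] ad by auto
      have k': "card (insert z (insert u (?T \<union> ?S))) = 8" using kU dis by auto
      show ?thesis
        by (rule split_not_ten[OF assms(2) _ _ c' c]) (use X dis k k' net in auto)
    next
      \<comment> \<open>Now \<open>z'\<close> and \<open>z''\<close> may be separated from
        \<open>W\<close>, so an explicit cover is given: order 17 tolerates nine vertices. The four
        for \<open>W\<close> are chosen to contain a neighbour \<open>w'\<close> of
        \<open>z\<close>, and \<open>z'\<close> is dominated by \<open>u\<close> and
        \<open>w'\<close>, two steps away through \<open>z\<close>.\<close>
      case nz: True
      have "z \<notin> W" "z \<sim> w" using dis assms nz by auto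
      then obtain w' S where S: "w' \<in> W" "z \<sim> w'" "w' \<in> S" "S \<subseteq> V" "card S \<le> 4" "covers W S"
        using seven_cover_through[OF assms(5) True _ assms(8)] by metis
      let ?R = "{x, y, t, u, z'} \<union> S"
      have ne: "t \<noteq> u" "y \<noteq> t" "y \<noteq> u" "z' \<noteq> u" "z' \<noteq> w'" "u \<noteq> w'" using net dis S(1) by auto
      have "near y t" "near y u" "near z' u" "near z' w'"
        using ne ad adj_sym S(2) unfolding near_def by blast+
      then have "dominated y ?R" "dominated z' ?R" unfolding dominated_def using ne S(3) by blast+
      moreover have "dominated t ?R" "dominated x ?R" "dominated x' ?R" "dominated s ?R" "dominated y' ?R"
         "dominated u ?R" "dominated z ?R" "dominated z'' ?R"
        unfolding dominated_def using ad adj_sym by auto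
      moreover have "covers W ?R" using covers_mono[OF S(6)] by blast
      ultimately have "covers X ?R" unfolding X covers_def by auto
      moreover have "card ?R \<le> 9"
      proof -
        have "card {x, y, t, u, z'} \<le> 5" by (auto simp: card_insert_if)
        then show ?thesis using card_Un_le[of "{x, y, t, u, z'}" S] S(5) by linarith
      qed
      moreover have "?R \<subseteq> V" using net_V[OF assms(1)] net S(4) by auto
      ultimately have "cost X 9" unfolding cost_def by blast
      moreover have "card X = 17"
      proof -
        have "card N = 10" using netlike_cost(2) assms(1) unfolding netlike_def by blast
        then show ?thesis using card_Un_disjoint[of N W] assms(3,4) fin True net by auto
      qed
      ultimately show ?thesis by (intro good_fine[of _ 9]) auto
    qed
  qed
qed

text \<open>For an edge leaving at \<open>u\<close>, the claw condition with \<open>t\<close> and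
  \<open>z\<close> gives an edge to \<open>W\<close> from one of these, or an edge between
  \<open>t\<close> and \<open>z\<close>, with which the ten vertices cost only five.\<close>

lemma net_join:
  assumes "netlike N" "subsets_fine X" "X = N \<union> W" "N \<inter> W = {}" "con W" "card W = 4 \<or> 7 \<le> card W" "con X"
  shows "fine X"
proof -
  obtain t x x' s y y' u z z' z'' where net: "net N t x x' s y y' u z z' z''" using assms unfolding netlike_def
    by blast
  note nd = net[unfolded net_def]
  have fin: "finite N" "finite W" using netlike_cost(3)[OF assms(1)] assms con_finite by auto
  have "N \<noteq> {}" using nd by auto
  moreover have "N \<noteq> X" using assms(3,4) con_ne[OF assms(5)] by blast
  ultimately obtain n w where nw: "n \<in> N" "w \<in> W" "n \<sim> w" using conD[OF assms(7), of N] assms(3) by blast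
  have side: "fine X" if "m \<in> {t, x, x', s, y, y'}" "m \<sim> w" for m
    using that net_join_side[OF net assms(2-6) _ nw(2)] net_join_side[OF net_sym[OF net] assms(2-6) _ nw(2)]
      by blast
  have tail: "fine X" if "m \<in> {z, z', z''}" "m \<sim> w" for m
    using that net_join_tail[OF net assms(2-6) _ nw(2)] by blast
  consider "n \<in> {t, x, x', s, y, y'}" | "n \<in> {z, z', z''}" | "n = u" using nw nd by auto
  then show ?thesis
  proof cases
    case 1 then show ?thesis using side nw by blast
  next
    case 2 then show ?thesis using tail nw by blast
  next
    case 3
    have "t \<noteq> z" "t \<noteq> w" "z \<noteq> w" using nd nw assms(4) by auto
    then consider "t \<sim> w" | "z \<sim> w" | "t \<sim> z" using claw[of u t z w] nd nw 3 adj_sym by blast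
    then show ?thesis
    proof cases
      case 1 then show ?thesis using side[of t] by auto
    next
      case 2 then show ?thesis using tail[of z] by auto
    next
      case tz: 3
      let ?xs = "[t, x, x', s, y, y', u, z, z', z'']"
      have xs: "N = set ?xs" "distinct ?xs" using nd by auto
      have c5: "cost (set ?xs) 5"
      proof (rule list_cost[where E = "[(0,7),(0,3),(0,6),(3,6),(0,1),(1,2),(3,4),(4,5),(6,7),(7,8),(8,9)]"
        and S = "[1,4,8,0,6]"])
        have "length ?xs = 10" by simp
        moreover have "list_all (edom [(0,7),(0,3),(0,6),(3,6),(0,1),(1,2),(3,4),(4,5),(6,7),(7,8),(8,9)]
          [1,4,8,0,6]) [0..<10]"
          by code_simp
        ultimately show "list_all (edom [(0,7),(0,3),(0,6),(3,6),(0,1),(1,2),(3,4),(4,5),(6,7),(7,8),(8,9)]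
          [1,4,8,0,6]) [0..<length ?xs]"
          by metis
        show "distinct ?xs" by (rule xs(2))
        show "set ?xs \<subseteq> V" using net_V[OF net] xs by simp
      qed (use nd tz in auto)
      have k10: "card N = 10" using netlike_cost(2) assms(1) by blast
      have c5: "cost N 5" using c5 xs(1) by metis
      have "W \<subset> X" using assms nw by blast
      then consider "fine W" | "netlike W" using assms(2,5,6) unfolding subsets_fine_def by blast
      then show ?thesis
      proof cases
        case 1
        have "fine N" using good_fine[OF c5] k10 by simp
        then show ?thesis using fine_Un[OF _ 1 assms(4) fin] assms(3) by blast
      next
        case 2
        \<comment> \<open>With five vertices for the first, even two exceptional graphs stay below
          the bound at order 20.\<close>
        have "cost X 11" using cost_Un[OF c5 netlike_cost(1)[OF 2]] assms(3) by simp
        moreover have "card X = 20" using card_Un_disjoint[OF fin assms(4)] k10 netlike_cost(2)[OF 2] assms(3)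
          by simp
        ultimately show ?thesis by (intro good_fine[of _ 11]) auto
      qed
    qed
  qed
qed

section \<open>Induction on the order\<close>

text \<open>The outside neighbour serves to root the enumeration of shapes; the two dominators lie
  in \<open>Y\<close>.\<close>

lemma four_good:
  assumes "con Y" "card Y = 4" "r \<in> Y" "p \<notin> Y" "p \<sim> r" shows "fine Y"
proof -
  have b: "branch p r Y" unfolding branch_def using assms by auto
  obtain S where "S \<subseteq> Y" "card S \<le> 2" "covers Y S" "\<exists>s\<in>S. r \<sim> s" using branch_4_self[OF b assms(2)] .
  then have "cost Y 2" unfolding cost_def using con_sub[OF assms(1)] by blast
  then show ?thesis using assms by (intro good_fine[of _ 2]) auto
qed

theorem connected_fine:
  assumes "con X" "7 \<le> card X" shows "fine X \<or> netlike X"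
  using assms
proof (induction "card X" arbitrary: X rule: less_induct)
  case less
  note con = less.prems(1)
  have finX: "finite X" using con con_finite by blast
  have sub: "subsets_fine X"
    unfolding subsets_fine_def
  proof (intro allI impI)
    fix Y assume Y: "Y \<subset> X" "con Y" "card Y = 4 \<or> 7 \<le> card Y"
    show "fine Y \<or> netlike Y"
    proof (cases "7 \<le> card Y")
      case True then show ?thesis using less.hyps[OF psubset_card_mono[OF finX Y(1)]] Y by blast
    next
      case False
      obtain r p where "r \<in> Y" "p \<in> X - Y" "r \<sim> p" using conD[OF con, of Y] Y con_ne by blast
      then show ?thesis using four_good[OF Y(2), of r p] Y False adj_sym by auto
    qed
  qed
  have sp: "splits_fine X"
    unfolding splits_fine_def
  proof (intro allI impI)
    fix Y Z assume Y: "X = Y \<union> Z" "Y \<inter> Z = {}" "con Y" "con Z" "card Y = 4 \<or> 7 \<le> card Y"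
      "card Z = 4 \<or> 7 \<le> card Z"
    then have "Y \<subset> X" "Z \<subset> X" using con_ne by blast+
    then consider "fine Y" "fine Z" | "netlike Y" | "netlike Z" using sub Y unfolding subsets_fine_def by blast
    then show "fine X"
    proof cases
      case 1 then show ?thesis using fine_Un Y con_finite by blast
    next
      case 2 then show ?thesis using net_join[OF 2 sub Y(1,2,4,6) con] by blast
    next
      case 3
      have "X = Z \<union> Y" "Z \<inter> Y = {}" using Y by auto
      then show ?thesis using net_join[OF 3 sub _ _ Y(3,5) con] by blast
    qed
  qed
  \<comment> \<open>Admitting \<open>N = X\<close>, with empty complement, guarantees that a minimal
    \<open>N\<close> exists.\<close>
  let ?P = "\<lambda>N. N \<subseteq> X \<and> con N \<and> 7 \<le> card N \<and> (N = X \<or> con (X - N))"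
  have "?P X" using less.prems by auto
  then obtain N where N: "?P N" and min: "\<And>N'. ?P N' \<Longrightarrow> card N \<le> card N'"
    using ex_has_least_nat[of ?P X card] by blast
  have finN: "finite N" using N con_finite by blast
  define Y where "Y = X - N"
  have XY: "X = N \<union> Y" "N \<inter> Y = {}" using N unfolding Y_def by auto
  show ?case
  proof (cases "card Y = 4 \<or> 7 \<le> card Y")
    case True
    then have "con Y" using N unfolding Y_def by auto
    then show ?thesis using splits_fineD[OF sp XY _ _ _ True] N by blast
  next
    case False
    \<comment> \<open>Here \<open>Y\<close> is empty or of order at most 6, so it can serve as the
      third branch of a star at some \<open>v\<close> in \<open>N\<close>.\<close>
    obtain v where v: "v \<in> N" "leg v Y"
    proof (cases "Y = {}")
      case True then show thesis using that N con_ne unfolding leg_def by blast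
    next
      case Yne: False
      then have cY: "con Y" using N unfolding Y_def by auto
      obtain v p where "v \<in> N" "p \<in> Y" "v \<sim> p" using conD[OF con, of N] N Yne con_ne unfolding Y_def by blast
      then have "branch v p Y" unfolding branch_def using cY XY False by auto
      then show thesis using that \<open>v \<in> N\<close> unfolding leg_def by blast
    qed
    \<comment> \<open>A larger component \<open>D\<close> would contradict minimality: the rest of
      \<open>N\<close> stays connected through \<open>v\<close>, and \<open>Y\<close> hangs on
      \<open>v\<close>, so \<open>X - D\<close> is connected.\<close>
    have small: "card D \<le> 6" if D: "D \<subseteq> N - {v}" "con D" "\<And>x y. x \<in> D \<Longrightarrow> y \<in> N - {v} - D \<Longrightarrow> \<not> x \<sim> y" for D
    proof (rule ccontr)
      assume "\<not> card D \<le> 6"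
      have cND: "con (N - D)" using con_Diff_component[OF _ v(1) D(1,3)] N by blast
      have "con (X - D)"
      proof (cases "Y = {}")
        case True then show ?thesis using cND XY by simp
      next
        case False
        then obtain p where p: "branch v p Y" using v unfolding leg_def by blast
        have "con ((N - D) \<union> Y)" using con_Un[OF cND, of Y v p] p v D unfolding branch_def by blast
        moreover have "X - D = (N - D) \<union> Y" using XY D by auto
        ultimately show ?thesis by simp
      qed
      then have "?P D" using D N \<open>\<not> card D \<le> 6\<close> by auto
      then have "card N \<le> card D" by (rule min)
      moreover have "D \<subset> N" using D v by blast
      then have "card D < card N" using psubset_card_mono finN by blast
      ultimately show False by simp
    qed
    have Nv: "con N" "v \<in> N" using N v by blast+
    have Nv1: "N \<noteq> {v}"
    proof
      assume e: "N = {v}"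
      have "card N = 1" unfolding e by simp
      moreover have "7 \<le> card N" using N by blast
      ultimately show False by simp
    qed
    obtain M1 M2 where M: "leg v M1" "leg v M2" "N = insert v (M1 \<union> M2)" "M1 \<inter> M2 = {}"
      using Nv Nv1
    proof (cases rule: split_at)
      case (one d)
      then have "branch v d (N - {v})" unfolding branch_def using small[of "N - {v}"] by auto
      then show thesis using that[of "N - {v}" "{}"] v unfolding leg_def by auto
    next
      case (two D E d e)
      have "card D \<le> 6" by (rule small) (use two in auto)
      moreover have "card E \<le> 6" by (rule small) (use two(1,4,10) adj_sym in blast)+
      moreover have "v \<notin> D" "v \<notin> E" using two(1) by auto
      ultimately have "branch v d D" "branch v e E" unfolding branch_def using two by auto
      then show thesis using that[of D E] two v unfolding leg_def by auto
    qed
    have X: "X = insert v (M1 \<union> M2 \<union> Y)" using M XY by auto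
    have "M1 \<inter> Y = {}" "M2 \<inter> Y = {}" using M XY by auto
    then show ?thesis using star_fine_or_netlike[OF M(1,2) v(2) M(4) _ _ X less.prems(2) con sp] by blast
  qed
qed

end

section \<open>Tight graphs\<close>

text \<open>
  The attachments of a connected 7-set to the outside vertex 0 that cannot be covered by vertex 0 and three
  vertices of the set. The first is \<open>H\<^sub>1\<close> with clique vertex 1; the others are paths, vertex 0 being
  adjacent to the middle vertex and one next to it.
\<close>

definition tight_shapes :: "(nat \<times> nat) list list" where
  "tight_shapes = [[(0,1),(1,2),(1,3),(2,3),(3,4),(4,5),(2,6),(6,7)],
     [(0,1),(0,2),(1,2),(2,3),(3,4),(4,5),(1,6),(6,7)],
     [(0,1),(0,2),(1,2),(2,3),(3,4),(1,5),(5,6),(6,7)],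
     [(0,1),(0,5),(1,2),(2,3),(3,4),(1,5),(5,6),(6,7)]]"

text \<open>Vertex 0 counts as taken at the expense of its own unit, so three further vertices would
  save one over the usual four. For the same reason only the labels 1 to 7 are to be
  dominated.\<close>

lemma shapes_7_cover:
  "list_all (\<lambda>E. list_ex (\<lambda>S. list_all (edom E (0 # S)) [1,2,3,4,5,6,7])
       [[2,4,5],[2,3,6],[2,3,5],[2,5,6],[3,4,6],[1,5,6]]
     \<or> E \<in> set tight_shapes) (shapes 7)"
  by code_simp

text \<open>Any further edge makes such a cover possible, so these attachments are induced subgraphs.\<close>

lemma tight_shapes_cover:
  "list_all (\<lambda>E. list_all (\<lambda>(i, j). j \<le> i \<or> eadj E i j \<or>
      list_ex (\<lambda>S. list_all (edom ((i, j) # E) (0 # S)) [1,2,3,4,5,6,7])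
       [[1,3,6],[1,3,4],[3,4,6],[2,5,6],[2,4,6],[2,3,5],[3,5,6],[2,3,6]])
     (List.product [0..<8] [0..<8])) tight_shapes"
  by code_simp

context claw_free_relation begin

section \<open>Attachments of a unit to an outside vertex\<close>

text \<open>Equivalences instead of implications: \<open>H_1\<close> as an induced subgraph.\<close>

definition h_unit :: "'a set \<Rightarrow> 'a \<Rightarrow> (nat \<Rightarrow> 'a) \<Rightarrow> bool" where
  "h_unit U c p \<longleftrightarrow> U = insert c (p ` {..<6}) \<and> inj_on p {..<6} \<and> c \<notin> p ` {..<6} \<and>
     (\<forall>i<6. \<forall>j<6. p i \<sim> p j \<longleftrightarrow> j = Suc i \<or> i = Suc j) \<and> (\<forall>i<6. c \<sim> p i \<longleftrightarrow> i \<in> {2, 3})"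

definition tip_attached :: "'a set \<Rightarrow> 'a \<Rightarrow> 'a \<Rightarrow> (nat \<Rightarrow> 'a) \<Rightarrow> bool" where
  "tip_attached U w c p \<longleftrightarrow> h_unit U c p \<and> (\<forall>x\<in>U. w \<sim> x \<longleftrightarrow> x = c)"

text \<open>The three path shapes become one by choosing the direction of the path, with middle
  vertex \<open>q ! 3\<close>. The missing edge makes the claw condition at \<open>q ! 3\<close>
  usable.\<close>

definition path_attached :: "'a set \<Rightarrow> 'a \<Rightarrow> 'a list \<Rightarrow> bool" where
  "path_attached U w q \<longleftrightarrow> U = set q \<and> length q = 7 \<and> distinct q \<and> (\<forall>i<6. q ! i \<sim> q ! Suc i) \<and>
     \<not> q ! 2 \<sim> q ! 4 \<and> w \<sim> q ! 2 \<and> w \<sim> q ! 3"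

lemma list_covers_root:
  assumes "list_all (edom E (0 # S)) [1,2,3,4,5,6,7]" "\<forall>(i, j)\<in>set E. xs ! i \<sim> xs ! j" "distinct xs"
    "length xs = 8" "set xs = insert w U" "xs ! 0 = w" "w \<notin> U" "distinct (0 # S)" "set S \<subseteq> {1..7}"
      "length S = 3"
  shows "\<exists>S\<subseteq>U. card S \<le> 3 \<and> covers U (insert w S)"
proof -
  have "covers ((!) xs ` set [1,2,3,4,5,6,7]) ((!) xs ` set (0 # S))"
    by (rule list_covers[OF assms(1-3)]) (use assms in auto)
  moreover have img: "(!) xs ` set [1,2,3,4,5,6,7] = U"
  proof -
    have "xs = w # map ((!) xs) [1,2,3,4,5,6,7]"
      using assms(4,6) by (intro nth_equalityI) (auto simp: less_Suc_eq numeral_eq_Suc)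
    then have "set xs = insert w ((!) xs ` set [1,2,3,4,5,6,7])" "w \<notin> (!) xs ` set [1,2,3,4,5,6,7]"
      using assms(3) by (metis list.simps(15) set_map, metis distinct.simps(2) set_map)
    then show ?thesis using assms(5,7) by (metis insert_ident)
  qed
  moreover have "(!) xs ` set (0 # S) = insert w ((!) xs ` set S)" using assms(6) by simp
  moreover have "(!) xs ` set S \<subseteq> U"
  proof -
    have "set S \<subseteq> set [1,2,3,4,5,6,7]"
    proof
      fix i assume "i \<in> set S"
      then have "1 \<le> i" "i \<le> 7" using assms(9) by auto
      then show "i \<in> set [1,2,3,4,5,6,7]" by (auto simp: le_Suc_eq numeral_eq_Suc)
    qed
    then show ?thesis using img by blast
  qed
  moreover have "card ((!) xs ` set S) \<le> 3"
    using card_image_le[of "set S" "(!) xs"] card_length[of S] assms(10) by simp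
  ultimately show ?thesis by metis
qed

lemma attach_cases:
  assumes "con U" "card U = 7" "w \<notin> U" "w \<sim> u" "u \<in> U"
  shows "(\<exists>S\<subseteq>U. card S \<le> 3 \<and> covers U (insert w S)) \<or> (\<exists>c p. tip_attached U w c p) \<or> (\<exists>q. path_attached U w q)"
proof (rule ccontr)
  assume neg: "\<not> ?thesis"
  obtain E xs where "E \<in> set (shapes 7)" "length xs = Suc 7" "xs ! 0 = w" "xs ! 1 = u" "set xs = insert w U"
    "distinct xs"
    "\<forall>(i, j)\<in>set E. i < Suc 7 \<and> j < Suc 7 \<and> xs ! i \<sim> xs ! j" by (rule shape_list[OF assms])
  then have E: "E \<in> set (shapes 7)" "length xs = Suc 7" "xs ! 0 = w" "set xs = insert w U" "distinct xs"
    "\<forall>(i, j)\<in>set E. xs ! i \<sim> xs ! j" by auto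
  have len: "length xs = 8" using E(2) by simp
  have "E \<in> set tight_shapes"
  proof (rule ccontr)
    assume "E \<notin> set tight_shapes"
    then obtain S where S: "S \<in> set [[2,4,5],[2,3,6],[2,3,5],[2,5,6],[3,4,6],[1,5,6]]"
        "list_all (edom E (0 # S)) [1,2,3,4,5,6,7]"
      using shapes_7_cover E(1) unfolding list_all_iff[of _ "shapes 7"]
        list_ex_iff[of _ "[[2,4,5],[2,3,6],[2,3,5],[2,5,6],[3,4,6],[1,5,6]]"] by blast
    have "\<exists>S\<subseteq>U. card S \<le> 3 \<and> covers U (insert w S)"
      by (rule list_covers_root[OF S(2) E(6,5) len E(4,3) assms(3)]) (use S(1) in auto)
    then show False using neg by blast
  qed
  note tight = this
  have ex: "eadj E i j" if ij: "i < j" "j < 8" "xs ! i \<sim> xs ! j" for i j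
  proof (rule ccontr)
    assume no: "\<not> eadj E i j"
    have "(i, j) \<in> set (List.product [0..<8] [0..<8])" using ij by auto
    then obtain S where S: "S \<in> set [[1,3,6],[1,3,4],[3,4,6],[2,5,6],[2,4,6],[2,3,5],[3,5,6],[2,3,6]]"
        "list_all (edom ((i, j) # E) (0 # S)) [1,2,3,4,5,6,7]"
      using tight_shapes_cover tight no ij(1)
      unfolding list_all_iff[of _ tight_shapes] list_all_iff[of _ "List.product [0..<8] [0..<8]"]
        list_ex_iff[of _ "[[1,3,6],[1,3,4],[3,4,6],[2,5,6],[2,4,6],[2,3,5],[3,5,6],[2,3,6]]"] by fastforce
    have "\<forall>(i, j)\<in>set ((i, j) # E). xs ! i \<sim> xs ! j" using E(6) ij(3) by auto
    from list_covers_root[OF S(2) this E(5) len E(4,3) assms(3)]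
    have "\<exists>S\<subseteq>U. card S \<le> 3 \<and> covers U (insert w S)" using S(1) by auto
    then show False using neg by blast
  qed
  have esym: "eadj E i j = eadj E j i" for i j unfolding eadj_def list_ex_iff by auto
  have adj: "xs ! i \<sim> xs ! j \<longleftrightarrow> eadj E i j" if "i < 8" "j < 8" "i \<noteq> j" for i j
  proof
    assume a: "xs ! i \<sim> xs ! j"
    show "eadj E i j"
    proof (cases "i < j")
      case True then show ?thesis using ex that a by blast
    next
      case False then show ?thesis using ex[of j i] that adj_sym[OF a] esym by auto
    qed
  next
    assume "eadj E i j"
    then show "xs ! i \<sim> xs ! j" using eadj_sound[OF E(6)] by blast
  qed
  define a0 a1 a2 a3 a4 a5 a6 a7 where "a0 = xs ! 0" "a1 = xs ! 1" "a2 = xs ! 2" "a3 = xs ! 3" "a4 = xs ! 4"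
    "a5 = xs ! 5" "a6 = xs ! 6" "a7 = xs ! 7"
  note a_defs = this
  have xs: "xs = [a0, a1, a2, a3, a4, a5, a6, a7]"
    unfolding a_defs using len by (intro nth_equalityI) (auto simp: less_Suc_eq numeral_eq_Suc)
  have w: "w = a0" using E(3) unfolding a_defs by simp
  have dist: "distinct [a0, a1, a2, a3, a4, a5, a6, a7]" using E(5) xs by simp
  have U: "U = {a1, a2, a3, a4, a5, a6, a7}"
    using E(4) dist assms(3) unfolding xs w by auto
  consider "E = [(0,1),(1,2),(1,3),(2,3),(3,4),(4,5),(2,6),(6,7)]"
    | "E = [(0,1),(0,2),(1,2),(2,3),(3,4),(4,5),(1,6),(6,7)]"
    | "E = [(0,1),(0,2),(1,2),(2,3),(3,4),(1,5),(5,6),(6,7)]"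
    | "E = [(0,1),(0,5),(1,2),(2,3),(3,4),(1,5),(5,6),(6,7)]"
    using tight unfolding tight_shapes_def by auto
  then show False
  proof cases
    case 1
    define p where "p i = [a7, a6, a2, a3, a4, a5] ! i" for i
    have i6: "{..<6} = {0, 1, 2, 3, 4, 5::nat}" by auto
    have ps: "p 0 = a7" "p (Suc 0) = a6" "p 2 = a2" "p 3 = a3" "p 4 = a4" "p 5 = a5" unfolding p_def by auto
    note A = adj[unfolded 1 eadj_def]
    have nb: "a1 \<sim> a2" "a1 \<sim> a3" "\<not> a1 \<sim> a4" "\<not> a1 \<sim> a5" "\<not> a1 \<sim> a6" "\<not> a1 \<sim> a7"
      "a2 \<sim> a3" "\<not> a2 \<sim> a4" "\<not> a2 \<sim> a5" "a2 \<sim> a6" "\<not> a2 \<sim> a7"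
      "a3 \<sim> a4" "\<not> a3 \<sim> a5" "\<not> a3 \<sim> a6" "\<not> a3 \<sim> a7" "a4 \<sim> a5" "\<not> a4 \<sim> a6" "\<not> a4 \<sim> a7"
      "\<not> a5 \<sim> a6" "\<not> a5 \<sim> a7" "a6 \<sim> a7"
      "a0 \<sim> a1" "\<not> a0 \<sim> a2" "\<not> a0 \<sim> a3" "\<not> a0 \<sim> a4" "\<not> a0 \<sim> a5" "\<not> a0 \<sim> a6" "\<not> a0 \<sim> a7"
      unfolding a_defs by (subst A; simp)+
    have nb': "a3 \<sim> a2" "\<not> a4 \<sim> a2" "\<not> a5 \<sim> a2" "a6 \<sim> a2" "\<not> a7 \<sim> a2" "a4 \<sim> a3" "\<not> a5 \<sim> a3" "\<not> a6 \<sim> a3"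
      "\<not> a7 \<sim> a3" "a5 \<sim> a4" "\<not> a6 \<sim> a4" "\<not> a7 \<sim> a4" "\<not> a6 \<sim> a5" "\<not> a7 \<sim> a5" "a7 \<sim> a6"
      using nb adj_sym by blast+
    have inj: "inj_on p {..<6}" unfolding i6 inj_on_def using dist by (auto simp: ps)
    have pp: "\<forall>i<6. \<forall>j<6. p i \<sim> p j \<longleftrightarrow> j = Suc i \<or> i = Suc j"
    proof (intro allI impI)
      fix i j :: nat assume "i < 6" "j < 6"
      then have "i \<in> {0, 1, 2, 3, 4, 5}" "j \<in> {0, 1, 2, 3, 4, 5}" by auto
      then show "p i \<sim> p j \<longleftrightarrow> j = Suc i \<or> i = Suc j"
        by (elim insertE emptyE; simp add: ps nb nb' adj_irrefl)
    qed
    have "h_unit U a1 p" unfolding h_unit_def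
    proof (intro conjI)
      show "U = insert a1 (p ` {..<6})" unfolding U i6 by (auto simp: ps)
      show "a1 \<notin> p ` {..<6}" unfolding i6 using dist by (auto simp: ps)
      show "\<forall>i<6. a1 \<sim> p i \<longleftrightarrow> i \<in> {2, 3}"
      proof (intro allI impI)
        fix i :: nat assume "i < 6"
        then have "i \<in> {0, 1, 2, 3, 4, 5}" by auto
        then show "a1 \<sim> p i \<longleftrightarrow> i \<in> {2, 3}" using nb by (auto simp: ps)
      qed
    qed (use inj pp in auto)
    then have "tip_attached U w a1 p" unfolding tip_attached_def U w using nb by auto
    then show False using neg by blast
  next
    case 2
    note A = adj[unfolded 2 eadj_def]
    have "a7 \<sim> a6" "a6 \<sim> a1" "a1 \<sim> a2" "a2 \<sim> a3" "a3 \<sim> a4" "a4 \<sim> a5" "\<not> a1 \<sim> a3" "a0 \<sim> a1" "a0 \<sim> a2"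
      unfolding a_defs by (subst A; simp)+
    then have "path_attached U w [a7, a6, a1, a2, a3, a4, a5]"
      using dist unfolding path_attached_def U w by (auto simp: less_Suc_eq numeral_eq_Suc)
    then show False using neg by blast
  next
    case 3
    note A = adj[unfolded 3 eadj_def]
    have "a4 \<sim> a3" "a3 \<sim> a2" "a2 \<sim> a1" "a1 \<sim> a5" "a5 \<sim> a6" "a6 \<sim> a7" "\<not> a2 \<sim> a5" "a0 \<sim> a2" "a0 \<sim> a1"
      unfolding a_defs by (subst A; simp)+
    then have "path_attached U w [a4, a3, a2, a1, a5, a6, a7]"
      using dist unfolding path_attached_def U w by (auto simp: less_Suc_eq numeral_eq_Suc)
    then show False using neg by blast
  next
    case 4
    note A = adj[unfolded 4 eadj_def]
    have "a7 \<sim> a6" "a6 \<sim> a5" "a5 \<sim> a1" "a1 \<sim> a2" "a2 \<sim> a3" "a3 \<sim> a4" "\<not> a5 \<sim> a2" "a0 \<sim> a5" "a0 \<sim> a1"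
      unfolding a_defs by (subst A; simp)+
    then have "path_attached U w [a7, a6, a5, a1, a2, a3, a4]"
      using dist unfolding path_attached_def U w by (auto simp: less_Suc_eq numeral_eq_Suc)
    then show False using neg by blast
  qed
qed

text \<open>Inside \<open>U\<close>, only the clique vertex has exactly two neighbours and these
  adjacent: \<open>p 2\<close> and \<open>p 3\<close> have three neighbours, and the other path
  vertices lie in no triangle.\<close>

lemma h_unit_tip_unique:
  assumes "h_unit U c p" "h_unit U c' p'" shows "c = c'"
proof (rule ccontr)
  assume ne: "c \<noteq> c'"
  have i6: "{..<6} = {0, 1, 2, 3, 4, 5::nat}" by auto
  note h = assms(1)[unfolded h_unit_def] and h' = assms(2)[unfolded h_unit_def]
  have "c' \<in> U" using h' by auto
  then obtain i where i: "i < 6" "c' = p i" using h ne by auto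
  define y z where "y = p' 2" and "z = p' 3"
  have yz: "y \<in> U" "z \<in> U" "y \<noteq> z" "c' \<sim> y" "c' \<sim> z" "y \<sim> z"
    using h' unfolding y_def z_def by (auto dest: inj_onD)
  have only: "x = y \<or> x = z" if "x \<in> U" "c' \<sim> x" for x
    using that h' adj_irrefl unfolding y_def z_def by auto
  have pc: "c \<sim> p j \<longleftrightarrow> j = 2 \<or> j = 3" "p j \<sim> c \<longleftrightarrow> j = 2 \<or> j = 3" if "j < 6" for j
    using h that adj_sym by blast+
  have pp: "p j \<sim> p k \<longleftrightarrow> k = Suc j \<or> j = Suc k" if "j < 6" "k < 6" for j k using h that by blast
  have mem: "x = c \<or> (\<exists>j<6. x = p j)" if "x \<in> U" for x using h that by auto
  have inU: "c \<in> U" "\<And>j. j < 6 \<Longrightarrow> p j \<in> U" using h by auto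
  have pinj: "p j = p k \<longleftrightarrow> j = k" if "j < 6" "k < 6" for j k using h that by (auto dest: inj_onD)
  have pne: "p j \<noteq> c" if "j < 6" for j using h that by auto
  show False
  proof (cases "i = 2 \<or> i = 3")
    case True
    then have "c' \<sim> c" "c' \<sim> p (i - 1)" "c' \<sim> p (i + 1)" using i pc pp by auto
    then have "c = y \<or> c = z" "p (i - 1) = y \<or> p (i - 1) = z" "p (i + 1) = y \<or> p (i + 1) = z"
      using only[OF inU(1)] only[OF inU(2)[of "i - 1"]] only[OF inU(2)[of "i + 1"]] True by auto
    moreover have "c \<noteq> p (i - 1)" "c \<noteq> p (i + 1)" "p (i - 1) \<noteq> p (i + 1)"
      using pinj[of "i - 1" "i + 1"] pne[of "i - 1"] pne[of "i + 1"] True by auto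
    ultimately show False by metis
  next
    case False
    then have "\<not> c' \<sim> c" using pc i by auto
    then obtain j k where jk: "j < 6" "k < 6" "y = p j" "z = p k" using mem yz by metis
    then have "j = Suc i \<or> i = Suc j" "k = Suc i \<or> i = Suc k" "k = Suc j \<or> j = Suc k"
      using yz i pp by auto
    then show False by auto
  qed
qed

text \<open>Evaluation settles every neighbour of \<open>w2\<close> on the path except the middle
  one, where the claw condition at \<open>q ! 3\<close> provides \<open>q ! 2\<close> or
  \<open>q ! 4\<close> as another neighbour of \<open>w2\<close>.\<close>

lemma path_attached_two_cover:
  assumes b: "path_attached U w1 q" and w: "w1 \<notin> U" "w2 \<notin> U" "w1 \<noteq> w2" "w2 \<sim> u" "u \<in> U"
  shows "\<exists>S\<subseteq>U. card S \<le> 3 \<and> covers U ({w1, w2} \<union> S)"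
proof -
  note bd = b[unfolded path_attached_def]
  have w1: "w1 \<sim> q ! 2" "w1 \<sim> q ! 3" using bd by blast+
  \<comment> \<open>Labels 0 to 6 are the path, 7 and 8 the outside vertices.\<close>
  define xs where "xs = q @ [w1, w2]"
  have dist: "distinct xs" using bd w unfolding xs_def by auto
  have len: "length xs = 9" using bd unfolding xs_def by simp
  have nth: "xs ! i = q ! i" if "i < 7" for i using that bd unfolding xs_def by (simp add: nth_append)
  have x78: "xs ! 7 = w1" "xs ! 8 = w2" using bd unfolding xs_def by (auto simp: nth_append)
  have base: "\<forall>(i, j)\<in>set [(0,1),(1,2),(2,3),(3,4),(4,5),(5,6),(7,2),(7,3)]. xs ! i \<sim> xs ! j"
  proof -
    have "q ! i \<sim> q ! Suc i" if "i < 6" for i using bd that by blast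
    from this[of 0] this[of 1] this[of 2] this[of 3] this[of 4] this[of 5] show ?thesis
      using w1 x78 by (simp add: nth eval_nat_numeral)
  qed
  have imgU: "(!) xs ` set [0,1,2,3,4,5,6] = U"
  proof -
    have "map ((!) xs) [0..<7] = map ((!) q) [0..<7]" using nth by (intro map_cong) auto
    also have "\<dots> = q" using map_nth[of q] bd by metis
    finally have "(!) xs ` set [0..<7] = U" using bd by (metis set_map)
    moreover have "[0..<7] = [0,1,2,3,4,5,6::nat]" by (simp add: upt_rec)
    ultimately show ?thesis by metis
  qed
  have fin: ?thesis if i: "xs ! i \<sim> w2" and e:
    "list_all (edom [(8,i),(0,1),(1,2),(2,3),(3,4),(4,5),(5,6),(7,2),(7,3)] (7 # 8 # S)) [0,1,2,3,4,5,6]"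
     "distinct (7 # 8 # S)" "set S \<subseteq> set [0,1,2,3,4,5,6]" "length S \<le> 3" for i S
  proof -
    have "covers ((!) xs ` set [0,1,2,3,4,5,6]) ((!) xs ` set (7 # 8 # S))"
      by (rule list_covers[OF e(1) _ dist e(2)]) (use base i adj_sym x78 len e(3) in auto)
    moreover have "(!) xs ` set (7 # 8 # S) = {w1, w2} \<union> ((!) xs ` set S)" using x78 by auto
    moreover have "(!) xs ` set S \<subseteq> U" using e(3) imgU by blast
    moreover have "card ((!) xs ` set S) \<le> 3" using card_image_le[of "set S" "(!) xs"] card_length[of S] e(4)
      by simp
    ultimately show ?thesis using imgU by metis
  qed
  have i2: ?thesis if "xs ! 2 \<sim> w2" by (rule fin[OF that, of "[1,4,5]"]) (code_simp, auto)
  have i4: ?thesis if "xs ! 4 \<sim> w2" by (rule fin[OF that, of "[1,3,5]"]) (code_simp, auto)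
  obtain i where i: "i < 7" "u = xs ! i" using w(5) bd nth by (metis in_set_conv_nth)
  have iw: "xs ! i \<sim> w2" using w(4) i adj_sym by blast
  consider "i = 0" | "i = 1" | "i = 2" | "i = 3" | "i = 4" | "i = 5" | "i = 6" using i(1) by linarith
  then show ?thesis
  proof cases
    case 1 with iw have "xs ! 0 \<sim> w2" by simp
    then show ?thesis by (rule fin[where S = "[4,5]"]) (code_simp, auto)
  next
    case 2 with iw have "xs ! 1 \<sim> w2" by simp
    then show ?thesis by (rule fin[where S = "[1,4,5]"]) (code_simp, auto)
  next
    case 3 then show ?thesis using i2 iw by simp
  next
    case 4
    have "q ! i \<sim> q ! Suc i" if "i < 6" for i using bd that by blast
    from this[of 2] this[of 3] have "q ! 3 \<sim> q ! 2" "q ! 3 \<sim> q ! 4" using adj_sym by simp_all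
    moreover have "q ! 3 \<sim> w2" using iw nth 4 by simp
    moreover have "q ! 2 \<noteq> q ! 4" "q ! 2 \<noteq> w2" "q ! 4 \<noteq> w2" using bd w by (auto simp: nth_eq_iff_index_eq)
    ultimately have "q ! 2 \<sim> w2 \<or> q ! 4 \<sim> w2" using claw bd by blast
    then show ?thesis using i2 i4 nth by auto
  next
    case 5 then show ?thesis using i4 iw by simp
  next
    case 6 with iw have "xs ! 5 \<sim> w2" by simp
    then show ?thesis by (rule fin[where S = "[1,2,5]"]) (code_simp, auto)
  next
    case 7 with iw have "xs ! 6 \<sim> w2" by simp
    then show ?thesis by (rule fin[where S = "[1,2,4]"]) (code_simp, auto)
  qed
qed


section \<open>From units to the labelled graph\<close>

text \<open>\<open>H_t\<close> described on the vertices of the graph itself, as the common ground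
  of the extremal argument, the lower bound and the isomorphism.\<close>

definition h_labelling :: "nat \<Rightarrow> (nat \<Rightarrow> 'a) \<Rightarrow> (nat \<Rightarrow> nat \<Rightarrow> 'a) \<Rightarrow> bool" where
  "h_labelling t c p \<longleftrightarrow> V = (\<Union>i<t. insert (c i) (p i ` {..<6})) \<and>
     (\<forall>i<t. inj_on (p i) {..<6} \<and> c i \<notin> p i ` {..<6}) \<and>
     (\<forall>i<t. \<forall>k<t. i \<noteq> k \<longrightarrow> insert (c i) (p i ` {..<6}) \<inter> insert (c k) (p k ` {..<6}) = {}) \<and>
     (\<forall>i<t. \<forall>k<t. c i \<sim> c k \<longleftrightarrow> i \<noteq> k) \<and>
     (\<forall>i<t. \<forall>k<t. \<forall>j<6. c i \<sim> p k j \<longleftrightarrow> i = k \<and> j \<in> {2, 3}) \<and>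
     (\<forall>i<t. \<forall>k<t. \<forall>j<6. \<forall>l<6. p i j \<sim> p k l \<longleftrightarrow> i = k \<and> (l = Suc j \<or> j = Suc l))"

text \<open>Such a vertex comes for free: it belongs to four vertices that pay for \<open>U\<close>,
  and may help a neighbouring unit.\<close>

definition covered_through :: "'a set \<Rightarrow> 'a \<Rightarrow> bool" where
  "covered_through U w \<longleftrightarrow> (\<exists>S. w \<in> S \<and> S \<subseteq> V \<and> card S \<le> 4 \<and> covers U S)"

text \<open>Otherwise \<open>S\<close>, together with four vertices for each remaining unit, would
  make \<open>V\<close> good.\<close>

lemma cover_lower:
  assumes P: "unit_partition P V" "\<not> good V" and Q: "Q \<subseteq> P" "S \<subseteq> V" "covers (\<Union>Q) S"
  shows "4 * card Q \<le> card S"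
proof (rule ccontr)
  assume "\<not> 4 * card Q \<le> card S"
  have finP: "finite P" using P unfolding unit_partition_def by blast
  have cQ: "card Q \<le> card P" using card_mono[OF finP Q(1)] .
  have "unit_partition (P - Q) (\<Union>(P - Q))"
    using P(1) unfolding unit_partition_def by (auto simp: pairwise_def)
  then have "cost (\<Union>(P - Q)) (4 * card (P - Q))" using unit_partition_cost by blast
  moreover have "cost (\<Union>Q) (card S)" using Q unfolding cost_def by blast
  ultimately have "cost (\<Union>Q \<union> \<Union>(P - Q)) (card S + 4 * card (P - Q))" using cost_Un by blast
  moreover have "\<Union>Q \<union> \<Union>(P - Q) = V" using P(1) Q(1) unfolding unit_partition_def by blast
  moreover have "card V = 7 * card P" using unit_partition_cost[OF P(1)] by blast
  moreover have "card (P - Q) = card P - card Q" using card_Diff_subset Q(1) finP finite_subset by metis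
  ultimately have "good V" unfolding good_def using \<open>\<not> 4 * card Q \<le> card S\<close> cQ
    by (intro exI[of _ "card S + 4 * card (P - Q)"]) auto
  then show False using P by blast
qed

text \<open>Some neighbour \<open>w'\<close> of \<open>u\<close> lies in a set of four that covers
  \<open>U'\<close>. If \<open>w'\<close> and three vertices of \<open>U\<close> covered
  \<open>U\<close>, seven vertices would serve two units, against
  \<open>cover_lower\<close>.\<close>

lemma pair_type:
  assumes P: "unit_partition P V" "\<not> good V" and U: "U \<in> P" "U' \<in> P" "U \<noteq> U'" "u \<in> U" "w \<in> U'" "u \<sim> w"
  shows "\<exists>w'\<in>U'. u \<sim> w' \<and> covered_through U' w' \<and> ((\<exists>c p. tip_attached U w' c p) \<or> (\<exists>q. path_attached U w' q))"
proof -
  have un: "con U" "card U = 7" "con U'" "card U' = 7" using P U unfolding unit_partition_def unit_def by auto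
  have dis: "U \<inter> U' = {}" using P(1) U unfolding unit_partition_def pairwise_def disjnt_def by blast
  then have "u \<notin> U'" using U by blast
  then obtain w' S where S: "w' \<in> U'" "u \<sim> w'" "w' \<in> S" "S \<subseteq> V" "card S \<le> 4" "covers U' S"
    using seven_cover_through[OF un(3,4) _ U(5,6)] by metis
  have "w' \<notin> U" "w' \<sim> u" using S dis adj_sym by blast+
  from attach_cases[OF un(1,2) this U(4)]
  consider T where "T \<subseteq> U" "card T \<le> 3" "covers U (insert w' T)" |
    "(\<exists>c p. tip_attached U w' c p) \<or> (\<exists>q. path_attached U w' q)"
    by blast
  then show ?thesis
  proof cases
    case 1
    have "covers U (S \<union> T)" by (rule covers_mono[OF 1(3) order_refl]) (use S(3) in auto)
    moreover have "covers U' (S \<union> T)" by (rule covers_mono[OF S(6) order_refl]) auto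
    ultimately have c: "covers (\<Union>{U, U'}) (S \<union> T)" unfolding covers_def by auto
    have "S \<union> T \<subseteq> V" using S(4) 1(1) con_sub[OF un(1)] by blast
    then have "4 * card {U, U'} \<le> card (S \<union> T)" using cover_lower[OF P _ _ c] U by blast
    then have False using card_Un_le[of S T] S(5) 1(2) U(3) by simp
    then show ?thesis ..
  next
    case 2 then show ?thesis using S unfolding covered_through_def by blast
  qed
qed

text \<open>The outside neighbours \<open>w1\<close> and \<open>w2\<close> are paid by their own
  units, so three units would be served by 4 + 4 + 3 = 11 vertices.\<close>

lemma path_attached_no_third:
  assumes P: "unit_partition P V" "\<not> good V" and U: "U \<in> P" "U1 \<in> P" "U2 \<in> P" "U \<noteq> U1" "U \<noteq> U2" "U1 \<noteq> U2"
    and b: "path_attached U w1 q" "w1 \<in> U1" "covered_through U1 w1" and e: "u \<in> U" "w \<in> U2" "u \<sim> w"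
  shows False
proof -
  have dis: "A \<inter> B = {}" if "A \<in> P" "B \<in> P" "A \<noteq> B" for A B
    using P(1) that unfolding unit_partition_def pairwise_def disjnt_def by blast
  obtain w2 where w2: "w2 \<in> U2" "u \<sim> w2" "covered_through U2 w2"
    using pair_type[OF P U(1,3,5) e] by blast
  obtain S1 where S1: "w1 \<in> S1" "S1 \<subseteq> V" "card S1 \<le> 4" "covers U1 S1" using b unfolding covered_through_def
    by blast
  obtain S2 where S2: "w2 \<in> S2" "S2 \<subseteq> V" "card S2 \<le> 4" "covers U2 S2" using w2 unfolding covered_through_def
    by blast
  have "w1 \<notin> U" "w2 \<notin> U" "w1 \<noteq> w2"
    using dis[OF U(1,2,4)] dis[OF U(1,3,5)] dis[OF U(2,3,6)] b(2) w2(1) by blast+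
  then obtain S where S: "S \<subseteq> U" "card S \<le> 3" "covers U ({w1, w2} \<union> S)"
    using path_attached_two_cover[OF b(1) _ _ _ _ e(1)] w2(2) adj_sym by metis
  let ?S = "S1 \<union> S2 \<union> S"
  have "covers U ?S" by (rule covers_mono[OF S(3) order_refl]) (use S1(1) S2(1) in auto)
  moreover have "covers U1 ?S" by (rule covers_mono[OF S1(4) order_refl]) auto
  moreover have "covers U2 ?S" by (rule covers_mono[OF S2(4) order_refl]) auto
  ultimately have c: "covers (\<Union>{U, U1, U2}) ?S" unfolding covers_def by auto
  have "U \<subseteq> V" using P(1) U unfolding unit_partition_def by blast
  then have "?S \<subseteq> V" using S S1 S2 by blast
  then have "4 * card {U, U1, U2} \<le> card ?S" using cover_lower[OF P _ _ c] U by blast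
  moreover have "card {U, U1, U2} = 3" using U by auto
  moreover have "card ?S \<le> 11" using card_Un_le[of "S1 \<union> S2" S] card_Un_le[of S1 S2] S S1 S2 by linarith
  ultimately show False by simp
qed

text \<open>A third unit \<open>U2\<close> is adjacent to \<open>U\<close> or to \<open>U1\<close>.
  The former contradicts \<open>path_attached_no_third\<close>. In the latter case \<open>U\<close>
  and \<open>U2\<close> have vertices whose only neighbour in \<open>U1\<close> is its clique
  vertex, and the claw condition there makes them adjacent, which leads back to the former
  case.\<close>

lemma no_path_attached:
  assumes P: "unit_partition P V" "\<not> good V" "con V" "3 \<le> card P"
    and U: "U \<in> P" "U1 \<in> P" "U \<noteq> U1" and b: "path_attached U w1 q" "w1 \<in> U1" "covered_through U1 w1"
  shows False
proof -
  have dis: "A \<inter> B = {}" if "A \<in> P" "B \<in> P" "A \<noteq> B" for A B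
    using P(1) that unfolding unit_partition_def pairwise_def disjnt_def by blast
  have "\<not> P \<subseteq> {U, U1}" using P(4) card_mono[of "{U, U1}" P] U(3) by auto
  then obtain U3 where U3: "U3 \<in> P" "U3 \<noteq> U" "U3 \<noteq> U1" by blast
  have "U3 \<noteq> {}" using P(1) U3 con_ne unfolding unit_partition_def unit_def by blast
  then have ne: "U \<union> U1 \<noteq> V" using dis[OF U3(1) U(1) U3(2)] dis[OF U3(1) U(2) U3(3)] U3(1) P(1)
    unfolding unit_partition_def by blast
  have sub: "U \<union> U1 \<subseteq> V" "U \<union> U1 \<noteq> {}" using U b(2) P(1) unfolding unit_partition_def by blast+
  obtain y z where yz: "y \<in> U \<union> U1" "z \<in> V - (U \<union> U1)" "y \<sim> z" using conD[OF P(3) sub ne] by blast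
  then obtain U2 where U2: "U2 \<in> P" "z \<in> U2" using P(1) unfolding unit_partition_def by blast
  have ne2: "U \<noteq> U2" "U1 \<noteq> U2" using U2 yz by blast+
  note third = path_attached_no_third[OF P(1,2) U(1,2) U2(1) U(3) ne2 b]
  show False
  proof (cases "y \<in> U")
    case True then show False using third U2 yz by blast
  next
    case False
    then have y: "y \<in> U1" using yz by blast
    have q: "q ! 2 \<in> U" "w1 \<sim> q ! 2" using b(1) unfolding path_attached_def by auto
    obtain u' where u': "u' \<in> U" "w1 \<sim> u'" "covered_through U u'"
      "(\<exists>c p. tip_attached U1 u' c p) \<or> (\<exists>q. path_attached U1 u' q)"
      using pair_type[OF P(1,2) U(2,1) U(3)[symmetric] b(2) q] by blast
    have "\<not> (\<exists>q. path_attached U1 u' q)"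
      using path_attached_no_third[OF P(1,2) U(2,1) U2(1) U(3)[symmetric] ne2(2,1) _ u'(1,3) y U2(2) yz(3)]
        by blast
    then obtain c p where a: "tip_attached U1 u' c p" using u'(4) by blast
    obtain b' where b': "b' \<in> U2" "y \<sim> b'" "covered_through U2 b'"
      "(\<exists>c p. tip_attached U1 b' c p) \<or> (\<exists>q. path_attached U1 b' q)"
      using pair_type[OF P(1,2) U(2) U2(1) ne2(2) y U2(2) yz(3)] by blast
    have "\<not> (\<exists>q. path_attached U1 b' q)"
      using path_attached_no_third[OF P(1,2) U(2) U2(1) U(1) ne2(2) U(3)[symmetric] ne2(1)[symmetric] _ b'(1,3)
        b(2) u'(1,2)] by blast
    then obtain c' p' where a': "tip_attached U1 b' c' p'" using b'(4) by blast
    have cc: "c' = c" using h_unit_tip_unique a a' unfolding tip_attached_def by blast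
    have c: "c \<in> U1" "p 2 \<in> U1" "c \<noteq> p 2" "c \<sim> p 2" using a unfolding tip_attached_def h_unit_def by auto
    have "u' \<sim> x \<longleftrightarrow> x = c" "b' \<sim> x \<longleftrightarrow> x = c" if "x \<in> U1" for x
      using a a' cc that unfolding tip_attached_def by simp_all
    then have e: "c \<sim> u'" "c \<sim> b'" "\<not> u' \<sim> p 2" "\<not> b' \<sim> p 2"
      using c(1-3) adj_sym by metis+
    have "u' \<noteq> b'" "u' \<noteq> p 2" "b' \<noteq> p 2"
      using dis[OF U(1) U2(1) ne2(1)] dis[OF U] dis[OF U(2) U2(1) ne2(2)] u'(1) b'(1) c(2) by blast+
    then have "u' \<sim> b'" using claw[OF e(1,2) c(4)] e by blast
    then show False using third u'(1) b'(1) by blast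
  qed
qed

theorem tight_labelling:
  assumes P: "unit_partition P V" "\<not> good V" "con V" "3 \<le> card P"
  shows "\<exists>c p. h_labelling (card P) c p"
proof -
  have dis: "A \<inter> B = {}" if "A \<in> P" "B \<in> P" "A \<noteq> B" for A B
    using P(1) that unfolding unit_partition_def pairwise_def disjnt_def by blast
  have unP: "\<Union>P = V" "finite P" using P(1) unfolding unit_partition_def by auto
  have ty: "\<exists>w' c p. tip_attached U w' c p \<and> u \<sim> w'" if "U \<in> P" "U' \<in> P" "U \<noteq> U'" "u \<in> U" "w \<in> U'" "u \<sim> w"
    for U U' u w
    using pair_type[OF P(1,2) that] no_path_attached[OF P that(1,2,3)] by blast
  have hex: "\<exists>c p. h_unit U c p" if U: "U \<in> P" for U
  proof -
    have "\<not> P \<subseteq> {U}" using P(4) card_mono[of "{U}" P] by auto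
    then obtain U' where U': "U' \<in> P" "U' \<noteq> U" by blast
    have "U' \<noteq> {}" "U \<noteq> {}" using P(1) U U' con_ne unfolding unit_partition_def unit_def by blast+
    moreover have "U \<subseteq> V" "U' \<subseteq> V" using U U' unP by blast+
    ultimately obtain y z where yz: "y \<in> U" "z \<in> V - U" "y \<sim> z" using conD[OF P(3), of U] dis[OF U U'(1)] U'(2)
      by blast
    then obtain U2 where "U2 \<in> P" "z \<in> U2" "U \<noteq> U2" using unP by blast
    then show ?thesis using ty[OF U _ _ yz(1) _ yz(3)] unfolding tip_attached_def by blast
  qed
  then obtain C p where h: "\<And>U. U \<in> P \<Longrightarrow> h_unit U (C U) (p U)" by metis
  \<comment> \<open>An edge between units ends in clique vertices on both sides: the attachment
    meets one vertex of \<open>U\<close> only, and this vertex does not depend on the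
    attachment.\<close>
  have tip: "u = C U" if "U \<in> P" "U' \<in> P" "U \<noteq> U'" "u \<in> U" "w \<in> U'" "u \<sim> w" for U U' u w
  proof -
    from ty[OF that] obtain w' c q where "tip_attached U w' c q" "u \<sim> w'" by blast
    then show ?thesis using h_unit_tip_unique[OF h[OF that(1)], of c q] that(4) adj_sym
      unfolding tip_attached_def by metis
  qed
  have clique: "C U \<sim> C U'" if UU: "U \<in> P" "U' \<in> P" "U \<noteq> U'" for U U'
  proof (rule ccontr)
    assume no: "\<not> C U \<sim> C U'"
    \<comment> \<open>\<open>A\<close> gathers \<open>U\<close> and the units whose clique vertex is
      adjacent to \<open>C U\<close>. An edge leaving it joins some \<open>C U1\<close> to some
      \<open>C U2\<close>, with \<open>U1\<close> different from \<open>U\<close> by the choice of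
      \<open>A\<close>; then \<open>C U\<close>, \<open>C U2\<close> and \<open>p U1 2\<close> would
      form a claw at \<open>C U1\<close>.\<close>
    define A where "A = {W \<in> P. W = U \<or> C U \<sim> C W}"
    have CU: "C W \<in> W" if "W \<in> P" for W using h[OF that] unfolding h_unit_def by blast
    have A: "U \<in> A" "U' \<notin> A" "A \<subseteq> P" using UU no unfolding A_def by auto
    have "U' \<inter> \<Union>A = {}"
    proof -
      have "U' \<inter> W = {}" if "W \<in> A" for W using dis[of U' W] that A UU by blast
      then show ?thesis by blast
    qed
    then have "\<Union>A \<noteq> V" using CU[OF UU(2)] UU(2) unP by blast
    moreover have "\<Union>A \<noteq> {}" using A(1) CU[OF UU(1)] by blast
    moreover have "\<Union>A \<subseteq> V" using A(3) unP by blast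
    ultimately obtain y z where yz: "y \<in> \<Union>A" "z \<in> V - \<Union>A" "y \<sim> z" using conD[OF P(3), of "\<Union>A"] by blast
    obtain U1 where U1: "U1 \<in> A" "y \<in> U1" using yz by blast
    obtain U2 where U2: "U2 \<in> P" "z \<in> U2" "U2 \<notin> A" using yz unP by blast
    have U1P: "U1 \<in> P" "U1 \<noteq> U2" using U1 U2 A by blast+
    have y: "y = C U1" using tip[OF U1P(1) U2(1) U1P(2) U1(2) U2(2) yz(3)] .
    have z: "z = C U2" using tip[OF U2(1) U1P(1) U1P(2)[symmetric] U2(2) U1(2) adj_sym[OF yz(3)]] .
    show False
    proof (cases "U1 = U")
      case True then show False using U2 y z yz(3) unfolding A_def by blast
    next
      case False
      then have c: "C U \<sim> C U1" using U1(1) unfolding A_def by blast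
      have hp: "p U1 2 \<in> U1" "C U1 \<sim> p U1 2" using h[OF U1P(1)] unfolding h_unit_def by auto
      then have hne: "p U1 2 \<noteq> C U1" using adj_irrefl by metis
      have U2U: "U2 \<noteq> U" using U2 A by blast
      have n1: "\<not> C U \<sim> p U1 2" using tip[OF U1P(1) UU(1) False hp(1) CU[OF UU(1)]] hne adj_sym by blast
      have n2: "\<not> C U2 \<sim> p U1 2" using tip[OF U1P(1) U2(1) U1P(2) hp(1) CU[OF U2(1)]] hne adj_sym by blast
      have n3: "\<not> C U \<sim> C U2" using U2 unfolding A_def by blast
      have d: "C U \<noteq> C U2" "C U \<noteq> p U1 2" "C U2 \<noteq> p U1 2"
        using dis[OF UU(1) U2(1) U2U[symmetric]] CU[OF UU(1)] CU[OF U2(1)]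
          dis[OF UU(1) U1P(1) False[symmetric]] dis[OF U2(1) U1P(1) U1P(2)[symmetric]] hp(1)
        by (metis disjoint_iff)+
      have "C U1 \<sim> C U2" using yz(3) y z by simp
      from claw[OF adj_sym[OF c] this hp(2) d] show False using n1 n2 n3 by blast
    qed
  qed
  obtain g where g: "bij_betw g {..<card P} P" using ex_bij_betw_nat_finite[OF unP(2)]
    by (auto simp: atLeast0LessThan)
  have gP: "g i \<in> P" if "i < card P" for i using g that unfolding bij_betw_def by auto
  have gne: "g i \<noteq> g k" if "i < card P" "k < card P" "i \<noteq> k" for i k using g that
    unfolding bij_betw_def inj_on_def by auto
  have gset: "insert (C (g i)) (p (g i) ` {..<6}) = g i" if "i < card P" for i
    using h[OF gP[OF that]] unfolding h_unit_def by auto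
  have "h_labelling (card P) (\<lambda>i. C (g i)) (\<lambda>i. p (g i))"
    unfolding h_labelling_def
  proof (intro conjI allI impI)
    have "(\<Union>i<card P. insert (C (g i)) (p (g i) ` {..<6})) = (\<Union>i<card P. g i)" using gset by auto
    also have "\<dots> = V" using g unP unfolding bij_betw_def by auto
    finally show "V = (\<Union>i<card P. insert (C (g i)) (p (g i) ` {..<6}))" by simp
    fix i assume i: "i < card P"
    show "inj_on (p (g i)) {..<6}" "C (g i) \<notin> p (g i) ` {..<6}" using h[OF gP[OF i]] unfolding h_unit_def
      by auto
    fix k assume k: "k < card P"
    show "i \<noteq> k \<Longrightarrow> insert (C (g i)) (p (g i) ` {..<6}) \<inter> insert (C (g k)) (p (g k) ` {..<6}) = {}"
      unfolding gset[OF i] gset[OF k] by (rule dis[OF gP[OF i] gP[OF k] gne[OF i k]])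
    show "C (g i) \<sim> C (g k) \<longleftrightarrow> i \<noteq> k"
      using clique[OF gP[OF i] gP[OF k] gne[OF i k]] adj_irrefl by (cases "i = k") auto
    have in_g: "C (g i) \<in> g i" "\<And>j. j < 6 \<Longrightarrow> p (g k) j \<in> g k" "\<And>j. j < 6 \<Longrightarrow> p (g i) j \<in> g i"
      using gset[OF i] gset[OF k] by auto
    have pne: "p (g k) j \<noteq> C (g k)" if "j < 6" for j
      using h[OF gP[OF k]] that unfolding h_unit_def by (metis imageI lessThan_iff)
    fix j :: nat assume j: "j < 6"
    show "C (g i) \<sim> p (g k) j \<longleftrightarrow> i = k \<and> j \<in> {2, 3}"
    proof (cases "i = k")
      case True then show ?thesis using h[OF gP[OF i]] j unfolding h_unit_def by auto
    next
      case False
      have "\<not> p (g k) j \<sim> C (g i)"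
        using tip[OF gP[OF k] gP[OF i] gne[OF k i False[symmetric]] in_g(2)[OF j] in_g(1)] pne[OF j] by blast
      then show ?thesis using False adj_sym by blast
    qed
    fix l :: nat assume l: "l < 6"
    show "p (g i) j \<sim> p (g k) l \<longleftrightarrow> i = k \<and> (l = Suc j \<or> j = Suc l)"
    proof (cases "i = k")
      case True then show ?thesis using h[OF gP[OF i]] j l unfolding h_unit_def by auto
    next
      case False
      have "\<not> p (g k) l \<sim> p (g i) j"
        using tip[OF gP[OF k] gP[OF i] gne[OF k i False[symmetric]] in_g(2)[OF l] in_g(3)[OF j]] pne[OF l]
          by blast
      then show ?thesis using False adj_sym by blast
    qed
  qed
  then show ?thesis by blast
qed


section \<open>Lower bound for the labelled graph\<close>

lemmas h_labelling_verts = h_labelling_def[THEN iffD1, THEN conjunct1]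
lemmas h_labelling_inj = h_labelling_def[THEN iffD1, THEN conjunct2, THEN conjunct1, rule_format]
lemmas h_labelling_disjoint = h_labelling_def[THEN iffD1, THEN conjunct2, THEN conjunct2, THEN conjunct1,
  rule_format]
lemmas h_labelling_clique = h_labelling_def[THEN iffD1, THEN conjunct2, THEN conjunct2, THEN conjunct2, THEN
  conjunct1, rule_format]
lemmas h_labelling_tip = h_labelling_def[THEN iffD1, THEN conjunct2, THEN conjunct2, THEN conjunct2, THEN
  conjunct2, THEN conjunct1, rule_format]
lemmas h_labelling_path = h_labelling_def[THEN iffD1, THEN conjunct2, THEN conjunct2, THEN conjunct2, THEN
  conjunct2, THEN conjunct2, rule_format]

text \<open>Each block of seven contains four elements of \<open>S\<close>. The end
  \<open>p i 0\<close> has the single neighbour \<open>p i 1\<close> and only \<open>p i 2\<close>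
  at two steps, so \<open>p i 1\<close> is forced, and likewise \<open>p i 4\<close>. Dominating
  these two takes \<open>p i 0\<close>, \<open>p i 2\<close> or both of \<open>p i 3\<close> and
  \<open>c i\<close>, and symmetrically \<open>p i 5\<close>, \<open>p i 3\<close> or both of
  \<open>p i 2\<close> and \<open>c i\<close>; in every case two more vertices.\<close>

lemma h_labelling_cover_lower:
  assumes h: "h_labelling t c p" and S: "S \<subseteq> V" "covers V S"
  shows "4 * t \<le> card S"
proof -
  note VU = h_labelling_verts[OF h] and dis = h_labelling_disjoint[OF h]
  have cp: "c i \<sim> p k j \<longleftrightarrow> i = k \<and> (j = 2 \<or> j = 3)" if "i < t" "k < t" "j < 6" for i j k
    using h_labelling_tip[OF h that] by simp
  note pp = h_labelling_path[OF h]
  have finS: "finite S" using S finite_V finite_subset by blast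
  have unit: "4 \<le> card (S \<inter> insert (c i) (p i ` {..<6}))" if i: "i < t" for i
  proof -
    note inj = h_labelling_inj[OF h i, THEN conjunct1] h_labelling_inj[OF h i, THEN conjunct2]
    have nb: "(x = c i \<and> (j = 2 \<or> j = 3)) \<or> (\<exists>l<6. x = p i l \<and> (l = Suc j \<or> j = Suc l))" if "p i j \<sim> x" "j < 6"
      for x j
    proof -
      have "x \<in> V" using that adj_in adj_sym by blast
      then obtain k where k: "k < t" "x = c k \<or> (\<exists>l<6. x = p k l)" using VU by auto
      then show ?thesis using that cp[OF k(1) i that(2)] pp[OF i k(1) that(2)] adj_sym by blast
    qed
    have inV: "p i j \<in> V" if "j < 6" for j using VU i that by auto
    have dom: "dominated (p i j) S" if "j < 6" for j using S inV[OF that] unfolding covers_def by blast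
    have ne: "p i j = p i l \<longleftrightarrow> j = l" if "j < 6" "l < 6" for j l using inj that by (auto dest: inj_onD)
    have nec: "p i j \<noteq> c i" if "j < 6" for j using inj that by (metis imageI lessThan_iff)
    have n0: "x = p i 1" if "p i 0 \<sim> x" for x using nb[OF that] by auto
    have n5: "x = p i 4" if "p i 5 \<sim> x" for x using nb[OF that] by auto
    have n1: "x = p i 0 \<or> x = p i 2" if "p i 1 \<sim> x" for x using nb[OF that] by (auto simp: numeral_2_eq_2)
    have n4: "x = p i 3 \<or> x = p i 5" if "p i 4 \<sim> x" for x using nb[OF that] by auto
    have n2: "x = p i 1 \<or> x = p i 3 \<or> x = c i" if "p i 2 \<sim> x" for x using nb[OF that]
      by (auto simp: numeral_2_eq_2 numeral_3_eq_3 eval_nat_numeral)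
    have n3: "x = p i 2 \<or> x = p i 4 \<or> x = c i" if "p i 3 \<sim> x" for x using nb[OF that]
      by (auto simp: numeral_2_eq_2 numeral_3_eq_3 eval_nat_numeral)
    have m0: "x = p i 2" if "near (p i 0) x" for x using that n0 n1 unfolding near_def by blast
    have m5: "x = p i 3" if "near (p i 5) x" for x using that n5 n4 unfolding near_def by blast
    have m1: "x = p i 3 \<or> x = c i" if "near (p i 1) x" for x using that n1 n0 n2 unfolding near_def by blast
    have m4: "x = p i 2 \<or> x = c i" if "near (p i 4) x" for x using that n4 n5 n3 unfolding near_def by blast
    have s1: "p i 1 \<in> S" using dom[of 0] n0 m0 unfolding dominated_def by auto
    have s4: "p i 4 \<in> S" using dom[of 5] n5 m5 unfolding dominated_def by auto
    have t1: "p i 0 \<in> S \<or> p i 2 \<in> S \<or> (p i 3 \<in> S \<and> c i \<in> S)"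
    proof -
      have "dominated (p i 1) S" using dom by simp
      then consider u where "u \<in> S" "p i 1 \<sim> u"
        | u w where "u \<in> S" "w \<in> S" "u \<noteq> w" "near (p i 1) u" "near (p i 1) w" unfolding dominated_def by blast
      then show ?thesis
      proof cases
        case 1 then show ?thesis using n1[OF 1(2)] by metis
      next
        case 2 then show ?thesis using m1[OF 2(4)] m1[OF 2(5)] by metis
      qed
    qed
    have t4: "p i 3 \<in> S \<or> p i 5 \<in> S \<or> (p i 2 \<in> S \<and> c i \<in> S)"
    proof -
      have "dominated (p i 4) S" using dom by simp
      then consider u where "u \<in> S" "p i 4 \<sim> u"
        | u w where "u \<in> S" "w \<in> S" "u \<noteq> w" "near (p i 4) u" "near (p i 4) w" unfolding dominated_def by blast
      then show ?thesis
      proof cases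
        case 1 then show ?thesis using n4[OF 1(2)] by metis
      next
        case 2 then show ?thesis using m4[OF 2(4)] m4[OF 2(5)] by metis
      qed
    qed
    have "p i 0 \<noteq> p i 3" "p i 0 \<noteq> p i 5" "p i 0 \<noteq> p i 2" "p i 2 \<noteq> p i 3" "p i 2 \<noteq> p i 5"
      "p i 2 \<noteq> c i" "p i 3 \<noteq> c i" by (simp_all add: ne nec)
    with t1 t4 obtain a b where ab: "a \<in> S" "b \<in> S" "a \<noteq> b"
      "a \<in> {p i 0, p i 2, p i 3, p i 5, c i}" "b \<in> {p i 0, p i 2, p i 3, p i 5, c i}"
      by (elim disjE conjE) blast+
    have "{p i 1, p i 4, a, b} \<subseteq> S \<inter> insert (c i) (p i ` {..<6})" using s1 s4 ab by auto
    moreover have "card {p i 1, p i 4, a, b} = 4"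
    proof -
      have "p i 1 \<noteq> p i 4" "p i 1 \<notin> {p i 0, p i 2, p i 3, p i 5, c i}"
        "p i 4 \<notin> {p i 0, p i 2, p i 3, p i 5, c i}"
        using ne nec by auto
      then have "p i 1 \<noteq> p i 4" "p i 1 \<noteq> a" "p i 1 \<noteq> b" "p i 4 \<noteq> a" "p i 4 \<noteq> b" using ab by blast+
      then show ?thesis using ab(3) by simp
    qed
    ultimately show ?thesis using card_mono[of "S \<inter> insert (c i) (p i ` {..<6})" "{p i 1, p i 4, a, b}"] finS
      by auto
  qed
  have "S \<inter> V = (\<Union>i<t. S \<inter> insert (c i) (p i ` {..<6}))" unfolding VU Int_UN_distrib ..
  then have "card S = card (\<Union>i<t. S \<inter> insert (c i) (p i ` {..<6}))" using S(1) by (simp add: Int_absorb2)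
  also have "\<dots> = (\<Sum>i<t. card (S \<inter> insert (c i) (p i ` {..<6})))"
  proof (rule card_UN_disjoint)
    show "\<forall>i\<in>{..<t}. \<forall>k\<in>{..<t}. i \<noteq> k \<longrightarrow>
        S \<inter> insert (c i) (p i ` {..<6}) \<inter> (S \<inter> insert (c k) (p k ` {..<6})) = {}"
    proof (intro ballI impI)
      fix i k assume "i \<in> {..<t}" "k \<in> {..<t}" "i \<noteq> k"
      from dis[OF _ _ this(3)] this(1,2) show
        "S \<inter> insert (c i) (p i ` {..<6}) \<inter> (S \<inter> insert (c k) (p k ` {..<6})) = {}"
        by (simp only: lessThan_iff) blast
    qed
  qed (use finS in auto)
  also have "\<dots> \<ge> (\<Sum>i<t. 4)" using unit by (intro sum_mono) auto
  finally show ?thesis by simp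
qed

lemma h_labelling_card:
  assumes "h_labelling t c p" shows "card V = 7 * t"
proof -
  have "card V = (\<Sum>i<t. card (insert (c i) (p i ` {..<6})))"
    unfolding h_labelling_verts[OF assms]
    by (rule card_UN_disjoint) (use h_labelling_disjoint[OF assms] in \<open>simp_all only: finite_lessThan
      lessThan_iff finite_insert finite_imageI, blast+\<close>)
  also have "\<dots> = (\<Sum>i<t. 7)"
  proof (rule sum.cong)
    fix i assume "i \<in> {..<t}"
    then have "inj_on (p i) {..<6}" "c i \<notin> p i ` {..<6}" using h_labelling_inj[OF assms] by simp_all
    then show "card (insert (c i) (p i ` {..<6})) = 7" using card_image[of "p i" "{..<6}"] by simp
  qed simp
  finally show ?thesis by simp
qed

end

section \<open>Transfer to digraphs\<close>

lemma two_le_card_iff: "finite A \<Longrightarrow> 2 \<le> card A \<longleftrightarrow> (\<exists>a\<in>A. \<exists>b\<in>A. a \<noteq> b)"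
  using card_le_Suc0_iff_eq[of A] by (metis not_less_eq_eq numeral_2_eq_2)

text \<open>The distance is an infimum over walks. Without adjacency and equality every walk has
  length at least 2; if none has length 2, the infimum is at least 3, being infinite when there is
  no walk.\<close>

lemma graph_dist_eq_2_iff:
  assumes "Digraph.graph G" "v \<in> verts G" "\<not> v \<rightarrow>\<^bsub>G\<^esub> u"
  shows "graph_dist G v u = 2 \<longleftrightarrow> u \<noteq> v \<and> (\<exists>y. v \<rightarrow>\<^bsub>G\<^esub> y \<and> y \<rightarrow>\<^bsub>G\<^esub> u)"
proof -
  interpret Digraph.graph G by fact
  have cost: "awalk_cost (\<lambda>_. 1) p = real (length p)" for p by (induction p) auto
  have dist: "graph_dist G v u = (INF p\<in>{p. awalk v p u}. ereal (real (length p)))"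
    unfolding graph_dist_def \<mu>_def cost ..
  have dom: "tail G e \<rightarrow>\<^bsub>G\<^esub> head G e" if "e \<in> arcs G" for e using that
    by (auto simp: arcs_ends_def arc_to_ends_def)
  show ?thesis
  proof (cases "u = v")
    case True
    have "graph_dist G v u \<le> 0"
      using INF_lower[of "[]" "{p. awalk v p u}" "\<lambda>p. ereal (real (length p))"] assms True
      unfolding dist by (simp add: awalk_Nil_iff zero_ereal_def)
    then have "graph_dist G v u \<noteq> 2" by auto
    then show ?thesis using True by simp
  next
    case False
    have two: "2 \<le> length p" if "awalk v p u" for p
    proof (cases p)
      case Nil then show ?thesis using that False by (simp add: awalk_Nil_iff)
    next
      case (Cons e es)
      then show ?thesis using that dom assms(3) by (cases es) (auto simp: awalk_simps)
    qed
    show ?thesis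
    proof (cases "\<exists>y. v \<rightarrow>\<^bsub>G\<^esub> y \<and> y \<rightarrow>\<^bsub>G\<^esub> u")
      case True
      then obtain e f where "e \<in> arcs G" "f \<in> arcs G" "tail G e = v" "head G e = tail G f" "head G f = u"
        by (auto simp: arcs_ends_def arc_to_ends_def)
      then have "awalk v [e, f] u" by (auto simp: awalk_simps)
      then have "graph_dist G v u \<le> ereal (real (length [e, f]))"
        unfolding dist by (intro INF_lower[of "[e, f]" _ "\<lambda>p. ereal (real (length p))"]) auto
      moreover have "2 \<le> graph_dist G v u" unfolding dist using two by (intro INF_greatest) auto
      ultimately have "graph_dist G v u = 2" by auto
      then show ?thesis using True False by blast
    next
      case no: False
      have three: "3 \<le> length p" if w: "awalk v p u" for p
      proof -
        obtain e f es where p: "p = e # f # es" using two[OF w] by (cases p; cases "tl p") auto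
        have "es \<noteq> []"
        proof
          assume "es = []"
          then have "v \<rightarrow>\<^bsub>G\<^esub> head G e" "head G e \<rightarrow>\<^bsub>G\<^esub> u" using w dom[of e] dom[of f] unfolding p
            by (auto simp: awalk_simps)
          then show False using no by blast
        qed
        then show ?thesis unfolding p by (cases es) auto
      qed
      have "3 \<le> graph_dist G v u" unfolding dist using three by (intro INF_greatest) auto
      then show ?thesis using no by auto
    qed
  qed
qed

lemma graph_claw_free_relation:
  assumes "Digraph.graph G" "claw_free G"
  shows "claw_free_relation (verts G) (\<lambda>x y. x \<rightarrow>\<^bsub>G\<^esub> y)"
proof -
  interpret Digraph.graph G by fact
  show ?thesis
  proof
    fix x y assume "x \<rightarrow>\<^bsub>G\<^esub> y"
    then show "x \<in> verts G" by (auto dest: adj_in_verts)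
  next
    fix x y assume "x \<rightarrow>\<^bsub>G\<^esub> y" then show "y \<rightarrow>\<^bsub>G\<^esub> x" by (rule graph_symmetric)
  next
    fix x show "\<not> x \<rightarrow>\<^bsub>G\<^esub> x" using adj_not_same by blast
  next
    fix x a b c assume e: "x \<rightarrow>\<^bsub>G\<^esub> a" "x \<rightarrow>\<^bsub>G\<^esub> b" "x \<rightarrow>\<^bsub>G\<^esub> c" "a \<noteq> b" "a \<noteq> c" "b \<noteq> c"
    show "a \<rightarrow>\<^bsub>G\<^esub> b \<or> a \<rightarrow>\<^bsub>G\<^esub> c \<or> b \<rightarrow>\<^bsub>G\<^esub> c"
    proof (rule ccontr)
      assume no: "\<not> ?thesis"
      let ?S = "{x, a, b, c}"
      let ?H = "G \<restriction> ?S"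
      have sub: "?S \<subseteq> verts G" using e adj_in_verts by blast
      have ind: "induced_subgraph ?H G" using induced_induce[OF sub] .
      have ne: "x \<noteq> a" "x \<noteq> b" "x \<noteq> c" using e adj_not_same by blast+
      have ends: "arcs_ends ?H = {(u, v). u \<rightarrow>\<^bsub>G\<^esub> v \<and> u \<in> ?S \<and> v \<in> ?S}"
        unfolding arcs_ends_def arc_to_ends_def by auto
      have pos: "a \<rightarrow>\<^bsub>G\<^esub> x" "b \<rightarrow>\<^bsub>G\<^esub> x" "c \<rightarrow>\<^bsub>G\<^esub> x"
        using e(1-3) by (auto intro: graph_symmetric)
      have neg: "\<not> a \<rightarrow>\<^bsub>G\<^esub> b" "\<not> a \<rightarrow>\<^bsub>G\<^esub> c" "\<not> b \<rightarrow>\<^bsub>G\<^esub> a" "\<not> b \<rightarrow>\<^bsub>G\<^esub> c" "\<not> c \<rightarrow>\<^bsub>G\<^esub> a" "\<not> c \<rightarrow>\<^bsub>G\<^esub> b"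
        using no by (auto dest: graph_symmetric)
      have irr: "\<not> x \<rightarrow>\<^bsub>G\<^esub> x" "\<not> a \<rightarrow>\<^bsub>G\<^esub> a" "\<not> b \<rightarrow>\<^bsub>G\<^esub> b" "\<not> c \<rightarrow>\<^bsub>G\<^esub> c"
        using adj_not_same by blast+
      have bip: "arcs_ends ?H = {x} \<times> {a, b, c} \<union> {a, b, c} \<times> {x}"
      proof (rule equalityI; rule subrelI)
        fix u v assume "(u, v) \<in> arcs_ends ?H"
        then have "u \<rightarrow>\<^bsub>G\<^esub> v" "u \<in> ?S" "v \<in> ?S" unfolding ends by blast+
        then show "(u, v) \<in> {x} \<times> {a, b, c} \<union> {a, b, c} \<times> {x}"
          by (elim insertE emptyE; simp add: neg irr)
      next
        fix u v assume "(u, v) \<in> {x} \<times> {a, b, c} \<union> {a, b, c} \<times> {x}"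
        then have "(u = x \<and> v \<in> {a, b, c}) \<or> (v = x \<and> u \<in> {a, b, c})" by blast
        then show "(u, v) \<in> arcs_ends ?H" unfolding ends
          by (elim disjE conjE insertE emptyE; simp add: e(1-3) pos)
      qed
      have gr: "Digraph.graph ?H"
      proof -
        interpret H: sym_digraph ?H by (rule induced_graph_imp_graph[OF ind])
        show ?thesis by unfold_locales (auto simp: no_loops dest: no_multi_arcs)
      qed
      have "K\<^bsub>1,3\<^esub> ?H" unfolding complete_bipartite_digraph_def
      proof (rule conjI[OF gr], rule exI[of _ "{x}"], rule exI[of _ "{a, b, c}"], intro conjI)
        show "verts ?H = {x} \<union> {a, b, c}" by auto
        show "{x} \<inter> {a, b, c} = {}" using ne by simp
        show "card {x} = 1" "card {a, b, c} = 3" using e(4-6) by simp_all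
      qed (fact bip)
      then show False using assms(2) ind unfolding claw_free_def by blast
    qed
  qed simp
qed

lemma connected_graph_con:
  assumes "Digraph.graph G" "claw_free G" "Digraph_Component.connected G"
  shows "claw_free_relation.con (verts G) (\<lambda>x y. x \<rightarrow>\<^bsub>G\<^esub> y) (verts G)"
proof -
  interpret Digraph.graph G by fact
  interpret C: claw_free_relation "verts G" "\<lambda>x y. x \<rightarrow>\<^bsub>G\<^esub> y" by (rule graph_claw_free_relation[OF assms(1,2)])
  note conn = assms(3)[unfolded connected_conv]
  have "(arcs_ends G)\<^sup>s = arcs_ends G" unfolding symcl_def using graph_symmetric by auto
  then have reach: "(u, v) \<in> rtrancl_on (verts G) (arcs_ends G)" if "u \<in> verts G" "v \<in> verts G" for u v
    using conn that by auto
  show ?thesis unfolding C.con_def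
  proof (intro conjI allI impI)
    show "verts G \<noteq> {}" using conn by blast
    fix Y assume Y: "Y \<subseteq> verts G" "Y \<noteq> {}" "Y \<noteq> verts G"
    then obtain y z where yz: "y \<in> Y" "z \<in> verts G" "z \<notin> Y" by blast
    show "\<exists>y\<in>Y. \<exists>z\<in>verts G - Y. y \<rightarrow>\<^bsub>G\<^esub> z"
    proof (rule ccontr)
      assume no: "\<not> ?thesis"
      have "(y, z) \<in> rtrancl_on (verts G) (arcs_ends G)" using reach yz Y by blast
      \<comment> \<open>\<open>Y\<close> is closed under arcs, so it contains all that is reachable
        from \<open>y\<close>.\<close>
      then have "z \<in> Y" by (induction rule: rtrancl_on_induct) (use yz no in auto)
      then show False using yz by blast
    qed
  qed simp
qed

text \<open>If \<open>v\<close> has a neighbour in \<open>S\<close>, both notions hold. Otherwise no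
  element of \<open>S\<close> is adjacent to \<open>v\<close>, and then distance two and a walk of
  length two to another vertex agree.\<close>

lemma disj_total_dominating_iff:
  assumes "Digraph.graph G" "claw_free G"
  shows "disj_total_dominating G S \<longleftrightarrow> S \<subseteq> verts G \<and> claw_free_relation.covers (\<lambda>x y. x \<rightarrow>\<^bsub>G\<^esub> y) (verts G) S"
proof -
  interpret Digraph.graph G by fact
  interpret C: claw_free_relation "verts G" "\<lambda>x y. x \<rightarrow>\<^bsub>G\<^esub> y" by (rule graph_claw_free_relation[OF assms])
  have "((\<exists>u\<in>S. v \<rightarrow>\<^bsub>G\<^esub> u) \<or> 2 \<le> card {u \<in> S. graph_dist G v u = 2}) \<longleftrightarrow> C.dominated v S"
    if S: "S \<subseteq> verts G" and v: "v \<in> verts G" for v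
  proof (cases "\<exists>u\<in>S. v \<rightarrow>\<^bsub>G\<^esub> u")
    case True then show ?thesis unfolding C.dominated_def by blast
  next
    case False
    have "finite {u \<in> S. C.near v u}" using finite_subset[OF S] by simp
    moreover have "{u \<in> S. graph_dist G v u = 2} = {u \<in> S. C.near v u}"
      unfolding C.near_def using False graph_dist_eq_2_iff[OF assms(1) v] by blast
    ultimately show ?thesis using False unfolding C.dominated_def by (simp add: two_le_card_iff) blast
  qed
  then show ?thesis unfolding disj_total_dominating_def C.covers_def by blast
qed

section \<open>Isomorphism with the members of the family\<close>

lemma symcl_iff: "(a, b) \<in> R\<^sup>s \<longleftrightarrow> (a, b) \<in> R \<or> (b, a) \<in> R"
  unfolding symcl_def by force

lemma H_graph_arcs:
  "(Clique_Vert i, Clique_Vert k) \<in> parcs (H_graph t) \<longleftrightarrow> i < t \<and> k < t \<and> i \<noteq> k"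
  "(Clique_Vert i, Path_Vert k j) \<in> parcs (H_graph t) \<longleftrightarrow> i < t \<and> i = k \<and> j \<in> {2, 3}"
  "(Path_Vert k j, Clique_Vert i) \<in> parcs (H_graph t) \<longleftrightarrow> i < t \<and> i = k \<and> j \<in> {2, 3}"
  "(Path_Vert i j, Path_Vert k l) \<in> parcs (H_graph t) \<longleftrightarrow> i < t \<and> i = k \<and> j < 6 \<and> l < 6 \<and> (l = Suc j \<or> j = Suc l)"
  unfolding H_graph_def by (auto simp: symcl_iff)

lemma H_family_labelling:
  assumes "Digraph.graph G" "claw_free G" "G \<in> H_family"
  shows "\<exists>t c p. claw_free_relation.h_labelling (verts G) (\<lambda>x y. x \<rightarrow>\<^bsub>G\<^esub> y) t c p"
proof -
  interpret C: claw_free_relation "verts G" "\<lambda>x y. x \<rightarrow>\<^bsub>G\<^esub> y" by (rule graph_claw_free_relation[OF assms(1,2)])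
  obtain t f where f: "pre_digraph.digraph_isomorphism (with_proj (H_graph t)) f"
    "G = app_iso f (with_proj (H_graph t))"
    using assms(3) unfolding H_family_def digraph_iso_def by blast
  let ?\<phi> = "iso_verts f" and ?P = "pverts (H_graph t)"
  have wf: "wf_digraph (with_proj (H_graph t))" and inj: "inj_on ?\<phi> ?P"
    using f(1) unfolding pre_digraph.digraph_isomorphism_def by auto
  interpret W: wf_digraph "with_proj (H_graph t)" by (rule wf)
  have ends: "arcs_ends G = (\<lambda>(u, v). (?\<phi> u, ?\<phi> v)) ` parcs (H_graph t)"
    unfolding f(2) using W.arcs_ends_app_iso_eq[OF f(1)] by simp
  have sub: "parcs (H_graph t) \<subseteq> ?P \<times> ?P" using W.wellformed by auto
  have adj: "?\<phi> x \<rightarrow>\<^bsub>G\<^esub> ?\<phi> y \<longleftrightarrow> (x, y) \<in> parcs (H_graph t)" if "x \<in> ?P" "y \<in> ?P" for x y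
    unfolding ends using that sub inj by (auto dest: inj_onD)
  have V: "verts G = ?\<phi> ` ?P" unfolding f(2) by simp
  have P: "Clique_Vert i \<in> ?P \<longleftrightarrow> i < t" "Path_Vert i j \<in> ?P \<longleftrightarrow> i < t \<and> j < 6" for i j
    unfolding H_graph_def by auto
  have neq: "?\<phi> x = ?\<phi> y \<longleftrightarrow> x = y" if "x \<in> ?P" "y \<in> ?P" for x y using inj that by (auto dest: inj_onD)
  have "C.h_labelling t (\<lambda>i. ?\<phi> (Clique_Vert i)) (\<lambda>i j. ?\<phi> (Path_Vert i j))"
    unfolding C.h_labelling_def
  proof (intro conjI allI impI)
    have "?P = (\<Union>i<t. insert (Clique_Vert i) (Path_Vert i ` {..<6}))" unfolding H_graph_def by auto
    then show "verts G = (\<Union>i<t. insert (?\<phi> (Clique_Vert i)) ((\<lambda>j. ?\<phi> (Path_Vert i j)) ` {..<6}))"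
      unfolding V by (simp add: image_UN image_image)
  qed (auto simp: inj_on_def neq P adj H_graph_arcs)
  then show ?thesis by blast
qed

lemma labelling_H_family:
  assumes "Digraph.graph G" "claw_free G" "1 \<le> t"
    "claw_free_relation.h_labelling (verts G) (\<lambda>x y. x \<rightarrow>\<^bsub>G\<^esub> y) t c p"
  shows "G \<in> H_family"
proof -
  interpret Digraph.graph G by fact
  interpret C: claw_free_relation "verts G" "\<lambda>x y. x \<rightarrow>\<^bsub>G\<^esub> y" by (rule graph_claw_free_relation[OF assms(1,2)])
  note h = assms(4)
  define \<phi> where "\<phi> x = (case x of Clique_Vert i \<Rightarrow> c i | Path_Vert i j \<Rightarrow> p i j)" for x
  let ?P = "pverts (H_graph t)"
  have \<phi>: "\<phi> (Clique_Vert i) = c i" "\<phi> (Path_Vert i j) = p i j" for i j unfolding \<phi>_def by auto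
  have P: "?P = (\<Union>i<t. insert (Clique_Vert i) (Path_Vert i ` {..<6}))" unfolding H_graph_def by auto
  have V: "verts G = \<phi> ` ?P" unfolding P C.h_labelling_verts[OF h] by (simp add: image_UN image_image \<phi>)
  have adj: "\<phi> x \<rightarrow>\<^bsub>G\<^esub> \<phi> y \<longleftrightarrow> (x, y) \<in> parcs (H_graph t)" if xy: "x \<in> ?P" "y \<in> ?P" for x y
  proof -
    have cp: "p k j \<rightarrow>\<^bsub>G\<^esub> c i \<longleftrightarrow> i = k \<and> j \<in> {2, 3}" if "i < t" "k < t" "j < 6" for i k j
      using C.h_labelling_tip[OF h that] C.adj_sym by blast
    obtain i k where "i < t" "k < t" "x = Clique_Vert i \<or> (\<exists>j<6. x = Path_Vert i j)"
      "y = Clique_Vert k \<or> (\<exists>l<6. y = Path_Vert k l)"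
      using xy unfolding P by auto
    then show ?thesis using cp C.h_labelling_tip[OF h] C.h_labelling_clique[OF h] C.h_labelling_path[OF h]
      by (elim disjE exE conjE) (simp_all add: \<phi> H_graph_arcs)
  qed
  have inj: "inj_on \<phi> ?P"
  proof (rule inj_onI)
    fix x y assume xy: "x \<in> ?P" "y \<in> ?P" "\<phi> x = \<phi> y"
    obtain i k where ik: "i < t" "k < t" "x = Clique_Vert i \<or> (\<exists>j<6. x = Path_Vert i j)"
      "y = Clique_Vert k \<or> (\<exists>l<6. y = Path_Vert k l)"
      using xy unfolding P by auto
    then have "\<phi> x \<in> insert (c i) (p i ` {..<6})" "\<phi> y \<in> insert (c k) (p k ` {..<6})" by (auto simp: \<phi>)
    then have "i = k" using C.h_labelling_disjoint[OF h ik(1,2)] xy(3) by (metis IntI empty_iff)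
    moreover have "inj_on (p i) {..<6}" using C.h_labelling_inj[OF h ik(1)] by simp
    moreover have "p i j \<noteq> c i" if "j < 6" for j
      using C.h_labelling_inj[OF h ik(1)] that by (metis imageI lessThan_iff)
    ultimately show "x = y" using ik(3,4) xy(3)
      by (elim disjE exE conjE) (auto simp: \<phi> dest: inj_onD)
  qed
  have sub: "x \<in> ?P \<and> y \<in> ?P" if "(x, y) \<in> parcs (H_graph t)" for x y
    using that unfolding H_graph_def by (auto simp: symcl_iff)
  \<comment> \<open>Arcs of \<open>G\<close> have an arbitrary type, so the arc over a pair of
    labels is chosen; excluding parallel arcs makes it unique.\<close>
  define \<psi> where "\<psi> a = (SOME e. e \<in> arcs G \<and> tail G e = \<phi> (fst a) \<and> head G e = \<phi> (snd a))" for a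
  have \<psi>: "\<psi> a \<in> arcs G \<and> tail G (\<psi> a) = \<phi> (fst a) \<and> head G (\<psi> a) = \<phi> (snd a)" if a: "a \<in> parcs (H_graph t)"
    for a
  proof -
    have "\<phi> (fst a) \<rightarrow>\<^bsub>G\<^esub> \<phi> (snd a)" using adj[of "fst a" "snd a"] sub[of "fst a" "snd a"] a by simp
    then have "\<exists>e. e \<in> arcs G \<and> tail G e = \<phi> (fst a) \<and> head G e = \<phi> (snd a)"
      by (auto simp: arcs_ends_def arc_to_ends_def)
    then show ?thesis unfolding \<psi>_def by (rule someI_ex)
  qed
  \<comment> \<open>\<open>app_iso\<close> takes head and tail from the isomorphism record; those of
    \<open>G\<close> make the image equal to \<open>G\<close> as a record.\<close>
  define f where "f = \<lparr>iso_verts = \<phi>, iso_arcs = \<psi>, iso_head = head G, iso_tail = tail G\<rparr>"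
  have "pre_digraph.digraph_isomorphism (with_proj (H_graph t)) f"
    unfolding pre_digraph.digraph_isomorphism_def
  proof (intro conjI)
    show "wf_digraph (with_proj (H_graph t))" by unfold_locales (use sub in auto)
    show "inj_on (iso_verts f) (verts (with_proj (H_graph t)))" using inj unfolding f_def by simp
    show "inj_on (iso_arcs f) (arcs (with_proj (H_graph t)))"
    proof (rule inj_onI)
      fix a b assume ab: "a \<in> arcs (with_proj (H_graph t))" "b \<in> arcs (with_proj (H_graph t))"
        "iso_arcs f a = iso_arcs f b"
      then have ab': "a \<in> parcs (H_graph t)" "b \<in> parcs (H_graph t)" "\<psi> a = \<psi> b" unfolding f_def by auto
      then have "\<phi> (fst a) = \<phi> (fst b)" "\<phi> (snd a) = \<phi> (snd b)" using \<psi> by metis+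
      then show "a = b" using inj sub[of "fst a" "snd a"] sub[of "fst b" "snd b"] ab'
        by (auto simp: prod_eq_iff dest: inj_onD)
    qed
  qed (use \<psi> in \<open>auto simp: f_def\<close>)
  moreover have "G = app_iso f (with_proj (H_graph t))"
  proof (rule pre_digraph.equality)
    have "arcs G \<subseteq> \<psi> ` parcs (H_graph t)"
    proof
      fix e assume e: "e \<in> arcs G"
      then obtain x y where xy: "x \<in> ?P" "y \<in> ?P" "tail G e = \<phi> x" "head G e = \<phi> y"
        using V tail_in_verts[OF e] head_in_verts[OF e] by auto
      then have "\<phi> x \<rightarrow>\<^bsub>G\<^esub> \<phi> y" using e by (auto simp: arcs_ends_def arc_to_ends_def intro!: rev_image_eqI)
      then have a: "(x, y) \<in> parcs (H_graph t)" using adj xy by blast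
      have "\<psi> (x, y) = e" using \<psi>[OF a] e xy by (intro no_multi_arcs) (auto simp: arc_to_ends_def)
      then show "e \<in> \<psi> ` parcs (H_graph t)" using a by blast
    qed
    then show "arcs G = arcs (app_iso f (with_proj (H_graph t)))" using \<psi> unfolding f_def by auto
  qed (use V in \<open>auto simp: f_def\<close>)
  ultimately have "digraph_iso (with_proj (H_graph t)) G" unfolding digraph_iso_def by blast
  then show ?thesis unfolding H_family_def using assms(3) by blast
qed

theorem mainTheorem3:
  fixes G :: "('a, 'b) pre_digraph"
  assumes "Digraph.graph G"
    and "Digraph_Component.connected G"
    and "claw_free G"
    and "card (verts G) > 14"
  shows "real (disj_total_dom_number G) \<le> 4 * real (card (verts G)) / 7 \<and>
    (real (disj_total_dom_number G) = 4 * real (card (verts G)) / 7 \<longleftrightarrow> G \<in> H_family)"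
proof -
  interpret Digraph.graph G by fact
  interpret C: claw_free_relation "verts G" "\<lambda>x y. x \<rightarrow>\<^bsub>G\<^esub> y" by (rule graph_claw_free_relation[OF assms(1,3)])
  let ?n = "card (verts G)" and ?d = "disj_total_dom_number G"
  note dtd = disj_total_dominating_iff[OF assms(1,3)]
  have con: "C.con (verts G)" by (rule connected_graph_con[OF assms(1,3,2)])
  have fin: "finite (card ` {S. disj_total_dominating G S})"
    by (rule finite_imageI, rule finite_subset[of _ "Pow (verts G)"]) (auto simp: dtd)
  have upper: "?d \<le> k" if cost: "C.cost (verts G) k" for k
  proof -
    obtain S where S: "S \<subseteq> verts G" "card S \<le> k" "C.covers (verts G) S" using cost unfolding C.cost_def
      by (elim exE conjE)
    then have "S \<in> {S. disj_total_dominating G S}" using dtd by simp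
    then have "?d \<le> card S" unfolding disj_total_dom_number_def by (rule Min_le[OF fin imageI])
    then show ?thesis using S by simp
  qed
  \<comment> \<open>The exceptional graph has only ten vertices.\<close>
  have "\<not> C.netlike (verts G)" using C.netlike_cost(2) assms(4) by fastforce
  then have fine: "C.fine (verts G)" using C.connected_fine[OF con] assms(4) by auto
  then obtain k where k: "7 * k \<le> 4 * ?n" "C.cost (verts G) k" using C.fine_cost by blast
  have le: "7 * ?d \<le> 4 * ?n" using upper[OF k(2)] k(1) by linarith
  obtain S where S: "S \<subseteq> verts G" "C.covers (verts G) S" "card S = ?d"
  proof -
    have "{S. disj_total_dominating G S} \<noteq> {}" using k(2) dtd unfolding C.cost_def by blast
    then have "?d \<in> card ` {S. disj_total_dominating G S}"
      unfolding disj_total_dom_number_def by (intro Min_in[OF fin]) simp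
    then show thesis using that dtd by auto
  qed
  have "7 * ?d = 4 * ?n \<longleftrightarrow> G \<in> H_family"
  proof
    assume eq: "7 * ?d = 4 * ?n"
    have ng: "\<not> C.good (verts G)"
    proof
      assume "C.good (verts G)"
      then obtain l where "7 * l < 4 * ?n" "C.cost (verts G) l" unfolding C.good_def by blast
      then show False using upper eq by fastforce
    qed
    then obtain P where P: "C.unit_partition P (verts G)" using fine unfolding C.fine_def C.decomposable_def
      by blast
    \<comment> \<open>Units have order 7, so more than 14 vertices means at least three of
      them.\<close>
    then have "3 \<le> card P" using C.unit_partition_cost(1)[OF P] assms(4) by linarith
    then show "G \<in> H_family"
      using C.tight_labelling[OF P ng con] labelling_H_family[OF assms(1,3), of "card P"] by auto
  next
    assume "G \<in> H_family"
    then obtain t c p where h: "C.h_labelling t c p" using H_family_labelling[OF assms(1,3)] by blast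
    show "7 * ?d = 4 * ?n" using C.h_labelling_cover_lower[OF h S(1,2)] S(3) C.h_labelling_card[OF h] le
      by linarith
  qed
  moreover have "real ?d \<le> 4 * real ?n / 7 \<longleftrightarrow> 7 * ?d \<le> 4 * ?n" "real ?d = 4 * real ?n / 7 \<longleftrightarrow> 7 * ?d = 4 * ?n"
    by linarith+
  ultimately show ?thesis using le by blast
qed

end
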